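(* Let $n\ge 2$, let $\Omega\subset\mathbb{R}^n$ be a regular domain, let $f\in C^1$, let $\kappa$ be a constant, and let $u\in C^3(\Omega)$ be a bounded solution of $$\begin{cases}\Delta u+f(u)=0 & \text{in }\Omega,\\ u>0 & \text{in }\Omega,\\ u=0 & \text{on }\partial\Omega,\\ \partial_\nu u=-\kappa & \text{on }\partial\Omega.\end{cases}$$ Suppose that there exists a non-positive primitive $F$ of $f$ (that is, $F'=f$ and $F\le 0$) such that $$\kappa^2+2F(0)\ge 0 .$$ Then one of the following holds: either $H(p)<0$ for every $p\in\partial\Omega$, or $\Omega$ is a half-space and $u$ is $1$-dimensional, i.e. there exist $x_0\in\mathbb{R}^n$, a function $g:[0,+\infty)\to\mathbb{R}$ and a vector $\vec a\in\mathbb{R}^n$ such that $$\Omega=\{x\in\mathbb{R}^n:\ \vec a\cdot(x-x_0)>0\}\quad\text{and}\quad u(x)=g(\vec a\cdot(x-x_0))\ \text{ for all } x\in\Omega .$$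
   Context: A regular domain is a connected open set $\Omega\subset\mathbb{R}^n$, bounded or not, with nonempty smooth boundary. $\nu$ denotes the outward unit normal to $\partial\Omega$. The boundary conditions are understood in the classical sense ($u$ is of class $C^1$ up to $\partial\Omega$). The function $f:\mathbb{R}\to\mathbb{R}$ is a given nonlinearity. $H(p)$ denotes the mean curvature of $\partial\Omega$ at $p$, normalized as the average of the principal curvatures, with the sign convention that $H>0$ on the boundary of a ball; equivalently, $\Delta u=\partial^2_{\nu\nu}u+(n-1)H\,\partial_\nu u$ on $\partial\Omega$ for functions $u$ that are constant on $\partial\Omega$. *)

theory Defs
  imports "HOL-Analysis.Analysis"
begin

section \<open>Regularity classes and the Laplacian\<close>

text \<open>Intended for open \<open>S\<close>, where the Frechet derivative at a point of \<open>S\<close> depends only on \<open>f\<close> in \<open>S\<close>.\<close>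

primrec Ck_on :: "nat \<Rightarrow> 'a::real_normed_vector set \<Rightarrow> ('a \<Rightarrow> 'b::real_normed_vector) \<Rightarrow> bool" where
  "Ck_on 0 S f \<longleftrightarrow> continuous_on S f"
| "Ck_on (Suc k) S f \<longleftrightarrow> (\<forall>x\<in>S. f differentiable (at x)) \<and>
     (\<forall>v. Ck_on k S (\<lambda>x. frechet_derivative f (at x) v))"

definition smooth_on :: "'a::real_normed_vector set \<Rightarrow> ('a \<Rightarrow> 'b::real_normed_vector) \<Rightarrow> bool" where
  "smooth_on S f \<longleftrightarrow> (\<forall>k. Ck_on k S f)"

text \<open>Class \<open>C\<^sup>1\<close> up to the boundary: \<open>u\<close> and its gradient in \<open>\<Omega>\<close> extend continuously to the closure,
  the boundary values of \<open>u\<close> being those of the extension.\<close>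

definition C1_up_to_boundary :: "'a::real_inner set \<Rightarrow> ('a \<Rightarrow> real) \<Rightarrow> bool" where
  "C1_up_to_boundary \<Omega> u \<longleftrightarrow> continuous_on (closure \<Omega>) u \<and>
     (\<exists>G. continuous_on (closure \<Omega>) G \<and> (\<forall>x\<in>\<Omega>. GDERIV u x :> G x))"

definition laplacian :: "('a::euclidean_space \<Rightarrow> real) \<Rightarrow> 'a \<Rightarrow> real" where
  "laplacian u x =
     (\<Sum>b\<in>Basis. frechet_derivative (\<lambda>y. frechet_derivative u (at y) b) (at x) b)"


section \<open>Regular domains and the geometry of their boundary\<close>

text \<open>Smoothness of the boundary: near each boundary point \<open>\<Omega>\<close> is the sublevel set of a smooth
  function without critical points. In particular \<open>\<Omega>\<close> lies locally on one side of its boundary,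
  which is locally the zero set of that function.\<close>

definition smooth_boundary :: "'a::euclidean_space set \<Rightarrow> bool" where
  "smooth_boundary \<Omega> \<longleftrightarrow> (\<forall>p\<in>frontier \<Omega>. \<exists>U (\<phi> :: 'a \<Rightarrow> real).
     open U \<and> p \<in> U \<and> smooth_on U \<phi> \<and>
     (\<forall>x\<in>U. \<exists>v. frechet_derivative \<phi> (at x) v \<noteq> 0) \<and>
     \<Omega> \<inter> U = {x \<in> U. \<phi> x < 0})"

definition regular_domain :: "'a::euclidean_space set \<Rightarrow> bool" where
  "regular_domain \<Omega> \<longleftrightarrow> open \<Omega> \<and> connected \<Omega> \<and> frontier \<Omega> \<noteq> {} \<and> smooth_boundary \<Omega>"

text \<open>Velocities at \<open>p\<close> of curves in the boundary. Only differentiability at time 0 is required of the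
  curve; on a smooth hypersurface this gives the usual tangent space.\<close>

definition boundary_tangent_space :: "'a::euclidean_space set \<Rightarrow> 'a \<Rightarrow> 'a set" where
  "boundary_tangent_space \<Omega> p =
     {v. \<exists>\<gamma> :: real \<Rightarrow> 'a. \<gamma> 0 = p \<and> (\<forall>t. \<gamma> t \<in> frontier \<Omega>) \<and> (\<gamma> has_vector_derivative v) (at 0)}"

definition outward_normal :: "'a::euclidean_space set \<Rightarrow> 'a \<Rightarrow> 'a" where
  "outward_normal \<Omega> p = (THE v. norm v = 1 \<and> (\<forall>w\<in>boundary_tangent_space \<Omega> p. v \<bullet> w = 0) \<and>
     (\<forall>\<^sub>F t in at_right 0. p - t *\<^sub>R v \<in> \<Omega> \<and> p + t *\<^sub>R v \<notin> \<Omega>))"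

text \<open>The normal derivative at a boundary point is one-sided, taken along the part of the normal line
  inside \<open>\<Omega>\<close>.\<close>

definition has_normal_derivative :: "('a::euclidean_space \<Rightarrow> real) \<Rightarrow> 'a set \<Rightarrow> 'a \<Rightarrow> real \<Rightarrow> bool" where
  "has_normal_derivative u \<Omega> p c \<longleftrightarrow>
     ((\<lambda>t. u (p + t *\<^sub>R outward_normal \<Omega> p)) has_real_derivative c) (at_left 0)"

text \<open>The differential \<open>A\<close> of the Gauss map \<open>\<nu>\<close> along the boundary is determined only on the tangent
  space, which contains \<open>E\<close>. \<open>E\<close> is an orthonormal basis of the tangent space consisting of
  eigenvectors (principal directions), and \<open>k e\<close> is the principal curvature in direction \<open>e\<close>, so that
  \<open>k\<close> on \<open>E\<close> lists the principal curvatures with multiplicity. Since \<open>\<nu>\<close> is outward, they are positive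
  on the boundary of a ball.\<close>

definition principal_curvatures ::
    "'a::euclidean_space set \<Rightarrow> 'a \<Rightarrow> 'a set \<Rightarrow> ('a \<Rightarrow> real) \<Rightarrow> bool" where
  "principal_curvatures \<Omega> p E k \<longleftrightarrow>
     pairwise orthogonal E \<and> (\<forall>e\<in>E. norm e = 1) \<and> span E = boundary_tangent_space \<Omega> p \<and>
     (\<exists>A. (outward_normal \<Omega> has_derivative A) (at p within frontier \<Omega>) \<and>
          (\<forall>e\<in>E. A e = k e *\<^sub>R e))"

definition mean_curvature :: "'a::euclidean_space set \<Rightarrow> 'a \<Rightarrow> real" where
  "mean_curvature \<Omega> p = (THE h. \<exists>E k. principal_curvatures \<Omega> p E k \<and>
     h = (\<Sum>e\<in>E. k e) / (real DIM('a) - 1))"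

end

theory Submission
  imports Defs "HOL-Analysis.Analysis"
begin

text \<open>Put \<open>P = |\<nabla>u|\<^sup>2 + 2 F(u)\<close> and \<open>K = \<kappa>\<^sup>2 + 2 F(0)\<close>, so that \<open>P = K\<close> on the boundary. A
  Bernstein argument bounds \<open>\<nabla>u\<close>, a maximum principle then gives Modica's estimate \<open>P \<le> K\<close>, and by the
  strong maximum principle either \<open>P < K\<close> in \<open>\<Omega>\<close> or \<open>P = K\<close> throughout. In the second case
  \<open>\<nabla>u\<close> has constant direction and \<open>\<Omega>\<close> is a half-space. In the first case, with \<open>\<Psi>' = (K - 2F)\<^sup>-\<^sup>1\<^sup>/\<^sup>2\<close>,
  the function \<open>U = \<Psi>(u)\<close> vanishes on the boundary, has slope 1 there, satisfies \<open>|\<nabla>U| \<le> 1\<close>, and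
  \<open>\<Delta>U\<close> tends to 0 at the boundary. Hopf's lemma for \<open>K - P\<close> improves \<open>U \<le> dist\<close> to
  \<open>U \<le> dist - \<epsilon> dist\<^sup>2\<close> near a boundary point \<open>p\<close>. If \<open>H(p) \<ge> 0\<close>, then \<open>dist - \<epsilon> dist\<^sup>2 - U\<close> is superharmonic
  near \<open>p\<close>, and Hopf's lemma contradicts the equality of normal derivatives at \<open>p\<close>. No second derivative of
  \<open>u\<close> is evaluated on the boundary, so \<open>C\<^sup>1\<close> up to the boundary is enough.\<close>

section \<open>Gradient and Laplacian\<close>

text \<open>The sign conditions on \<open>F\<close> and \<open>K\<close> act through one inequality:
  where \<open>P > K \<ge> 0\<close>, \<open>F \<le> 0\<close> gives \<open>w \<ge> P > 0\<close>,
  so the differential inequality for \<open>P\<close>, which degenerates at critical points of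
  \<open>u\<close>, can be used there. At \<open>K = 0\<close> critical points with
  \<open>P = K\<close> need a separate argument, and \<kappa> = 0 is excluded by Hopf's lemma for
  \<open>u\<close> itself. The quadratic gain over \<open>U \<le> dist\<close> settles the
  borderline case \<open>H(p) = 0\<close>. Hopf's lemma bounds \<open>K - P\<close> below by a
  multiple of \<open>l\<close>, the defining function of an interior tangent ball, so
  \<open>|\<nabla>U|\<close> is at most \<open>1 - k' l\<close>. Along segments parallel to the
  normal this integrates to a gain of order \<open>l * l\<close>, whose Laplacian is strictly
  positive at \<open>p\<close>. This pays for the Taylor error of the boundary and for the Laplacian
  of \<open>U\<close>. Regularity of the distance function is avoided by measuring the way to the
  boundary in the fixed direction \<nu>, with an explicit quadratic polynomial in place of the
  distance.\<close>

abbreviation trace :: "('a::euclidean_space \<Rightarrow> 'a) \<Rightarrow> real" where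
  "trace A \<equiv> (\<Sum>b\<in>Basis. A b \<bullet> b)"

text \<open>The gradient is only required to be differentiable at each point, without continuity of
  second derivatives. Carrying \<open>g\<close> and \<open>L\<close> as data lets the sum, product
  and chain rules below compute Laplacians of composite test functions.\<close>

definition grad_lap_on ::
    "'a::euclidean_space set \<Rightarrow> ('a \<Rightarrow> real) \<Rightarrow> ('a \<Rightarrow> 'a) \<Rightarrow> ('a \<Rightarrow> real) \<Rightarrow> bool" where
  "grad_lap_on S q g L \<longleftrightarrow> (\<forall>x\<in>S. GDERIV q x :> g x \<and>
     (\<exists>H. (g has_derivative H) (at x) \<and> trace H = L x))"

lemma grad_lap_onD:
  assumes "grad_lap_on S q g L" "x \<in> S"
  shows "GDERIV q x :> g x" and "isCont q x"
  using assms unfolding grad_lap_on_def gderiv_def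
  by (blast intro: has_derivative_continuous)+

lemma grad_lap_on_subset: "grad_lap_on S q g L \<Longrightarrow> T \<subseteq> S \<Longrightarrow> grad_lap_on T q g L"
  unfolding grad_lap_on_def by blast

lemma grad_lap_on_eq:
  assumes "grad_lap_on S q g L" "\<And>x. q x = q' x" "\<And>x. g x = g' x" "\<And>x. x \<in> S \<Longrightarrow> L x = L' x"
  shows "grad_lap_on S q' g' L'"
proof -
  have "q = q'" "g = g'" using assms by auto
  then show ?thesis using assms unfolding grad_lap_on_def by auto
qed

lemma grad_lap_on_add:
  assumes "grad_lap_on S q1 g1 L1" "grad_lap_on S q2 g2 L2"
  shows "grad_lap_on S (\<lambda>x. q1 x + q2 x) (\<lambda>x. g1 x + g2 x) (\<lambda>x. L1 x + L2 x)"
  unfolding grad_lap_on_def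
proof (intro ballI conjI)
  fix x assume x: "x \<in> S"
  show "GDERIV (\<lambda>x. q1 x + q2 x) x :> g1 x + g2 x"
    using assms x by (intro GDERIV_add) (auto simp: grad_lap_on_def)
  obtain H1 H2 where H: "(g1 has_derivative H1) (at x)" "(\<Sum>b\<in>Basis. H1 b \<bullet> b) = L1 x"
    "(g2 has_derivative H2) (at x)" "(\<Sum>b\<in>Basis. H2 b \<bullet> b) = L2 x"
    using assms x unfolding grad_lap_on_def by blast
  show "\<exists>H. ((\<lambda>x. g1 x + g2 x) has_derivative H) (at x) \<and> trace H = L1 x + L2 x"
    using H by (intro exI[of _ "\<lambda>h. H1 h + H2 h"])
      (auto intro!: derivative_eq_intros simp: inner_add_left sum.distrib)
qed

lemma grad_lap_on_const: "grad_lap_on S (\<lambda>x. c) (\<lambda>x. 0) (\<lambda>x. 0)"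
  unfolding grad_lap_on_def by (auto intro!: GDERIV_const exI[of _ "\<lambda>_. 0"])

lemma grad_lap_on_mult:
  assumes "grad_lap_on S q1 g1 L1" "grad_lap_on S q2 g2 L2"
  shows "grad_lap_on S (\<lambda>x. q1 x * q2 x) (\<lambda>x. q1 x *\<^sub>R g2 x + q2 x *\<^sub>R g1 x)
    (\<lambda>x. q1 x * L2 x + q2 x * L1 x + 2 * (g1 x \<bullet> g2 x))"
  unfolding grad_lap_on_def
proof (intro ballI conjI)
  fix x assume x: "x \<in> S"
  show "GDERIV (\<lambda>x. q1 x * q2 x) x :> q1 x *\<^sub>R g2 x + q2 x *\<^sub>R g1 x"
    using assms x by (intro GDERIV_mult) (auto simp: grad_lap_on_def)
  obtain H1 H2 where H: "(g1 has_derivative H1) (at x)" "(\<Sum>b\<in>Basis. H1 b \<bullet> b) = L1 x"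
    "(g2 has_derivative H2) (at x)" "(\<Sum>b\<in>Basis. H2 b \<bullet> b) = L2 x"
    using assms x unfolding grad_lap_on_def by blast
  have d: "(q1 has_derivative (\<lambda>h. h \<bullet> g1 x)) (at x)" "(q2 has_derivative (\<lambda>h. h \<bullet> g2 x)) (at x)"
    using assms x unfolding grad_lap_on_def gderiv_def by blast+
  define H where "H h = (q1 x *\<^sub>R H2 h + (h \<bullet> g1 x) *\<^sub>R g2 x) + (q2 x *\<^sub>R H1 h + (h \<bullet> g2 x) *\<^sub>R g1 x)" for h
  have "((\<lambda>x. q1 x *\<^sub>R g2 x + q2 x *\<^sub>R g1 x) has_derivative H) (at x)"
    unfolding H_def using H d by (intro has_derivative_add has_derivative_scaleR)
  moreover have "trace H = q1 x * L2 x + q2 x * L1 x + 2 * (g1 x \<bullet> g2 x)"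
    unfolding H_def H(2)[symmetric] H(4)[symmetric] euclidean_inner[of "g1 x" "g2 x"]
    by (simp add: algebra_simps inner_add_left sum.distrib sum_distrib_left)
      (simp add: inner_commute algebra_simps sum_distrib_left)
  ultimately show "\<exists>H. ((\<lambda>x. q1 x *\<^sub>R g2 x + q2 x *\<^sub>R g1 x) has_derivative H) (at x) \<and>
      trace H = q1 x * L2 x + q2 x * L1 x + 2 * (g1 x \<bullet> g2 x)" by blast
qed

lemma grad_lap_on_cmult:
  assumes "grad_lap_on S q g L"
  shows "grad_lap_on S (\<lambda>x. c * q x) (\<lambda>x. c *\<^sub>R g x) (\<lambda>x. c * L x)"
  by (rule grad_lap_on_eq[OF grad_lap_on_mult[OF grad_lap_on_const[of S c] assms]]) auto

lemma grad_lap_on_diff: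
  assumes "grad_lap_on S q1 g1 L1" "grad_lap_on S q2 g2 L2"
  shows "grad_lap_on S (\<lambda>x. q1 x - q2 x) (\<lambda>x. g1 x - g2 x) (\<lambda>x. L1 x - L2 x)"
  by (rule grad_lap_on_eq[OF grad_lap_on_add[OF assms(1) grad_lap_on_cmult[OF assms(2), of "-1"]]]) auto

lemma grad_lap_on_sum:
  assumes "finite I" "\<And>i. i \<in> I \<Longrightarrow> grad_lap_on S (q i) (g i) (L i)"
  shows "grad_lap_on S (\<lambda>x. \<Sum>i\<in>I. q i x) (\<lambda>x. \<Sum>i\<in>I. g i x) (\<lambda>x. \<Sum>i\<in>I. L i x)"
  using assms by (induction I rule: finite_induct) (auto intro: grad_lap_on_const grad_lap_on_add)

lemma grad_lap_on_compose:
  fixes \<psi> :: "real \<Rightarrow> real"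
  assumes "grad_lap_on S q g L"
    and "\<And>x. x \<in> S \<Longrightarrow> (\<psi> has_real_derivative \<psi>' (q x)) (at (q x))"
    and "\<And>x. x \<in> S \<Longrightarrow> (\<psi>' has_real_derivative \<psi>'' (q x)) (at (q x))"
  shows "grad_lap_on S (\<lambda>x. \<psi> (q x)) (\<lambda>x. \<psi>' (q x) *\<^sub>R g x)
    (\<lambda>x. \<psi>' (q x) * L x + \<psi>'' (q x) * (g x \<bullet> g x))"
  unfolding grad_lap_on_def
proof (intro ballI conjI)
  fix x assume x: "x \<in> S"
  show "GDERIV (\<lambda>x. \<psi> (q x)) x :> \<psi>' (q x) *\<^sub>R g x"
    using assms x by (intro GDERIV_DERIV_compose) (auto simp: grad_lap_on_def)
  obtain H where H: "(g has_derivative H) (at x)" "trace H = L x"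
    using assms x unfolding grad_lap_on_def by blast
  have d: "(q has_derivative (\<lambda>h. h \<bullet> g x)) (at x)"
    using assms x unfolding grad_lap_on_def gderiv_def by blast
  have d2: "((\<lambda>x. \<psi>' (q x)) has_derivative (\<lambda>h. \<psi>'' (q x) * (h \<bullet> g x))) (at x)"
    using has_derivative_compose[OF d, of \<psi>' "(*) (\<psi>'' (q x))"] assms(3)[OF x]
    unfolding has_field_derivative_def .
  define H' where "H' h = \<psi>' (q x) *\<^sub>R H h + (\<psi>'' (q x) * (h \<bullet> g x)) *\<^sub>R g x" for h
  have "((\<lambda>x. \<psi>' (q x) *\<^sub>R g x) has_derivative H') (at x)"
    unfolding H'_def using H d2 by (intro has_derivative_scaleR)
  moreover have "(\<Sum>b\<in>Basis. H' b \<bullet> b) = \<psi>' (q x) * L x + \<psi>'' (q x) * (g x \<bullet> g x)"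
    unfolding H'_def H(2)[symmetric] euclidean_inner[of "g x" "g x"]
    by (simp add: algebra_simps inner_add_left sum.distrib sum_distrib_left)
      (simp add: inner_commute algebra_simps sum_distrib_left)
  ultimately show "\<exists>H. ((\<lambda>x. \<psi>' (q x) *\<^sub>R g x) has_derivative H) (at x) \<and>
      trace H = \<psi>' (q x) * L x + \<psi>'' (q x) * (g x \<bullet> g x)" by blast
qed

lemma grad_lap_on_quadratic:
  fixes A :: "'a::euclidean_space \<Rightarrow> 'a"
  assumes "bounded_linear A" "\<And>x y. A x \<bullet> y = x \<bullet> A y"
  shows "grad_lap_on S (\<lambda>x. A (x - c) \<bullet> (x - c)) (\<lambda>x. 2 *\<^sub>R A (x - c)) (\<lambda>x. 2 * trace A)"
proof -
  interpret A: bounded_linear A by fact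
  have d: "((\<lambda>x. A (x - c)) has_derivative A) (at x)" for x
    by (rule A.has_derivative) (auto intro!: derivative_eq_intros)
  show ?thesis unfolding grad_lap_on_def gderiv_def
  proof (intro ballI conjI)
    fix x
    show "((\<lambda>x. A (x - c) \<bullet> (x - c)) has_derivative (\<lambda>h. h \<bullet> (2 *\<^sub>R A (x - c)))) (at x)"
    proof -
      have "((\<lambda>x. x - c) has_derivative (\<lambda>h. h)) (at x)" by (auto intro!: derivative_eq_intros)
      from has_derivative_inner[OF d this] show ?thesis
        by (rule has_derivative_eq_rhs) (simp add: assms(2)[of _ "x - c"] inner_commute[of "A (x - c)"] fun_eq_iff)
    qed
    show "\<exists>H. ((\<lambda>x. 2 *\<^sub>R A (x - c)) has_derivative H) (at x) \<and>
        trace H = 2 * trace A"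
      by (intro exI[of _ "\<lambda>h. 2 *\<^sub>R A h"])
        (auto intro!: derivative_eq_intros d simp: sum_distrib_left)
  qed
qed

lemma grad_lap_on_sq_norm:
  fixes c :: "'a::euclidean_space"
  shows "grad_lap_on S (\<lambda>x. (x - c) \<bullet> (x - c)) (\<lambda>x. 2 *\<^sub>R (x - c)) (\<lambda>x. 2 * real DIM('a))"
  by (rule grad_lap_on_eq[OF grad_lap_on_quadratic[OF bounded_linear_ident, of S c]]) auto

lemma grad_lap_on_linear:
  fixes a :: "'a::euclidean_space"
  shows "grad_lap_on S (\<lambda>x. a \<bullet> (x - c)) (\<lambda>x. a) (\<lambda>x. 0)"
  unfolding grad_lap_on_def gderiv_def
  by (auto intro!: derivative_eq_intros exI[of _ "\<lambda>_. 0"] simp: inner_commute)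

lemma GDERIV_line:
  assumes "GDERIV q (x + t *\<^sub>R v) :> g"
  shows "((\<lambda>t. q (x + t *\<^sub>R v)) has_real_derivative g \<bullet> v) (at t)"
proof -
  have "((\<lambda>t. q (x + t *\<^sub>R v)) has_derivative (\<lambda>h. (h *\<^sub>R v) \<bullet> g)) (at t)"
    by (rule has_derivative_compose[of "\<lambda>t. x + t *\<^sub>R v" _ _ _ q "\<lambda>h. h \<bullet> g"])
      (use assms in \<open>auto intro!: derivative_eq_intros simp: gderiv_def\<close>)
  then show ?thesis unfolding has_field_derivative_def
    by (simp add: inner_commute mult.commute[of _ "g \<bullet> v"] fun_eq_iff)
qed

text \<open>If \<open>H b \<bullet> b\<close> were positive for a basis vector \<open>b\<close>, the
  slope of \<open>q\<close> along \<open>b\<close> would be positive just beyond \<open>z\<close>,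
  and the mean value theorem would give a value above \<open>q z\<close>. Only the derivative of
  \<open>g\<close> at \<open>z\<close> enters.\<close>

lemma grad_lap_on_local_max:
  assumes gl: "grad_lap_on S q g L" and S: "open S" "z \<in> S" and max: "\<And>x. x \<in> S \<Longrightarrow> q x \<le> q z"
  shows "g z = 0" and "L z \<le> 0"
proof -
  have gd: "GDERIV q x :> g x" if "x \<in> S" for x using grad_lap_onD(1)[OF gl that] .
  obtain r where r: "r > 0" "ball z r \<subseteq> S" using S open_contains_ball by blast
  have "(q has_derivative (\<lambda>h. h \<bullet> g z)) (at z)" using gd[OF S(2)] unfolding gderiv_def .
  from differential_zero_maxmin[OF S(2,1) this] max
  have "(\<lambda>h. h \<bullet> g z) = (\<lambda>h. 0)" by auto
  then show g0: "g z = 0" by (metis inner_eq_zero_iff)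
  obtain H where H: "(g has_derivative H) (at z)" "trace H = L z"
    using gl S unfolding grad_lap_on_def by blast
  have "H b \<bullet> b \<le> 0" if b: "b \<in> Basis" for b
  proof (rule ccontr)
    assume "\<not> H b \<bullet> b \<le> 0"
    then have pos: "H b \<bullet> b > 0" by simp
    have bl: "bounded_linear H" using H(1) by (rule has_derivative_bounded_linear)
    interpret H: bounded_linear H by (rule bl)
    have "((\<lambda>t. g (z + t *\<^sub>R b)) has_derivative (\<lambda>h. H (h *\<^sub>R b))) (at 0)"
      by (rule has_derivative_compose[where g=g]) (auto intro!: derivative_eq_intros H(1))
    then have "((\<lambda>t. g (z + t *\<^sub>R b) \<bullet> b) has_derivative (\<lambda>h. H (h *\<^sub>R b) \<bullet> b)) (at 0)"
      by (rule has_derivative_inner_left)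
    then have "((\<lambda>t. g (z + t *\<^sub>R b) \<bullet> b) has_real_derivative (H b \<bullet> b)) (at 0)"
      unfolding has_field_derivative_def by (simp add: H.scaleR mult.commute[of _ "H b \<bullet> b"] fun_eq_iff)
    from DERIV_pos_inc_right[OF this pos] g0 obtain d where d: "d > 0"
      "\<And>h. 0 < h \<Longrightarrow> h < d \<Longrightarrow> g (z + h *\<^sub>R b) \<bullet> b > 0" by auto
    define t where "t = min (d/2) (r/2)"
    have t: "0 < t" "t < d" "t < r" using d(1) r(1) unfolding t_def by auto
    have inS: "z + s *\<^sub>R b \<in> S" if "0 \<le> s" "s \<le> t" for s
    proof -
      have "norm b = 1" using b by simp
      then have "dist z (z + s *\<^sub>R b) = s" using that by (simp add: dist_norm)
      then show ?thesis using that t r(2) by auto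
    qed
    have "\<exists>s. s > 0 \<and> s < t \<and> q (z + t *\<^sub>R b) - q (z + 0 *\<^sub>R b) = (t - 0) * (g (z + s *\<^sub>R b) \<bullet> b)"
      by (rule MVT2) (auto intro!: t GDERIV_line gd inS)
    then obtain s where s: "0 < s" "s < t" "q (z + t *\<^sub>R b) - q z = t * (g (z + s *\<^sub>R b) \<bullet> b)" by auto
    have "t * (g (z + s *\<^sub>R b) \<bullet> b) > 0" using d(2)[of s] s t by simp
    then show False using max[OF inS[of t]] s t by simp
  qed
  then show "L z \<le> 0" unfolding H(2)[symmetric] by (rule sum_nonpos)
qed

text \<open>The starting point may be a boundary point, where \<open>q\<close> is merely continuous.
  This is the link between boundary values and gradients inside.\<close>

lemma mean_value_segment:
  fixes q :: "'a::euclidean_space \<Rightarrow> real"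
  assumes t: "t > 0" and inT: "\<And>s. 0 < s \<Longrightarrow> s \<le> t \<Longrightarrow> x + s *\<^sub>R v \<in> T" and x: "x \<in> closure T"
    and cont: "continuous_on (closure T) q" and gd: "\<And>x. x \<in> T \<Longrightarrow> GDERIV q x :> g x"
  obtains s where "0 < s" "s < t" "q (x + t *\<^sub>R v) - q x = t * (g (x + s *\<^sub>R v) \<bullet> v)"
proof -
  have cl: "x + s *\<^sub>R v \<in> closure T" if "0 \<le> s" "s \<le> t" for s
    using inT[of s] that x closure_subset by (cases "s = 0") auto
  have "continuous_on {0..t} (\<lambda>s. q (x + s *\<^sub>R v))"
    by (rule continuous_on_compose2[OF cont]) (use cl in \<open>auto intro!: continuous_intros\<close>)
  moreover have "(\<lambda>s. q (x + s *\<^sub>R v)) differentiable (at s)" if "0 < s" "s < t" for s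
    using GDERIV_line[OF gd[OF inT[of s]]] that unfolding real_differentiable_def by force
  ultimately have "\<exists>l z. 0 < z \<and> z < t \<and> ((\<lambda>s. q (x + s *\<^sub>R v)) has_real_derivative l) (at z) \<and>
      q (x + t *\<^sub>R v) - q (x + 0 *\<^sub>R v) = (t - 0) * l"
    by (intro MVT t)
  then obtain l z where z: "0 < z" "z < t" "((\<lambda>s. q (x + s *\<^sub>R v)) has_real_derivative l) (at z)"
    "q (x + t *\<^sub>R v) - q x = t * l" by auto
  have zT: "x + z *\<^sub>R v \<in> T" using inT z by simp
  have "l = g (x + z *\<^sub>R v) \<bullet> v" using z(3) GDERIV_line[OF gd[OF zT]] by (rule DERIV_unique)
  with z show ?thesis using that by blast
qed

text \<open>The second difference \<open>\<Delta> a b t\<close> is symmetric in \<open>a\<close> and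
  \<open>b\<close>, and its quotient by \<open>t\<^sup>2\<close> tends to
  \<open>H b \<bullet> a\<close>. Differentiability of \<open>g\<close> at the single point
  \<open>x\<close> suffices.\<close>

lemma hessian_symmetric:
  fixes q :: "'a::euclidean_space \<Rightarrow> real"
  assumes S: "open S" "x \<in> S" and gd: "\<And>y. y \<in> S \<Longrightarrow> GDERIV q y :> g y"
    and H: "(g has_derivative H) (at x)"
  shows "H a \<bullet> b = H b \<bullet> a"
proof -
  interpret H: bounded_linear H using H by (rule has_derivative_bounded_linear)
  define \<Delta> where "\<Delta> a b t = q (x + t *\<^sub>R a + t *\<^sub>R b) - q (x + t *\<^sub>R a) - q (x + t *\<^sub>R b) + q x" for a b t
  have one: "\<exists>d>0. \<forall>t. 0 < t \<and> t < d \<longrightarrow> \<bar>\<Delta> a b t / t^2 - H b \<bullet> a\<bar> \<le> e"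
    if e: "e > 0" for e :: real and a b :: 'a
  proof -
    define N where "N = norm a + norm b + 1"
    have N: "N \<ge> 1" unfolding N_def by simp
    define e' where "e' = e / (2 * N * N)"
    have e': "e' > 0" unfolding e'_def using e N by simp
    obtain d1 where d1: "d1 > 0" "\<And>y. norm (y - x) < d1 \<Longrightarrow> norm (g y - g x - H (y - x)) \<le> e' * norm (y - x)"
      using H[unfolded has_derivative_at_alt] e' by blast
    obtain r where r: "r > 0" "ball x r \<subseteq> S" using S open_contains_ball by blast
    define d where "d = min d1 r / N"
    have d: "d > 0" unfolding d_def using d1 r N by simp
    show ?thesis
    proof (intro exI[of _ d] conjI d allI impI)
      fix t assume t: "0 < t \<and> t < d"
      have tN: "t * N < d1" "t * N < r" using t N unfolding d_def by (auto simp: field_simps min_def split: if_splits)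
      have nb: "norm (s *\<^sub>R a + s' *\<^sub>R b) \<le> t * N" if "0 \<le> s" "s \<le> t" "0 \<le> s'" "s' \<le> t" for s s'
      proof -
        have "norm (s *\<^sub>R a + s' *\<^sub>R b) \<le> s * norm a + s' * norm b"
          using norm_triangle_ineq[of "s *\<^sub>R a" "s' *\<^sub>R b"] that by simp
        also have "\<dots> \<le> t * norm a + t * norm b" using that by (intro add_mono mult_right_mono) auto
        also have "\<dots> \<le> t * N" unfolding N_def using t by (simp add: algebra_simps)
        finally show ?thesis .
      qed
      have inS: "x + s *\<^sub>R a + s' *\<^sub>R b \<in> S" if "0 \<le> s" "s \<le> t" "0 \<le> s'" "s' \<le> t" for s s'
      proof -
        have "dist x (x + (s *\<^sub>R a + s' *\<^sub>R b)) < r" using nb[OF that] tN by (subst dist_commute) (simp add: dist_norm)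
        then show ?thesis using r(2) by (auto simp: add.assoc)
      qed
      have gl: "norm (g (x + s *\<^sub>R a + s' *\<^sub>R b) - g x - H (s *\<^sub>R a + s' *\<^sub>R b)) \<le> e' * (t * N)" if "0 \<le> s" "s \<le> t" "0 \<le> s'" "s' \<le> t" for s s'
      proof -
        have "norm (s *\<^sub>R a + s' *\<^sub>R b) < d1" using nb[OF that] tN by linarith
        then have "norm (g (x + (s *\<^sub>R a + s' *\<^sub>R b)) - g x - H (s *\<^sub>R a + s' *\<^sub>R b)) \<le> e' * norm (s *\<^sub>R a + s' *\<^sub>R b)"
          using d1(2)[of "x + (s *\<^sub>R a + s' *\<^sub>R b)"] by simp
        also have "\<dots> \<le> e' * (t * N)" using nb[OF that] e' by (intro mult_left_mono) auto
        finally show ?thesis by (simp add: add.assoc)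
      qed
      \<comment> \<open>The mean value theorem is applied to the increment of \<open>q\<close> in
        direction \<open>b\<close>, as a function of the shift along \<open>a\<close>. Both
        gradients that appear are then linearized at \<open>x\<close>, not at each other, so one
        error bound serves twice.\<close>
      define \<psi> where "\<psi> s = q (x + t *\<^sub>R b + s *\<^sub>R a) - q (x + s *\<^sub>R a)" for s
      have "\<exists>s. s > 0 \<and> s < t \<and> \<psi> t - \<psi> 0 = (t - 0) * (g (x + t *\<^sub>R b + s *\<^sub>R a) \<bullet> a - g (x + s *\<^sub>R a) \<bullet> a)"
        unfolding \<psi>_def
      proof (rule MVT2)
        fix s assume "0 \<le> s" "s \<le> t"
        then have "x + t *\<^sub>R b + s *\<^sub>R a \<in> S" "x + s *\<^sub>R a \<in> S"
          using inS[of s t] inS[of s 0] t by (auto simp: algebra_simps)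
        then show "((\<lambda>s. q (x + t *\<^sub>R b + s *\<^sub>R a) - q (x + s *\<^sub>R a)) has_real_derivative
            g (x + t *\<^sub>R b + s *\<^sub>R a) \<bullet> a - g (x + s *\<^sub>R a) \<bullet> a) (at s)"
          by (intro DERIV_diff GDERIV_line gd)
      qed (use t in simp)
      then obtain s where s: "0 < s" "s < t"
        "\<psi> t - \<psi> 0 = t * ((g (x + t *\<^sub>R b + s *\<^sub>R a) - g (x + s *\<^sub>R a)) \<bullet> a)" by (auto simp: inner_diff_left)
      let ?R = "(g (x + s *\<^sub>R a + t *\<^sub>R b) - g x - H (s *\<^sub>R a + t *\<^sub>R b)) - (g (x + s *\<^sub>R a + 0 *\<^sub>R b) - g x - H (s *\<^sub>R a + 0 *\<^sub>R b))"
      have R: "norm ?R \<le> 2 * (e' * (t * N))"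
        using norm_triangle_ineq4[of "g (x + s *\<^sub>R a + t *\<^sub>R b) - g x - H (s *\<^sub>R a + t *\<^sub>R b)" "g (x + s *\<^sub>R a + 0 *\<^sub>R b) - g x - H (s *\<^sub>R a + 0 *\<^sub>R b)"]
          gl[of s t] gl[of s 0] s t by auto
      have gR: "g (x + t *\<^sub>R b + s *\<^sub>R a) - g (x + s *\<^sub>R a) = t *\<^sub>R H b + ?R"
        by (simp add: H.add H.scaleR algebra_simps)
      have "\<psi> t - \<psi> 0 = t * (t * (H b \<bullet> a) + ?R \<bullet> a)"
        unfolding s(3) gR by (simp only: inner_add_left inner_scaleR_left)
      moreover have "\<Delta> a b t = \<psi> t - \<psi> 0"
        unfolding \<Delta>_def \<psi>_def by (simp add: algebra_simps)
      ultimately have quot: "\<Delta> a b t / t^2 - H b \<bullet> a = (?R \<bullet> a) / t"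
        using t by (simp add: power2_eq_square field_simps)
      have "\<bar>?R \<bullet> a\<bar> \<le> e * t"
      proof -
        have "\<bar>?R \<bullet> a\<bar> \<le> norm ?R * norm a" by (rule Cauchy_Schwarz_ineq2)
        also have "\<dots> \<le> (2 * (e' * (t * N))) * N"
          using order_trans[OF norm_ge_zero R] by (intro mult_mono R) (auto simp: N_def)
        also have "\<dots> = e * t" unfolding e'_def using N by (simp add: field_simps)
        finally show ?thesis .
      qed
      then have "\<bar>?R \<bullet> a\<bar> / t \<le> e" using t by (simp only: divide_le_eq) simp
      then show "\<bar>\<Delta> a b t / t^2 - H b \<bullet> a\<bar> \<le> e"
        unfolding quot abs_divide using t by simp
    qed
  qed
  have "\<bar>H a \<bullet> b - H b \<bullet> a\<bar> \<le> e" if "e > 0" for e :: real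
  proof -
    obtain d1 where d1: "d1 > 0" "\<And>t. 0 < t \<and> t < d1 \<Longrightarrow> \<bar>\<Delta> a b t / t^2 - H b \<bullet> a\<bar> \<le> e/2"
      using one[of "e/2" a b] \<open>e > 0\<close> by auto
    obtain d2 where d2: "d2 > 0" "\<And>t. 0 < t \<and> t < d2 \<Longrightarrow> \<bar>\<Delta> b a t / t^2 - H a \<bullet> b\<bar> \<le> e/2"
      using one[of "e/2" b a] \<open>e > 0\<close> by auto
    define t where "t = min d1 d2 / 2"
    have t: "0 < t \<and> t < d1" "0 < t \<and> t < d2" using d1(1) d2(1) unfolding t_def by auto
    have eq: "\<Delta> b a t = \<Delta> a b t" unfolding \<Delta>_def by (simp add: algebra_simps)
    show ?thesis using d1(2)[OF t(1)] d2(2)[OF t(2)] unfolding eq by linarith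
  qed
  then have "\<bar>H a \<bullet> b - H b \<bullet> a\<bar> \<le> 0" by (rule field_le_epsilon[of _ 0, simplified])
  then show ?thesis by simp
qed

section \<open>Hopf's lemma and the strong minimum principle\<close>

lemma right_derivative_ge:
  fixes \<phi> :: "real \<Rightarrow> real"
  assumes "(\<phi> has_real_derivative D) (at_right 0)" "\<phi> 0 = 0" "d > 0"
    and "\<And>t. 0 < t \<Longrightarrow> t < d \<Longrightarrow> \<phi> t \<ge> k * t"
  shows "D \<ge> k"
proof (rule tendsto_lowerbound)
  show "((\<lambda>t. (\<phi> t - \<phi> 0) / (t - 0)) \<longlongrightarrow> D) (at_right 0)"
    using assms(1) unfolding has_field_derivative_iff .
  show "\<forall>\<^sub>F t in at_right 0. k \<le> (\<phi> t - \<phi> 0) / (t - 0)"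
    using eventually_at_right_less[of 0] eventually_at_right_field[of "\<lambda>t. t < d" 0] assms(2-)
    by (intro eventually_at_rightI[of 0 d]) (auto simp: field_simps)
qed simp

text \<open>Comparison with the barrier \<open>exp (- \<alpha> |x - c|\<^sup>2) - exp (- \<alpha>
  r\<^sup>2)\<close>, scaled to lie below \<open>q\<close> on the half ball. The conclusion is a
  bound on the whole ball, so that no derivative at a boundary point has to exist.\<close>

lemma hopf_ball:
  fixes c :: "'a::euclidean_space"
  assumes r: "r > 0" and gl: "grad_lap_on (ball c r) q g L" and cont: "continuous_on (cball c r) q"
    and nonneg: "\<And>x. x \<in> cball c r \<Longrightarrow> q x \<ge> 0" and pos: "\<And>x. x \<in> ball c r \<Longrightarrow> q x > 0"
    and C: "C \<ge> 0" and ineq: "\<And>x. x \<in> ball c r \<Longrightarrow> L x \<le> C * norm (g x) + C * q x"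
  shows "\<exists>k>0. \<forall>x\<in>cball c r. q x \<ge> k * (r\<^sup>2 - (norm (x - c))\<^sup>2)"
proof -
  define n where "n = real DIM('a)"
  have n: "n \<ge> 0" unfolding n_def by simp
  \<comment> \<open>With \<open>s = |x - c|\<^sup>2 \<ge> r\<^sup>2 / 4\<close> the barrier has
    Laplacian at least \<open>(\<alpha>\<^sup>2 r\<^sup>2 - 2 \<alpha> n) exp (- \<alpha>
    s)\<close>. The choice of \<alpha> makes this exceed the first and zeroth order terms on the
    outer annulus; this is \<open>big\<close>.\<close>
  define \<alpha> where "\<alpha> = (2*n + 2*C*r + C + 1) / r\<^sup>2 + 1"
  have \<alpha>: "\<alpha> \<ge> 1" unfolding \<alpha>_def using n C r by simp
  have \<alpha>r: "\<alpha> * r\<^sup>2 \<ge> 2*n + 2*C*r + C + 1" unfolding \<alpha>_def using r by (simp add: field_simps)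
  have big: "\<alpha>\<^sup>2 * r\<^sup>2 - 2*\<alpha>*n - 2*\<alpha>*C*r - C > 0"
  proof -
    have "\<alpha> * (\<alpha> * r\<^sup>2) \<ge> \<alpha> * (2*n + 2*C*r + C + 1)" using \<alpha>r \<alpha> by (intro mult_left_mono) auto
    moreover have "\<alpha> * (C + 1) \<ge> 1 * (C + 1)" using \<alpha> C by (intro mult_right_mono) auto
    ultimately show ?thesis by (simp add: power2_eq_square algebra_simps)
  qed
  define b where "b x = exp (- \<alpha> * ((x - c) \<bullet> (x - c))) - exp (- \<alpha> * r\<^sup>2)" for x
  have glb: "grad_lap_on S b (\<lambda>x. (- \<alpha> * exp (- \<alpha> * ((x - c) \<bullet> (x - c)))) *\<^sub>R (2 *\<^sub>R (x - c)))
      (\<lambda>x. (- \<alpha> * exp (- \<alpha> * ((x - c) \<bullet> (x - c)))) * (2 * n) + \<alpha>\<^sup>2 * exp (- \<alpha> * ((x - c) \<bullet> (x - c))) * (4 * ((x - c) \<bullet> (x - c))))" for S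
    by (rule grad_lap_on_eq[OF grad_lap_on_compose[OF grad_lap_on_sq_norm[of S c],
      of "\<lambda>s. exp (- \<alpha> * s) - exp (- \<alpha> * r\<^sup>2)" "\<lambda>s. - \<alpha> * exp (- \<alpha> * s)" "\<lambda>s. \<alpha>\<^sup>2 * exp (- \<alpha> * s)"]])
     (auto intro!: derivative_eq_intros simp: b_def power2_eq_square n_def)
  have cb: "continuous_on T b" for T unfolding b_def by (intro continuous_intros)
  have "compact (cball c (r/2))" "cball c (r/2) \<noteq> {}" using r by auto
  moreover have "continuous_on (cball c (r/2)) q" by (rule continuous_on_subset[OF cont]) (use r in auto)
  ultimately obtain y where y: "y \<in> cball c (r/2)" "\<And>x. x \<in> cball c (r/2) \<Longrightarrow> q y \<le> q x"
    using continuous_attains_inf by metis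
  define \<epsilon> where "\<epsilon> = q y"
  have \<epsilon>: "\<epsilon> > 0" unfolding \<epsilon>_def using y(1) r by (intro pos) auto
  define v where "v x = \<epsilon> * b x - q x" for x
  have "continuous_on (cball c r) v" unfolding v_def using cb cont by (intro continuous_intros)
  moreover have "compact (cball c r)" "cball c r \<noteq> {}" using r by auto
  ultimately obtain z where z: "z \<in> cball c r" "\<And>x. x \<in> cball c r \<Longrightarrow> v x \<le> v z"
    using continuous_attains_sup by metis
  \<comment> \<open>A positive maximum of \<open>v\<close> lies in the open annulus: on the half
    ball \<open>\<epsilon> \<le> q\<close> and \<open>b \<le> 1\<close>, on the sphere
    \<open>b = 0\<close>. There the gradients of \<open>q\<close> and of the scaled barrier agree,
    and the inequality for \<open>L\<close> contradicts \<open>big\<close>.\<close>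
  have "v z \<le> 0"
  proof (rule ccontr)
    assume "\<not> v z \<le> 0"
    then have vz: "q z < \<epsilon> * b z" unfolding v_def by simp
    have b1: "b z \<le> 1" unfolding b_def using \<alpha>
      by (smt (verit) exp_ge_zero inner_ge_zero one_le_exp_iff exp_le_one_iff mult_nonneg_nonneg mult_minus_left)
    have n1: "r/2 < dist c z"
    proof (rule ccontr)
      assume "\<not> r/2 < dist c z"
      then have "\<epsilon> \<le> q z" unfolding \<epsilon>_def by (intro y(2)) simp
      moreover have "\<epsilon> * b z \<le> \<epsilon> * 1" using b1 \<epsilon> by (intro mult_left_mono) auto
      ultimately show False using vz by simp
    qed
    have n2: "dist c z \<noteq> r"
    proof
      assume "dist c z = r"
      then have "b z = 0" unfolding b_def by (simp add: dist_norm norm_minus_commute dot_square_norm)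
      then show False using vz nonneg[OF z(1)] by simp
    qed
    then have zb: "z \<in> ball c r" using z(1) by auto
    have glv: "grad_lap_on (ball c r) v
      (\<lambda>x. \<epsilon> *\<^sub>R ((- \<alpha> * exp (- \<alpha> * ((x - c) \<bullet> (x - c)))) *\<^sub>R (2 *\<^sub>R (x - c))) - g x)
      (\<lambda>x. \<epsilon> * ((- \<alpha> * exp (- \<alpha> * ((x - c) \<bullet> (x - c)))) * (2 * n) + \<alpha>\<^sup>2 * exp (- \<alpha> * ((x - c) \<bullet> (x - c))) * (4 * ((x - c) \<bullet> (x - c)))) - L x)"
      using grad_lap_on_diff[OF grad_lap_on_cmult[OF glb] gl] unfolding v_def .
    define s where "s = (z - c) \<bullet> (z - c)"
    define E where "E = exp (- \<alpha> * s)"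
    have E: "E > 0" unfolding E_def by simp
    have s: "s = (dist c z)\<^sup>2" unfolding s_def by (simp add: dist_norm norm_minus_commute dot_square_norm)
    have s1: "r\<^sup>2 \<le> 4 * s"
    proof -
      have "(r/2)\<^sup>2 \<le> s" unfolding s using n1 r by (intro power_mono) auto
      then show ?thesis by (simp add: power_divide)
    qed
    have lm: "\<epsilon> *\<^sub>R ((- \<alpha> * E) *\<^sub>R (2 *\<^sub>R (z - c))) - g z = 0"
      "\<epsilon> * ((- \<alpha> * E) * (2 * n) + \<alpha>\<^sup>2 * E * (4 * s)) - L z \<le> 0"
      using grad_lap_on_local_max[OF glv open_ball zb] z(2) unfolding s_def E_def by auto
    have ng: "norm (g z) \<le> \<epsilon> * (2 * \<alpha> * E * r)"
    proof -
      have "g z = \<epsilon> *\<^sub>R ((- \<alpha> * E) *\<^sub>R (2 *\<^sub>R (z - c)))" using lm(1) by simp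
      then have "norm (g z) = \<epsilon> * (\<alpha> * E * (2 * norm (z - c)))" using \<epsilon> \<alpha> E by simp
      also have "\<dots> \<le> \<epsilon> * (\<alpha> * E * (2 * r))" using zb \<epsilon> \<alpha> E
        by (intro mult_left_mono) (auto simp: dist_norm norm_minus_commute)
      finally show ?thesis by (simp add: algebra_simps)
    qed
    have "b z \<le> E" unfolding b_def E_def s_def by simp
    then have qz: "q z \<le> \<epsilon> * E" using vz \<epsilon> by (smt (verit) mult_left_mono)
    have "\<epsilon> * ((- \<alpha> * E) * (2 * n) + \<alpha>\<^sup>2 * E * (4 * s)) \<le> C * norm (g z) + C * q z"
      using lm(2) ineq[OF zb] by simp
    also have "\<dots> \<le> C * (\<epsilon> * (2 * \<alpha> * E * r)) + C * (\<epsilon> * E)"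
      using ng qz C by (intro add_mono mult_left_mono) auto
    finally have "\<epsilon> * E * (\<alpha>\<^sup>2 * (4 * s) - 2*\<alpha>*n - 2*\<alpha>*C*r - C) \<le> 0" by (simp add: algebra_simps)
    moreover have "\<alpha>\<^sup>2 * (4 * s) \<ge> \<alpha>\<^sup>2 * r\<^sup>2" using s1 by (intro mult_left_mono) auto
    ultimately have "\<epsilon> * E * (\<alpha>\<^sup>2 * r\<^sup>2 - 2*\<alpha>*n - 2*\<alpha>*C*r - C) \<le> 0"
      using \<epsilon> E by (smt (verit) mult_left_mono mult_pos_pos)
    moreover have "\<epsilon> * E > 0" using \<epsilon> E by simp
    ultimately show False using big by (smt (verit) mult_pos_pos)
  qed
  then have main: "\<epsilon> * b x \<le> q x" if "x \<in> cball c r" for x using z(2)[OF that] unfolding v_def by simp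
  define k where "k = \<epsilon> * (\<alpha> * exp (- \<alpha> * r\<^sup>2))"
  show ?thesis
  proof (intro exI[of _ k] conjI ballI)
    show "k > 0" unfolding k_def using \<epsilon> \<alpha> by simp
    fix x assume x: "x \<in> cball c r"
    define s where "s = (norm (x - c))\<^sup>2"
    \<comment> \<open>Convexity of the exponential replaces the barrier by a multiple of
      \<open>r\<^sup>2 - |x - c|\<^sup>2\<close>.\<close>
    have "\<alpha> * (r\<^sup>2 - s) \<le> exp (\<alpha> * (r\<^sup>2 - s)) - 1"
      using exp_ge_add_one_self[of "\<alpha> * (r\<^sup>2 - s)"] by linarith
    then have "exp (- \<alpha> * r\<^sup>2) * (exp (\<alpha> * (r\<^sup>2 - s)) - 1) \<ge> exp (- \<alpha> * r\<^sup>2) * (\<alpha> * (r\<^sup>2 - s))"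
      by (rule mult_left_mono) simp
    moreover have "b x = exp (- \<alpha> * r\<^sup>2) * (exp (\<alpha> * (r\<^sup>2 - s)) - 1)"
      unfolding b_def s_def by (simp add: algebra_simps dot_square_norm flip: exp_add)
    ultimately have "b x \<ge> exp (- \<alpha> * r\<^sup>2) * (\<alpha> * (r\<^sup>2 - s))" by simp
    then have "\<epsilon> * b x \<ge> \<epsilon> * (exp (- \<alpha> * r\<^sup>2) * (\<alpha> * (r\<^sup>2 - s)))" using \<epsilon> by (intro mult_left_mono) auto
    then show "k * (r\<^sup>2 - (norm (x - c))\<^sup>2) \<le> q x" using main[OF x] unfolding k_def s_def by (simp add: algebra_simps)
  qed
qed

text \<open>If \<open>q x1\<close> were nonzero, the largest ball around \<open>x1\<close> free of
  zeros would touch the zero set at some \<open>y\<close>. Hopf's lemma gives a positive slope at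
  \<open>y\<close>, but \<open>y\<close> is an interior minimum, so the gradient vanishes there.
  Halving the radius keeps that ball inside \<open>ball z R\<close>.\<close>

lemma strong_minimum_principle:
  fixes z :: "'a::euclidean_space"
  assumes gl: "grad_lap_on (ball z R) q g L" and nonneg: "\<And>x. x \<in> ball z R \<Longrightarrow> q x \<ge> 0"
    and C: "C \<ge> 0" and ineq: "\<And>x. x \<in> ball z R \<Longrightarrow> L x \<le> C * norm (g x) + C * q x"
    and qz: "q z = 0" and x1: "x1 \<in> ball z (R/2)"
  shows "q x1 = 0"
proof (rule ccontr)
  assume nz: "q x1 \<noteq> 0"
  have x1R: "dist x1 z < R/2" using x1 by (simp add: dist_commute)
  have sub: "cball x1 (dist x1 z) \<subseteq> ball z R"
  proof
    fix x assume "x \<in> cball x1 (dist x1 z)"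
    then show "x \<in> ball z R" using dist_triangle[of z x x1] x1R by (simp add: dist_commute)
  qed
  have qc: "continuous_on (ball z R) q"
    using grad_lap_onD(2)[OF gl] by (simp add: continuous_at_imp_continuous_on)
  define Z where "Z = {x \<in> cball x1 (dist x1 z). q x = 0}"
  have "closed Z" unfolding Z_def
    by (rule continuous_closed_preimage_constant) (use continuous_on_subset[OF qc sub] in auto)
  moreover have zZ: "z \<in> Z" unfolding Z_def using qz by simp
  ultimately obtain y where y: "y \<in> Z" "\<And>x. x \<in> Z \<Longrightarrow> dist x1 y \<le> dist x1 x"
    using distance_attains_inf[of Z x1] by auto
  define r where "r = dist x1 y"
  have qy: "q y = 0" using y(1) unfolding Z_def by simp
  have r: "r > 0" unfolding r_def using nz qy by auto
  have rle: "r \<le> dist x1 z" unfolding r_def using y(1) unfolding Z_def by simp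
  have sub2: "cball x1 r \<subseteq> ball z R" using sub rle by (meson order_trans subset_cball)
  have sub3: "ball x1 r \<subseteq> ball z R" using sub2 ball_subset_cball by blast
  have pos: "q x > 0" if "x \<in> ball x1 r" for x
  proof -
    have "x \<notin> Z" using y(2)[of x] that unfolding r_def by auto
    then have "q x \<noteq> 0" using that rle unfolding Z_def by auto
    then show ?thesis using nonneg[of x] that sub3 by auto
  qed
  obtain k where k: "k > 0" "\<And>x. x \<in> cball x1 r \<Longrightarrow> q x \<ge> k * (r\<^sup>2 - (norm (x - x1))\<^sup>2)"
    using hopf_ball[OF r grad_lap_on_subset[OF gl sub3] continuous_on_subset[OF qc sub2] _ pos C] nonneg ineq sub2 sub3
    by (meson subsetD)
  have yR: "y \<in> ball z R" using sub2 r_def by auto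
  have glm: "grad_lap_on (ball z R) (\<lambda>x. - q x) (\<lambda>x. - g x) (\<lambda>x. - L x)"
    by (rule grad_lap_on_eq[OF grad_lap_on_cmult[OF gl, of "-1"]]) auto
  have gy: "g y = 0"
    using grad_lap_on_local_max(1)[OF glm open_ball yR] nonneg qy by simp
  have "((\<lambda>t. q (y + t *\<^sub>R (x1 - y))) has_real_derivative g y \<bullet> (x1 - y)) (at 0)"
    by (rule GDERIV_line) (use grad_lap_onD(1)[OF gl yR] in simp)
  then have "((\<lambda>t. q (y + t *\<^sub>R (x1 - y))) has_real_derivative 0) (at_right 0)"
    using gy by (simp add: has_field_derivative_at_within)
  then have "0 \<ge> k * r\<^sup>2"
  proof (rule right_derivative_ge[where d=1])
    fix t :: real assume t: "0 < t" "t < 1"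
    have e: "norm (y + t *\<^sub>R (x1 - y) - x1) = (1 - t) * r"
    proof -
      have "y + t *\<^sub>R (x1 - y) - x1 = (1 - t) *\<^sub>R (y - x1)" by (simp add: algebra_simps)
      then show ?thesis unfolding r_def using t by (simp add: dist_norm norm_minus_commute)
    qed
    moreover have "(1 - t) * r \<le> 1 * r" using t r by (intro mult_right_mono) auto
    ultimately have "y + t *\<^sub>R (x1 - y) \<in> cball x1 r" by (simp add: dist_norm norm_minus_commute[of x1])
    from k(2)[OF this] have "k * (r\<^sup>2 - ((1 - t) * r)\<^sup>2) \<le> q (y + t *\<^sub>R (x1 - y))" unfolding e .
    moreover have "r\<^sup>2 - ((1 - t) * r)\<^sup>2 \<ge> r\<^sup>2 * t"
    proof -
      have "r\<^sup>2 - ((1 - t) * r)\<^sup>2 - r\<^sup>2 * t = r\<^sup>2 * (t * (1 - t))" by (simp add: power2_eq_square algebra_simps)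
      moreover have "\<dots> \<ge> 0" using t by simp
      ultimately show ?thesis by simp
    qed
    ultimately show "q (y + t *\<^sub>R (x1 - y)) \<ge> k * r\<^sup>2 * t" using k(1) by (smt (verit) mult_left_mono mult.assoc)
  qed (use qy in auto)
  then show False using k(1) r by (smt (verit) mult_pos_pos zero_less_power)
qed

section \<open>Partial derivatives\<close>

lemma grad_lap_on_cong:
  assumes "open S" "grad_lap_on S q g L" "\<And>x. x \<in> S \<Longrightarrow> q x = q' x" "\<And>x. x \<in> S \<Longrightarrow> g x = g' x"
    "\<And>x. x \<in> S \<Longrightarrow> L x = L' x"
  shows "grad_lap_on S q' g' L'"
  unfolding grad_lap_on_def
proof (intro ballI conjI)
  fix x assume x: "x \<in> S"
  have "(q has_derivative (\<lambda>h. h \<bullet> g x)) (at x)" using grad_lap_onD(1)[OF assms(2) x] unfolding gderiv_def .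
  then have "(q' has_derivative (\<lambda>h. h \<bullet> g x)) (at x)"
    by (rule has_derivative_transform_within_open[OF _ assms(1) x]) (rule assms(3))
  then show "GDERIV q' x :> g' x" unfolding gderiv_def assms(4)[OF x] .
  obtain H where H: "(g has_derivative H) (at x)" "trace H = L x"
    using assms(2) x unfolding grad_lap_on_def by blast
  have "(g' has_derivative H) (at x)"
    by (rule has_derivative_transform_within_open[OF H(1) assms(1) x]) (rule assms(4))
  then show "\<exists>H. (g' has_derivative H) (at x) \<and> trace H = L' x"
    using H(2) assms(5)[OF x] by auto
qed

abbreviation pd :: "('a::real_normed_vector \<Rightarrow> 'b::real_normed_vector) \<Rightarrow> 'a \<Rightarrow> 'a \<Rightarrow> 'b" where
  "pd v b x \<equiv> frechet_derivative v (at x) b"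

definition grad :: "('a::euclidean_space \<Rightarrow> real) \<Rightarrow> 'a \<Rightarrow> 'a" where
  "grad v x = (\<Sum>b\<in>Basis. pd v b x *\<^sub>R b)"

lemma frechet_derivative_cong_open:
  assumes "open S" "x \<in> S" "\<And>y. y \<in> S \<Longrightarrow> v y = v' y"
  shows "frechet_derivative v (at x) = frechet_derivative v' (at x)"
proof -
  have "(v has_derivative D) (at x) \<longleftrightarrow> (v' has_derivative D) (at x)" for D
    using has_derivative_transform_within_open[OF _ assms(1,2)] assms(3) by metis
  then show ?thesis unfolding frechet_derivative_def by simp
qed

lemma inner_grad: "b \<in> Basis \<Longrightarrow> grad v x \<bullet> b = pd v b x"
  unfolding grad_def by (simp add: inner_sum_left_Basis)

lemma GDERIV_grad:
  assumes "v differentiable (at x)"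
  shows "GDERIV v x :> grad v x"
proof -
  interpret D: bounded_linear "frechet_derivative v (at x)"
    using assms by (intro has_derivative_bounded_linear[of v]) (simp add: frechet_derivative_works)
  have "frechet_derivative v (at x) h = h \<bullet> grad v x" for h
  proof -
    have "frechet_derivative v (at x) h = frechet_derivative v (at x) (\<Sum>b\<in>Basis. (h \<bullet> b) *\<^sub>R b)"
      by (simp add: euclidean_representation)
    also have "\<dots> = h \<bullet> grad v x" unfolding grad_def by (simp add: D.sum D.scaleR inner_sum_right mult.commute)
    finally show ?thesis .
  qed
  then have "frechet_derivative v (at x) = (\<lambda>h. h \<bullet> grad v x)" by blast
  then show ?thesis using assms unfolding gderiv_def frechet_derivative_works by simp
qed

lemma GDERIV_unique:
  assumes "GDERIV v x :> a" "GDERIV v x :> b" shows "a = b"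
proof -
  have "(\<lambda>h. h \<bullet> a) = (\<lambda>h. h \<bullet> b)"
    using assms unfolding gderiv_def by (rule has_derivative_unique)
  then show ?thesis by (metis vector_eq_ldot)
qed

lemma grad_has_derivative:
  assumes "\<And>b. b \<in> Basis \<Longrightarrow> pd v b differentiable (at x)"
  shows "(grad v has_derivative (\<lambda>h. \<Sum>b\<in>Basis. pd (pd v b) h x *\<^sub>R b)) (at x)"
  unfolding grad_def
  by (rule has_derivative_sum, rule has_derivative_scaleR_left) (use assms frechet_derivative_works in blast)

lemma Ck_on_2D:
  assumes "Ck_on 2 S v" "x \<in> S"
  shows "v differentiable (at x)" "pd v b differentiable (at x)"
  using assms by (auto simp: numeral_2_eq_2)

lemma Ck_on_2_grad_lap:
  assumes "Ck_on 2 S v"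
  shows "grad_lap_on S v (grad v) (laplacian v)"
  unfolding grad_lap_on_def
proof (intro ballI conjI exI)
  fix x assume x: "x \<in> S"
  show "GDERIV v x :> grad v x" using GDERIV_grad Ck_on_2D[OF assms x] by blast
  show "(grad v has_derivative (\<lambda>h. \<Sum>b\<in>Basis. pd (pd v b) h x *\<^sub>R b)) (at x)"
    by (rule grad_has_derivative) (rule Ck_on_2D[OF assms x])
  show "(\<Sum>c\<in>Basis. (\<Sum>b\<in>Basis. pd (pd v b) c x *\<^sub>R b) \<bullet> c) = laplacian v x"
    unfolding laplacian_def by (simp add: inner_sum_left_Basis)
qed

lemma pd_commute:
  fixes v :: "'a::euclidean_space \<Rightarrow> real"
  assumes "open S" "Ck_on 2 S v" "x \<in> S" "b \<in> Basis" "c \<in> Basis"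
  shows "pd (pd v b) c x = pd (pd v c) b x"
proof -
  have "(grad v has_derivative (\<lambda>h. \<Sum>b\<in>Basis. pd (pd v b) h x *\<^sub>R b)) (at x)"
    by (rule grad_has_derivative) (rule Ck_on_2D[OF assms(2,3)])
  from hessian_symmetric[OF assms(1,3) GDERIV_grad[OF Ck_on_2D(1)[OF assms(2)]] this, of c b]
  show ?thesis using assms(4,5) by (simp add: inner_sum_left_Basis)
qed

text \<open>Linearization of the equation: two exchanges of partial derivatives bring
  \<open>b\<close> to the outside, and then the equation itself is differentiated. This is what the
  third derivatives are for.\<close>

lemma laplacian_pd:
  assumes S: "open S" "x \<in> S" and v: "Ck_on 3 S v" and b: "b \<in> Basis"
    and eq: "\<And>y. y \<in> S \<Longrightarrow> laplacian v y = - f (v y)"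
    and f: "(f has_real_derivative f') (at (v x))"
  shows "laplacian (pd v b) x = - f' * pd v b x"
proof -
  have C2: "Ck_on 2 S (pd v c)" for c using v by (simp add: numeral_3_eq_3 numeral_2_eq_2)
  have v2: "Ck_on 2 S v" using v by (auto simp: numeral_3_eq_3 numeral_2_eq_2 intro!: continuous_at_imp_continuous_on differentiable_imp_continuous_within)
  have "laplacian (pd v b) x = (\<Sum>c\<in>Basis. pd (pd (pd v b) c) c x)" unfolding laplacian_def ..
  also have "\<dots> = (\<Sum>c\<in>Basis. pd (pd (pd v c) c) b x)"
  proof (rule sum.cong[OF refl])
    fix c :: 'a assume c: "c \<in> Basis"
    \<comment> \<open>Differentiating the exchange once more needs it on a neighbourhood, not only
      at \<open>x\<close>.\<close>
    have "pd (pd (pd v b) c) c x = pd (pd (pd v c) b) c x"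
      using frechet_derivative_cong_open[OF S, of "pd (pd v b) c" "pd (pd v c) b"] pd_commute[OF S(1) v2 _ b c] by simp
    also have "\<dots> = pd (pd (pd v c) c) b x" by (rule pd_commute[OF S(1) C2 S(2) b c])
    finally show "pd (pd (pd v b) c) c x = pd (pd (pd v c) c) b x" .
  qed
  also have "\<dots> = pd (laplacian v) b x"
  proof -
    have "(laplacian v has_derivative (\<lambda>h. \<Sum>c\<in>Basis. pd (pd (pd v c) c) h x)) (at x)"
      unfolding laplacian_def
      by (rule has_derivative_sum) (use Ck_on_2D(2)[OF C2 S(2)] frechet_derivative_works in blast)
    from fun_cong[OF frechet_derivative_at[OF this], of b] show ?thesis .
  qed
  also have "\<dots> = pd (\<lambda>y. - f (v y)) b x"
    using frechet_derivative_cong_open[OF S, of "laplacian v" "\<lambda>y. - f (v y)"] eq by simp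
  also have "\<dots> = - f' * pd v b x"
  proof -
    have "(v has_derivative frechet_derivative v (at x)) (at x)"
      using Ck_on_2D(1)[OF v2 S(2)] frechet_derivative_works by blast
    then have "((\<lambda>y. f (v y)) has_derivative (\<lambda>h. f' * frechet_derivative v (at x) h)) (at x)"
      using f unfolding has_field_derivative_def by (rule has_derivative_compose)
    then have "((\<lambda>y. - f (v y)) has_derivative (\<lambda>h. - (f' * frechet_derivative v (at x) h))) (at x)"
      by (rule has_derivative_minus)
    from fun_cong[OF frechet_derivative_at[OF this], of b] show ?thesis by simp
  qed
  finally show ?thesis .
qed

section \<open>Symmetric operators\<close>

text \<open>Induction on the dimension: a maximum of the quadratic form on the unit sphere of
  \<open>T\<close> is an eigenvector, and its orthogonal complement in \<open>T\<close> is again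
  invariant. Invariant subspaces are allowed because the tangent space is where it is
  applied.\<close>

lemma spectral_subspace:
  fixes S :: "'a::euclidean_space \<Rightarrow> 'a"
  assumes lin: "linear S" and sym: "\<And>x y. S x \<bullet> y = x \<bullet> S y"
  shows "subspace T \<Longrightarrow> (\<And>x. x \<in> T \<Longrightarrow> S x \<in> T) \<Longrightarrow>
    \<exists>E k. pairwise orthogonal E \<and> (\<forall>e\<in>E. norm e = 1) \<and> span E = T \<and> (\<forall>e\<in>E. S e = k e *\<^sub>R e)"
proof (induction "dim T" arbitrary: T rule: less_induct)
  case (less T)
  note T = \<open>subspace T\<close> and inv = less.prems(2)
  interpret S: linear S by (rule lin)
  show ?case
  proof (cases "T = {0}")
    case True
    then show ?thesis by (intro exI[of _ "{}"]) (auto simp: pairwise_def)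
  next
    case False
    then obtain z where z: "z \<in> T" "z \<noteq> 0" using T subspace_0 by blast
    define K where "K = T \<inter> sphere 0 1"
    have cK: "compact K" unfolding K_def using closed_subspace[OF T] by (simp add: closed_Int_compact)
    have "(1 / norm z) *\<^sub>R z \<in> K" unfolding K_def using z T by (simp add: subspace_scale)
    then have neK: "K \<noteq> {}" by blast
    have "continuous_on K (\<lambda>x. S x \<bullet> x)"
      using linear_continuous_on[OF linear_conv_bounded_linear[THEN iffD1, OF lin]] by (intro continuous_intros)
    from continuous_attains_sup[OF cK neK this]
    obtain x0 where x0: "x0 \<in> K" "\<And>x. x \<in> K \<Longrightarrow> S x \<bullet> x \<le> S x0 \<bullet> x0" by blast
    define m where "m = S x0 \<bullet> x0"
    have x0T: "x0 \<in> T" and n0: "norm x0 = 1" using x0(1) unfolding K_def by auto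
    have x00: "x0 \<bullet> x0 = 1" using n0 by (simp add: dot_square_norm)
    have R: "S x \<bullet> x \<le> m * (x \<bullet> x)" if x: "x \<in> T" for x
    proof (cases "x = 0")
      case False
      have "(1 / norm x) *\<^sub>R x \<in> K" unfolding K_def using x T False by (simp add: subspace_scale)
      from x0(2)[OF this] have "(S x \<bullet> x) / (norm x)\<^sup>2 \<le> m" unfolding m_def by (simp add: S.scale power2_eq_square)
      then show ?thesis using False by (simp add: divide_le_eq dot_square_norm)
    qed (simp add: S.zero)
    have orth: "S x0 \<bullet> y = 0" if y: "y \<in> T" "y \<bullet> x0 = 0" for y
    proof -
      define a where "a = S x0 \<bullet> y"
      define c where "c = m * (y \<bullet> y) - S y \<bullet> y"
      \<comment> \<open>The first variation of the quadratic form at its maximum in direction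
        \<open>y\<close>. Its validity for all \<open>t\<close> of either sign forces
        \<open>a = 0\<close>; the test value \<open>a / (c + 1)\<close> is defined also when
        \<open>c = 0\<close>.\<close>
      have q: "2 * t * a \<le> t * t * c" for t
      proof -
        have "x0 + t *\<^sub>R y \<in> T" using x0T y T by (simp add: subspace_add subspace_scale)
        from R[OF this] have "S x0 \<bullet> x0 + t * (S x0 \<bullet> y) + t * (S y \<bullet> x0) + t * t * (S y \<bullet> y) \<le> m * (1 + t * t * (y \<bullet> y))"
          using x00 y(2) by (simp add: S.add S.scale inner_add_left inner_add_right inner_commute algebra_simps)
        moreover have "S y \<bullet> x0 = a" unfolding a_def using sym[of y x0] by (simp add: inner_commute)
        ultimately show ?thesis unfolding c_def a_def m_def by (simp add: algebra_simps)
      qed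
      have "a = 0"
      proof (rule ccontr)
        assume a: "a \<noteq> 0"
        have "c \<ge> 0" unfolding c_def using R[OF y(1)] by simp
        define t where "t = a / (c + 1)"
        have tc: "t * (c + 1) = a" unfolding t_def using \<open>c \<ge> 0\<close> by simp
        have "t * t * c \<le> t * t * (c + 1)" by (intro mult_left_mono) auto
        also have "\<dots> = t * a" unfolding mult.assoc tc ..
        finally have "2 * t * a \<le> t * a" using q[of t] by linarith
        moreover have "t * a > 0" unfolding t_def using a \<open>c \<ge> 0\<close> by (auto simp: zero_less_mult_iff divide_simps neq_iff)
        ultimately show False by linarith
      qed
      then show ?thesis by (simp add: a_def)
    qed
    have Sx0: "S x0 = m *\<^sub>R x0"
    proof -
      define v where "v = S x0 - m *\<^sub>R x0"
      have v0: "v \<bullet> x0 = 0" unfolding v_def m_def using x00 by (simp add: inner_diff_left)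
      have "v \<in> T" unfolding v_def using inv[OF x0T] x0T T by (simp add: subspace_diff subspace_scale)
      from orth[OF this v0] have "S x0 \<bullet> v = 0" .
      then have "v \<bullet> v = 0" using v0 unfolding v_def by (simp add: inner_diff_left inner_diff_right inner_commute)
      then show ?thesis unfolding v_def by simp
    qed
    define T' where "T' = {y \<in> T. y \<bullet> x0 = 0}"
    have T': "subspace T'" unfolding T'_def using T by (auto simp: subspace_def inner_add_left)
    have inv': "S y \<in> T'" if "y \<in> T'" for y
      using that inv sym[of y x0] unfolding T'_def Sx0 by auto
    have "dim T' < dim T"
    proof (rule dim_psubset)
      have "x0 \<notin> T'" "T' \<subseteq> T" unfolding T'_def using x00 by auto
      then have "T' \<subset> T" using x0T by blast
      then show "span T' \<subset> span T" using T T' by (simp add: span_eq_iff[THEN iffD2])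
    qed
    from less.hyps[OF this T' inv'] obtain E k where E: "pairwise orthogonal E" "\<forall>e\<in>E. norm e = 1" "span E = T'"
      "\<forall>e\<in>E. S e = k e *\<^sub>R e" by blast
    have E0: "e \<bullet> x0 = 0" if "e \<in> E" for e using E(3) that span_base unfolding T'_def by blast
    have x0E: "x0 \<notin> E" using E0 x00 by auto
    have "span (insert x0 E) = T"
    proof
      have "E \<subseteq> T" using E(3) span_superset unfolding T'_def by blast
      then show "span (insert x0 E) \<subseteq> T" using T x0T by (simp add: span_minimal)
      show "T \<subseteq> span (insert x0 E)"
      proof
        fix y assume y: "y \<in> T"
        have "y - (y \<bullet> x0) *\<^sub>R x0 \<in> T'" unfolding T'_def using y x0T T x00
          by (simp add: subspace_diff subspace_scale inner_diff_left)
        then show "y \<in> span (insert x0 E)" using span_breakdown_eq E(3) by blast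
      qed
    qed
    moreover have "pairwise orthogonal (insert x0 E)"
      using E(1) E0 by (auto simp: pairwise_insert orthogonal_def inner_commute)
    ultimately show ?thesis using E n0 Sx0 x0E
      by (intro exI[of _ "insert x0 E"] exI[of _ "k(x0 := m)"]) auto
  qed
qed

text \<open>Expand each \<open>A b\<close> in the basis \<open>E\<close> and exchange the sums. It
  lets the trace be computed in a basis of principal directions and the normal.\<close>

lemma trace_orthonormal:
  fixes A :: "'a::euclidean_space \<Rightarrow> 'a"
  assumes lin: "linear A" and E: "pairwise orthogonal E" "\<And>e. e \<in> E \<Longrightarrow> norm e = 1" "span E = UNIV"
  shows "(\<Sum>e\<in>E. A e \<bullet> e) = trace A"
proof -
  interpret A: linear A by (rule lin)
  have "independent E" using E by (intro pairwise_orthogonal_independent) (use E(2)[of 0] in auto)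
  then have fin: "finite E" by (rule independent_imp_finite)
  have rep: "x = (\<Sum>e\<in>E. (x \<bullet> e) *\<^sub>R e)" for x
  proof -
    define d where "d = x - (\<Sum>e\<in>E. (x \<bullet> e) *\<^sub>R e)"
    have d0: "d \<bullet> e' = 0" if e': "e' \<in> E" for e'
    proof -
      have "(\<Sum>e\<in>E. (x \<bullet> e) * (e \<bullet> e')) = (\<Sum>e\<in>E. if e = e' then x \<bullet> e' else 0)"
        using E e' by (intro sum.cong) (auto simp: pairwise_def orthogonal_def dot_square_norm)
      also have "\<dots> = x \<bullet> e'" using fin e' by simp
      finally show ?thesis unfolding d_def by (simp add: inner_diff_left inner_sum_left)
    qed
    have "orthogonal d d"
      by (rule orthogonal_to_span[of _ E]) (simp_all add: E(3) orthogonal_def d0)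
    then show ?thesis unfolding d_def by (simp add: orthogonal_def)
  qed
  have "trace A = (\<Sum>b\<in>Basis. \<Sum>e\<in>E. (A b \<bullet> e) * (e \<bullet> b))"
  proof (rule sum.cong[OF refl])
    fix b :: 'a
    show "A b \<bullet> b = (\<Sum>e\<in>E. (A b \<bullet> e) * (e \<bullet> b))"
      by (subst rep[of "A b"]) (simp add: inner_sum_left)
  qed
  also have "\<dots> = (\<Sum>e\<in>E. \<Sum>b\<in>Basis. (A b \<bullet> e) * (e \<bullet> b))" by (rule sum.swap)
  also have "\<dots> = (\<Sum>e\<in>E. A e \<bullet> e)"
  proof (rule sum.cong[OF refl])
    fix e
    have "A e = A (\<Sum>b\<in>Basis. (e \<bullet> b) *\<^sub>R b)" by (simp add: euclidean_representation)
    then have "A e = (\<Sum>b\<in>Basis. (e \<bullet> b) *\<^sub>R A b)" by (simp add: A.sum A.scale)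
    then show "(\<Sum>b\<in>Basis. (A b \<bullet> e) * (e \<bullet> b)) = A e \<bullet> e" by (simp add: inner_sum_left mult.commute)
  qed
  finally show ?thesis by simp
qed

section \<open>Modica's gradient bound\<close>

text \<open>The level set is relatively closed by continuity and open by \<open>loc\<close>. It
  turns local constancy of \<open>u\<close> and of \<open>P\<close> into global constancy.\<close>

lemma connected_level_set:
  fixes q :: "'a::metric_space \<Rightarrow> 'b::t1_space"
  assumes "connected S" "continuous_on S q" "z \<in> S" "q z = c"
    and loc: "\<And>x. x \<in> S \<Longrightarrow> q x = c \<Longrightarrow> \<exists>r>0. ball x r \<subseteq> S \<and> (\<forall>y\<in>ball x r. q y = c)"
    and "x \<in> S"
  shows "q x = c"
proof -
  have "open {x \<in> S. q x = c}" unfolding open_contains_ball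
    using loc by blast
  then have "openin (top_of_set S) {x \<in> S. q x = c}" by (auto intro: open_subset)
  moreover have "closedin (top_of_set S) {x \<in> S. q x = c}"
    by (rule continuous_closedin_preimage_constant[OF assms(2)])
  ultimately have "{x \<in> S. q x = c} = {} \<or> {x \<in> S. q x = c} = S"
    using assms(1) unfolding connected_clopen by blast
  then show ?thesis using assms(3,4,6) by blast
qed

text \<open>\<open>G\<close> is the gradient of \<open>u\<close>, extended continuously to the closure, and \<open>gG b\<close> the gradient of its
  component \<open>G \<bullet> b\<close> in \<open>\<Omega>\<close>.\<close>

locale overdetermined =
  fixes \<Omega> :: "'a::euclidean_space set" and u :: "'a \<Rightarrow> real" and f f' F :: "real \<Rightarrow> real"
    and \<kappa> M K :: real and G :: "'a \<Rightarrow> 'a" and gG :: "'a \<Rightarrow> 'a \<Rightarrow> 'a"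
  assumes open_dom: "open \<Omega>" and connected_dom: "connected \<Omega>" and frontier_nonempty: "frontier \<Omega> \<noteq> {}"
    and gl_u: "grad_lap_on \<Omega> u G (\<lambda>x. - f (u x))"
    and gl_G: "\<And>b. b \<in> Basis \<Longrightarrow> grad_lap_on \<Omega> (\<lambda>x. G x \<bullet> b) (gG b) (\<lambda>x. - f' (u x) * (G x \<bullet> b))"
    and cont_u: "continuous_on (closure \<Omega>) u" and cont_G: "continuous_on (closure \<Omega>) G"
    and u_pos: "\<And>x. x \<in> \<Omega> \<Longrightarrow> u x > 0" and u_le: "\<And>x. x \<in> \<Omega> \<Longrightarrow> u x \<le> M" and M: "M \<ge> 0"
    and u_frontier: "\<And>p. p \<in> frontier \<Omega> \<Longrightarrow> u p = 0"
    and G_frontier: "\<And>p. p \<in> frontier \<Omega> \<Longrightarrow> norm (G p) = \<kappa>"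
    and DERIV_F: "\<And>s. (F has_real_derivative f s) (at s)"
    and DERIV_f: "\<And>s. (f has_real_derivative f' s) (at s)"
    and cont_f': "continuous_on UNIV f'"
    and F_le: "\<And>s. F s \<le> 0" and K: "K = \<kappa>\<^sup>2 + 2 * F 0" and K_ge: "K \<ge> 0"
begin

section \<open>Bochner's formula, the function P and Modica's estimate\<close>

abbreviation w :: "'a \<Rightarrow> real" where "w x \<equiv> G x \<bullet> G x"

definition P :: "'a \<Rightarrow> real" where "P x = w x + 2 * F (u x)"

text \<open>\<open>S\<close> is the squared norm of the Hessian of \<open>u\<close> and \<open>gw\<close> the gradient of \<open>w\<close>.\<close>

definition S :: "'a \<Rightarrow> real" where "S x = (\<Sum>b\<in>Basis. gG b x \<bullet> gG b x)"

definition gw :: "'a \<Rightarrow> 'a" where "gw x = (\<Sum>b\<in>Basis. (2 * (G x \<bullet> b)) *\<^sub>R gG b x)"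

lemma closure_cases:
  assumes "x \<in> closure \<Omega>" obtains "x \<in> \<Omega>" | "x \<in> frontier \<Omega>"
  using assms open_dom by (auto simp: frontier_def interior_open)

lemma u_bounds: "x \<in> closure \<Omega> \<Longrightarrow> 0 \<le> u x \<and> u x \<le> M"
  by (erule closure_cases) (auto simp: u_frontier M u_le dest: u_pos)

lemma cont_F: "continuous_on A F" and cont_f: "continuous_on A f"
  using DERIV_F DERIV_f by (meson DERIV_continuous continuous_at_imp_continuous_on)+

lemma bounded_on_range:
  fixes g :: "real \<Rightarrow> real"
  assumes "continuous_on UNIV g"
  obtains C where "C \<ge> 0" "\<And>s. 0 \<le> s \<Longrightarrow> s \<le> M \<Longrightarrow> \<bar>g s\<bar> \<le> C"
proof -
  have "compact (g ` {0..M})" using continuous_on_subset[OF assms] by (intro compact_continuous_image) auto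
  then obtain C where "\<And>y. y \<in> g ` {0..M} \<Longrightarrow> norm y \<le> C" using compact_imp_bounded bounded_iff by metis
  then have *: "\<And>s. 0 \<le> s \<Longrightarrow> s \<le> M \<Longrightarrow> \<bar>g s\<bar> \<le> C" by auto
  from *[of 0] M have "C \<ge> 0" by linarith
  with * show ?thesis using that by blast
qed

lemmas f_bound = bounded_on_range[OF cont_f] and f'_bound = bounded_on_range[OF cont_f']

text \<open>Such an \<open>s\<close> is a maximum of the nonpositive \<open>F\<close>, so
  \<open>f s = 0\<close>, and the bound on \<open>f'\<close> makes \<open>f\<close> at most linear
  in the distance to \<open>s\<close>. It serves the two degenerate situations with
  \<open>K = 0\<close>.\<close>

lemma f_bound_at_zero_of_F:
  assumes s: "0 \<le> s" "s \<le> M" and Fs: "F s = 0"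
  obtains C where "C \<ge> 0" "\<And>r. 0 \<le> r \<Longrightarrow> r \<le> M \<Longrightarrow> \<bar>f r\<bar> \<le> C * \<bar>r - s\<bar>"
proof -
  have fs: "f s = 0" using DERIV_local_max[OF DERIV_F zero_less_one, of s] F_le Fs by auto
  obtain C where C: "C \<ge> 0" "\<And>s. 0 \<le> s \<Longrightarrow> s \<le> M \<Longrightarrow> \<bar>f' s\<bar> \<le> C" using f'_bound by blast
  have "\<bar>f r\<bar> \<le> C * \<bar>r - s\<bar>" if "0 \<le> r" "r \<le> M" for r
    using field_differentiable_bound[of "{0..M}" f f' C r s] that s fs C(2)
    by (auto intro: has_field_derivative_at_within DERIV_f)
  with C(1) show ?thesis using that by blast
qed

lemma cont_w: "continuous_on (closure \<Omega>) w"
  by (intro continuous_intros cont_G)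

lemma cont_P: "continuous_on (closure \<Omega>) P"
  unfolding P_def by (intro continuous_intros cont_w continuous_on_compose2[OF cont_F cont_u]) auto

lemma w_frontier: "p \<in> frontier \<Omega> \<Longrightarrow> w p = \<kappa>\<^sup>2"
  using G_frontier by (simp add: dot_square_norm)

lemma P_frontier: "p \<in> frontier \<Omega> \<Longrightarrow> P p = K"
  by (simp add: P_def w_frontier u_frontier K)

lemma S_nonneg: "S x \<ge> 0"
  unfolding S_def by (intro sum_nonneg) simp

text \<open>Bochner's formula: each squared component contributes its squared gradient and, by the
  linearized equation, a multiple of \<open>f'\<close>.\<close>

lemma gl_w: "grad_lap_on \<Omega> w gw (\<lambda>x. 2 * S x - 2 * f' (u x) * w x)"
  by (rule grad_lap_on_eq[OF grad_lap_on_sum[OF finite_Basis grad_lap_on_mult[OF gl_G gl_G]]])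
    (auto simp: euclidean_inner[of "G _" "G _"] gw_def S_def sum_distrib_left sum_subtractf
      sum.distrib algebra_simps scaleR_2[symmetric] intro!: sum.cong)

abbreviation grad_P :: "'a \<Rightarrow> 'a" where "grad_P x \<equiv> gw x + (2 * f (u x)) *\<^sub>R G x"

abbreviation lap_P :: "'a \<Rightarrow> real" where "lap_P x \<equiv> 2 * S x - 2 * (f (u x))\<^sup>2"

text \<open>The \<open>f'\<close> term of Bochner's formula cancels the one from the second
  derivative of \<open>F (u x)\<close>.\<close>

lemma gl_P: "grad_lap_on \<Omega> P grad_P lap_P"
  by (rule grad_lap_on_eq[OF grad_lap_on_add[OF gl_w
      grad_lap_on_compose[OF gl_u, of "\<lambda>s. 2 * F s" "\<lambda>s. 2 * f s" "\<lambda>s. 2 * f' s"]]])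
    (auto intro!: derivative_eq_intros DERIV_F DERIV_f simp: P_def power2_eq_square algebra_simps)

text \<open>With \<open>X = gw / (2 w)\<close> this is the Cauchy-Schwarz inequality for \<open>gw\<close> together with its equality case.\<close>

lemma sum_sq_dev:
  "(\<Sum>b\<in>Basis. (norm (gG b x - (G x \<bullet> b) *\<^sub>R X))\<^sup>2) = S x - X \<bullet> gw x + w x * (X \<bullet> X)"
  unfolding S_def gw_def euclidean_inner[of "G x" "G x"]
  by (simp add: power2_norm_eq_inner inner_diff_left inner_diff_right inner_sum_right sum_distrib_right
      sum.distrib sum_subtractf inner_commute algebra_simps sum_distrib_left)

lemma gw_bound: "(norm (gw x))\<^sup>2 \<le> 4 * w x * S x"
proof (cases "w x = 0")
  case True
  then have "gw x = 0" unfolding gw_def by simp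
  then show ?thesis using True by simp
next
  case False
  then have w: "w x > 0" by (simp add: less_le)
  have "0 \<le> S x - ((1 / (2 * w x)) *\<^sub>R gw x) \<bullet> gw x + w x * (((1 / (2 * w x)) *\<^sub>R gw x) \<bullet> ((1 / (2 * w x)) *\<^sub>R gw x))"
    unfolding sum_sq_dev[symmetric] by (intro sum_nonneg) simp
  also have "\<dots> = S x - (gw x \<bullet> gw x) / (4 * w x)" using w by (simp add: field_simps)
  finally show ?thesis using w by (simp add: field_simps power2_norm_eq_inner)
qed

text \<open>Bernstein's method with the cutoff \<open>1 - |x - x0|\<^sup>2\<close>, which needs no uniform regularity of the boundary
  because the gradient is known there.\<close>

lemma gradient_bounded: obtains C where "C \<ge> 0" "\<And>x. x \<in> closure \<Omega> \<Longrightarrow> w x \<le> C"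
proof -
  define n where "n = real DIM('a)"
  have n: "n \<ge> 0" unfolding n_def by simp
  obtain C0 where C0: "C0 \<ge> 0" "\<And>s. 0 \<le> s \<Longrightarrow> s \<le> M \<Longrightarrow> \<bar>f s\<bar> \<le> C0" using f_bound by blast
  obtain C1 where C1: "C1 \<ge> 0" "\<And>s. 0 \<le> s \<Longrightarrow> s \<le> M \<Longrightarrow> \<bar>f' s\<bar> \<le> C1" using f'_bound by blast
  \<comment> \<open>The Laplacian of \<open>l * u\<^sup>2\<close> supplies \<open>2 * l * w\<close>.
    This absorbs \<open>2 * C1 * w\<close> from \<open>f'\<close>, \<open>4 * n * w\<close> from the
    Laplacian of the cutoff and \<open>32 * w\<close> from the mixed term, and leaves
    \<open>2 * w\<close>.\<close>
  define l where "l = C1 + 2 * n + 17"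
  have l: "l > 0" unfolding l_def using C1 n by simp
  \<comment> \<open>The summands bound \<open>Z\<close> at a maximum on the frontier, the part
    \<open>l * u\<^sup>2\<close> (all that is left on the unit sphere), and the gradient at an
    interior maximum.\<close>
  define B where "B = \<kappa>\<^sup>2 + l * M\<^sup>2 + l * (M * C0)"
  have B0: "l * M\<^sup>2 \<ge> 0" "l * (M * C0) \<ge> 0" "\<kappa>\<^sup>2 \<ge> 0" using l M C0 by auto
  have bd: "w x0 \<le> B" if x0: "x0 \<in> \<Omega>" for x0
  proof -
    define e where "e x = 1 - (x - x0) \<bullet> (x - x0)" for x
    define Z where "Z x = e x * e x * w x + l * (u x * u x)" for x
    have "continuous_on (closure \<Omega> \<inter> cball x0 1) Z" unfolding Z_def e_def
      by (intro continuous_intros continuous_on_subset[OF cont_w] continuous_on_subset[OF cont_u]) auto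
    moreover have "compact (closure \<Omega> \<inter> cball x0 1)" by (simp add: closed_Int_compact)
    moreover have x0i: "x0 \<in> closure \<Omega> \<inter> cball x0 1" using x0 closure_subset by auto
    ultimately obtain z where z: "z \<in> closure \<Omega> \<inter> cball x0 1" "\<And>x. x \<in> closure \<Omega> \<inter> cball x0 1 \<Longrightarrow> Z x \<le> Z z"
      using continuous_attains_sup[of "closure \<Omega> \<inter> cball x0 1" Z] by (metis empty_iff)
    have uz: "0 \<le> u z" "u z \<le> M" using u_bounds z by auto
    have s1: "(z - x0) \<bullet> (z - x0) \<le> 1"
      using z(1) by (simp add: dot_square_norm dist_norm norm_minus_commute power_le_one)
    have ez: "0 \<le> e z" "e z \<le> 1" unfolding e_def using s1 by auto
    have luu: "l * (u z * u z) \<le> l * M\<^sup>2" using uz l by (auto intro!: mult_mono simp: power2_eq_square)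
    have ee: "e z * e z \<le> 1" using ez by (simp add: mult_le_one)
    have eew: "e z * e z * w z \<le> w z" using mult_right_mono[OF ee, of "w z"] by simp
    have "Z z \<le> B"
    proof (cases "z \<in> \<Omega> \<and> z \<in> ball x0 1")
      case False
      then consider "z \<in> frontier \<Omega>" | "dist x0 z = 1" using z(1) closure_cases[of z] by force
      then show ?thesis
      proof cases
        case 1
        then show ?thesis using eew B0 unfolding Z_def B_def by (simp add: w_frontier u_frontier)
      next
        case 2
        then have "e z = 0" unfolding e_def by (simp add: dot_square_norm dist_norm norm_minus_commute)
        then have "Z z = l * (u z * u z)" unfolding Z_def by simp
        then show ?thesis using luu B0 unfolding B_def by linarith
      qed
    next
      case True
      define T where "T = \<Omega> \<inter> ball x0 1"
      have T: "open T" "z \<in> T" "T \<subseteq> \<Omega>" using open_dom True unfolding T_def by auto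
      have gle: "grad_lap_on T e (\<lambda>x. - (2 *\<^sub>R (x - x0))) (\<lambda>x. - (2 * n))"
        by (rule grad_lap_on_eq[OF grad_lap_on_diff[OF grad_lap_on_const[of T 1] grad_lap_on_sq_norm[of T x0]]])
          (auto simp: e_def n_def)
      note glZ = grad_lap_on_add[OF grad_lap_on_mult[OF grad_lap_on_mult[OF gle gle] grad_lap_on_subset[OF gl_w T(3)]]
          grad_lap_on_cmult[OF grad_lap_on_mult[OF grad_lap_on_subset[OF gl_u T(3)] grad_lap_on_subset[OF gl_u T(3)]], of l], folded Z_def]
      define s where "s = (z - x0) \<bullet> (z - x0)"
      define h where "h = (z - x0) \<bullet> gw z"
      have "\<And>x. x \<in> T \<Longrightarrow> Z x \<le> Z z" using z(2) T_def closure_subset by fastforce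
      from grad_lap_on_local_max(2)[OF glZ T(1,2) this]
      have L: "e z * e z * (2 * S z - 2 * f' (u z) * w z) + w z * (- 4 * e z * n + 8 * s) - 8 * e z * h
          + 2 * l * (w z - u z * f (u z)) \<le> 0"
        unfolding s_def h_def by (simp add: algebra_simps inner_add_left inner_diff_left)
      \<comment> \<open>\<open>gw_bound\<close> gives \<open>h\<^sup>2 \<le> 4 w S\<close>. The
        arithmetic-geometric mean inequality then spends the whole Hessian term on the mixed
        term.\<close>
      have hb: "8 * e z * h \<le> 2 * (e z * e z) * S z + 32 * w z"
      proof (rule power2_le_imp_le)
        have "h\<^sup>2 \<le> ((z - x0) \<bullet> (z - x0)) * (gw z \<bullet> gw z)" unfolding h_def by (rule Cauchy_Schwarz_ineq)
        also have "\<dots> \<le> 1 * (gw z \<bullet> gw z)" using s1 by (intro mult_right_mono) auto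
        also have "\<dots> \<le> 4 * w z * S z" using gw_bound[of z] by (simp add: power2_norm_eq_inner)
        finally have h2: "h\<^sup>2 \<le> 4 * w z * S z" .
        have "(8 * e z * h)\<^sup>2 = 64 * (e z)\<^sup>2 * h\<^sup>2" by (simp add: power_mult_distrib)
        also have "\<dots> \<le> 64 * (e z)\<^sup>2 * (4 * w z * S z)" using h2 by (intro mult_left_mono) auto
        also have "\<dots> \<le> (2 * (e z * e z) * S z + 32 * w z)\<^sup>2"
          using zero_le_power2[of "2 * (e z * e z) * S z - 32 * w z"] by (simp add: power2_eq_square algebra_simps)
        finally show "(8 * e z * h)\<^sup>2 \<le> (2 * (e z * e z) * S z + 32 * w z)\<^sup>2" .
      qed (use ez S_nonneg in auto)
      have t1: "e z * e z * (2 * f' (u z) * w z) \<le> 2 * C1 * w z"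
      proof -
        have "e z * e z * (2 * f' (u z) * w z) \<le> e z * e z * (2 * C1 * w z)"
          using C1(2)[OF uz] ez by (intro mult_left_mono mult_right_mono) auto
        also have "\<dots> \<le> 1 * (2 * C1 * w z)" using ee C1 by (intro mult_right_mono) auto
        finally show ?thesis by simp
      qed
      have t2: "w z * (4 * e z * n) \<le> w z * (4 * n)"
        using mult_right_mono[OF ez(2) n] by (intro mult_left_mono) auto
      have t3: "w z * (8 * s) \<ge> 0" unfolding s_def by simp
      have "u z * f (u z) \<le> u z * C0" using uz C0(2)[OF uz] by (intro mult_left_mono) auto
      also have "\<dots> \<le> M * C0" using uz C0(1) by (intro mult_right_mono) auto
      finally have t4: "u z * f (u z) \<le> M * C0" .
      have t4': "2 * l * (u z * f (u z)) \<le> 2 * l * (M * C0)" using t4 l by (intro mult_left_mono) auto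
      have "2 * w z \<le> 2 * l * (M * C0)"
        using L hb t1 t2 t3 t4' unfolding l_def by (simp add: algebra_simps)
      then have "w z \<le> l * (M * C0)" by simp
      then show ?thesis using eew luu B0 unfolding Z_def B_def by linarith
    qed
    moreover have "w x0 \<le> Z x0" unfolding Z_def e_def using l by simp
    ultimately show ?thesis using z(2)[OF x0i] by linarith
  qed
  show ?thesis
  proof (rule that)
    show "B \<ge> 0" unfolding B_def using B0 by linarith
    fix x assume "x \<in> closure \<Omega>"
    then show "w x \<le> B" by (rule closure_cases) (use B0 in \<open>auto simp: w_frontier B_def intro: bd[unfolded B_def]\<close>)
  qed
qed

text \<open>The term \<open>ep * exp (l * u)\<close> makes the differential inequality for \<open>P\<close> strict where the gradient is
  bounded away from 0. A small quadratic penalization then produces a maximum point in the unbounded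
  domain, and no compactness of translates is needed.\<close>

lemma modica_estimate:
  assumes "x1 \<in> closure \<Omega>" shows "P x1 \<le> K"
proof (rule ccontr)
  assume "\<not> P x1 \<le> K"
  define n where "n = real DIM('a)"
  have n: "n \<ge> 0" unfolding n_def by simp
  obtain C where C: "C \<ge> 0" "\<And>x. x \<in> closure \<Omega> \<Longrightarrow> w x \<le> C" using gradient_bounded by blast
  obtain C0 where C0: "C0 \<ge> 0" "\<And>s. 0 \<le> s \<Longrightarrow> s \<le> M \<Longrightarrow> \<bar>f s\<bar> \<le> C0" using f_bound by blast
  \<comment> \<open>Half of the excess to be refuted. The other half leaves room for the exponential
    perturbation, which \<open>ep\<close> scales to be at most \<open>d\<close>.\<close>
  define d where "d = (P x1 - K) / 2"
  have d: "d > 0" "P x1 = K + 2 * d" unfolding d_def using \<open>\<not> P x1 \<le> K\<close> by (auto simp: field_simps)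
  \<comment> \<open>Makes \<open>\<phi> + l * w \<ge> 1\<close> as soon as \<open>w \<ge> d\<close>,
    which gives strictness below.\<close>
  define l where "l = (C0 + 1) / d"
  have l: "l > 0" "l * d = C0 + 1" unfolding l_def using C0 d by auto
  define ep where "ep = d / exp (l * M)"
  have ep: "ep > 0" "ep * exp (l * M) = d" unfolding ep_def using d by auto
  have epe: "ep * exp (l * s) \<le> d" if "s \<le> M" for s
  proof -
    have "ep * exp (l * s) \<le> ep * exp (l * M)" using that l(1) ep(1) by (intro mult_left_mono) auto
    then show ?thesis using ep(2) by simp
  qed
  \<comment> \<open>The penalization costs \<open>2 * n * t\<^sup>2\<close> through its Laplacian
    and \<open>A * t\<close> through its gradient: the drift coefficient is at most
    \<open>2 * C0 + l * d\<close>, the gradient at most \<open>2 * t * sqrt (C + d)\<close>, and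
    division by the length of the gradient of \<open>u\<close> costs \<open>1 / sqrt d\<close>. The
    parameter \<open>t\<close> makes both together smaller than the gain
    \<open>ep * l\<close>.\<close>
  define A where "A = (2 * C0 + l * d) * (2 * sqrt (C + d) / sqrt d)"
  have A: "A \<ge> 0" unfolding A_def using C0 l d C by (auto intro!: mult_nonneg_nonneg divide_nonneg_nonneg)
  define t where "t = min 1 (ep * l / (2 * (2 * n + A + 1)))"
  have t: "0 < t" "t \<le> 1" unfolding t_def using ep l n A by auto
  have tt: "2 * n * t\<^sup>2 + A * t < ep * l"
  proof -
    have "t * t \<le> t * 1" using t by (intro mult_left_mono) auto
    then have "2 * n * t\<^sup>2 \<le> 2 * n * t" using n by (intro mult_left_mono) (auto simp: power2_eq_square)
    moreover have "t * (2 * (2 * n + A + 1)) \<le> ep * l"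
      using n A unfolding t_def by (subst pos_le_divide_eq[symmetric]) auto
    moreover have "n * t \<ge> 0" "A * t \<ge> 0" using n A t by auto
    ultimately show ?thesis using t(1) by (simp add: algebra_simps)
  qed
  \<comment> \<open>At distance \<open>R\<close> the penalization equals \<open>C + d\<close>, an
    upper bound for the other two terms of \<open>Z\<close>. So the maximum is not on the sphere,
    although the domain may be unbounded.\<close>
  define R where "R = sqrt (C + d) / t"
  have R: "t\<^sup>2 * R\<^sup>2 = C + d" "R \<ge> 0" unfolding R_def using t C d by (auto simp: power_divide)
  define Z where "Z x = P x + ep * exp (l * u x) - t\<^sup>2 * ((x - x1) \<bullet> (x - x1))" for x
  define D where "D = closure \<Omega> \<inter> cball x1 R"
  have "continuous_on D Z" unfolding Z_def D_def
    by (intro continuous_intros continuous_on_subset[OF cont_P] continuous_on_subset[OF cont_u]) auto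
  moreover have "compact D" unfolding D_def by (simp add: closed_Int_compact)
  moreover have x1D: "x1 \<in> D" using assms R unfolding D_def by auto
  ultimately obtain z where z: "z \<in> D" "\<And>x. x \<in> D \<Longrightarrow> Z x \<le> Z z"
    using continuous_attains_sup[of D Z] by (metis empty_iff)
  have zc: "z \<in> closure \<Omega>" using z(1) unfolding D_def by auto
  have uz: "0 \<le> u z" "u z \<le> M" using u_bounds[OF zc] by auto
  define s where "s = (z - x1) \<bullet> (z - x1)"
  have s: "s \<ge> 0" unfolding s_def by simp
  have ep_pos: "ep * exp (l * u x1) > 0" using ep by simp
  have Zx1: "Z x1 > K + 2 * d" unfolding Z_def using d(2) ep_pos by simp
  have Pz: "P z + d - t\<^sup>2 * s > K + 2 * d"
    using z(2)[OF x1D] Zx1 epe[OF uz(2)] unfolding Z_def s_def by linarith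
  have PC: "P z \<le> C" unfolding P_def using C(2)[OF zc] F_le[of "u z"] by linarith
  have ts: "t\<^sup>2 * s < C + d" using Pz PC K_ge d by linarith
  have tsge: "t\<^sup>2 * s \<ge> 0" using s by simp
  have "dist x1 z \<noteq> R"
  proof
    assume "dist x1 z = R"
    then have "s = R\<^sup>2" unfolding s_def by (simp add: dot_square_norm dist_norm norm_minus_commute)
    then show False using ts R by simp
  qed
  moreover have "z \<notin> frontier \<Omega>"
    using Pz d tsge P_frontier[of z] by linarith
  ultimately have zT: "z \<in> \<Omega> \<inter> ball x1 R" (is "_ \<in> ?T")
    using z(1) closure_cases[OF zc] unfolding D_def by force
  have T: "open ?T" "?T \<subseteq> \<Omega>" using open_dom by auto
  have glexp: "grad_lap_on ?T (\<lambda>x. ep * exp (l * u x)) (\<lambda>x. (ep * l * exp (l * u x)) *\<^sub>R G x)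
      (\<lambda>x. (ep * l * exp (l * u x)) * (- f (u x)) + (ep * l\<^sup>2 * exp (l * u x)) * (G x \<bullet> G x))"
    by (rule grad_lap_on_compose[OF grad_lap_on_subset[OF gl_u T(2)]])
      (auto intro!: derivative_eq_intros simp: power2_eq_square)
  note glZ = grad_lap_on_diff[OF grad_lap_on_add[OF grad_lap_on_subset[OF gl_P T(2)] glexp]
     grad_lap_on_cmult[OF grad_lap_on_sq_norm[of ?T x1], of "t\<^sup>2"], folded Z_def]
  have "\<And>x. x \<in> ?T \<Longrightarrow> Z x \<le> Z z" using z(2) closure_subset unfolding D_def by fastforce
  note lm = grad_lap_on_local_max[OF glZ T(1) zT this]
  define th where "th = ep * l * exp (l * u z)"
  define Y where "Y = (2 * t\<^sup>2) *\<^sub>R (z - x1)"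
  define g where "g = norm (G z)"
  define \<phi> where "\<phi> = f (u z)"
  have \<phi>: "\<bar>\<phi>\<bar> \<le> C0" unfolding \<phi>_def using C0(2)[OF uz] .
  have thle: "ep * l \<le> th" unfolding th_def using ep l uz by simp
  have thge: "th \<le> l * d" using epe[OF uz(2)] l(1) unfolding th_def by (simp add: mult.assoc mult.left_commute)
  have th0: "th \<ge> 0" using thle ep l by (smt (verit) mult_pos_pos)
  have gww: "gw z = Y - (2 * \<phi> + th) *\<^sub>R G z"
    using lm(1) unfolding Y_def \<phi>_def th_def by (simp add: algebra_simps)
  have lap: "2 * S z - 2 * \<phi>\<^sup>2 - th * \<phi> + l * th * w z - 2 * n * t\<^sup>2 \<le> 0"
    using lm(2) unfolding \<phi>_def th_def n_def by (simp add: algebra_simps power2_eq_square)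
  \<comment> \<open>Here both sign conditions enter: \<open>w = P - 2 F \<ge> P\<close> by
    \<open>F \<le> 0\<close>, and \<open>P z > K + d \<ge> d\<close>. The gradient of
    \<open>u\<close> therefore cannot degenerate at the maximum.\<close>
  have wz: "w z \<ge> d" using Pz tsge K_ge F_le[of "u z"] unfolding P_def by linarith
  have g: "g \<ge> sqrt d" "g > 0" "w z = g\<^sup>2"
  proof -
    show 1: "w z = g\<^sup>2" unfolding g_def by (simp add: dot_square_norm)
    show 2: "g \<ge> sqrt d" using wz 1 g_def by (metis norm_ge_zero real_sqrt_le_iff real_sqrt_unique)
    show "g > 0" using 2 d by (smt (verit) real_sqrt_gt_zero)
  qed
  \<comment> \<open>The critical point equation turns \<open>gw_bound\<close> into a lower bound for
    \<open>S\<close>. Inserted into \<open>lap\<close>, it cancels the \<open>\<phi>\<^sup>2\<close>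
    terms; what remains is a gain of order \<open>th\<close> against the penalization error.\<close>
  have "(norm (gw z))\<^sup>2 \<ge> (2 * \<phi> + th)\<^sup>2 * w z - 2 * (2 * \<phi> + th) * (Y \<bullet> G z)"
    unfolding gww power2_norm_eq_inner
    by (simp add: inner_diff_left inner_diff_right inner_commute power2_eq_square algebra_simps)
  then have "(2 * \<phi> + th)\<^sup>2 * w z - 2 * (2 * \<phi> + th) * (Y \<bullet> G z) \<le> 4 * w z * S z"
    using gw_bound[of z] by linarith
  moreover have "w z * (2 * S z - 2 * \<phi>\<^sup>2 - th * \<phi> + l * th * w z - 2 * n * t\<^sup>2) \<le> 0"
    using lap by (simp add: mult_nonneg_nonpos)
  ultimately have main: "w z * (th * \<phi> + th\<^sup>2 / 2 + l * th * w z - 2 * n * t\<^sup>2) \<le> (2 * \<phi> + th) * (Y \<bullet> G z)"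
    by (simp add: power2_eq_square algebra_simps)
  have "l * w z \<ge> l * d" using wz l by (intro mult_left_mono) auto
  then have "\<phi> + l * w z \<ge> 1" using l(2) \<phi> by linarith
  then have "th * (\<phi> + l * w z) \<ge> th * 1" using th0 by (intro mult_left_mono) auto
  then have "th * \<phi> + l * th * w z \<ge> th" by (simp add: algebra_simps)
  moreover have "th\<^sup>2 / 2 \<ge> 0" by simp
  ultimately have "th * \<phi> + th\<^sup>2 / 2 + l * th * w z \<ge> th" by linarith
  then have "th * \<phi> + th\<^sup>2 / 2 + l * th * w z - 2 * n * t\<^sup>2 \<ge> ep * l - 2 * n * t\<^sup>2" using thle by linarith
  then have "g\<^sup>2 * (ep * l - 2 * n * t\<^sup>2) \<le> (2 * \<phi> + th) * (Y \<bullet> G z)"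
    using main mult_left_mono[of "ep * l - 2 * n * t\<^sup>2" _ "w z"] g(3) by (smt (verit) zero_le_power2)
  also have "\<dots> \<le> \<bar>2 * \<phi> + th\<bar> * \<bar>Y \<bullet> G z\<bar>" by (metis abs_ge_self abs_mult)
  also have "\<dots> \<le> (2 * C0 + l * d) * (norm Y * g)"
    using \<phi> th0 thge C0 Cauchy_Schwarz_ineq2[of Y "G z"] unfolding g_def by (intro mult_mono) auto
  finally have "g * (g * (ep * l - 2 * n * t\<^sup>2)) \<le> g * ((2 * C0 + l * d) * norm Y)"
    by (simp add: power2_eq_square algebra_simps)
  then have g1: "g * (ep * l - 2 * n * t\<^sup>2) \<le> (2 * C0 + l * d) * norm Y" using g(2) by simp
  have pos: "ep * l - 2 * n * t\<^sup>2 \<ge> 0" using tt A t by (smt (verit) mult_nonneg_nonneg)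
  have "sqrt d * (ep * l - 2 * n * t\<^sup>2) \<le> (2 * C0 + l * d) * norm Y"
    using g1 mult_right_mono[OF g(1) pos] by linarith
  also have "norm Y \<le> 2 * t * sqrt (C + d)"
  proof (rule power2_le_imp_le)
    have "(norm Y)\<^sup>2 = 4 * t\<^sup>2 * (t\<^sup>2 * s)" unfolding Y_def s_def
      by (simp add: power_mult_distrib dot_square_norm power2_eq_square)
    also have "\<dots> \<le> 4 * t\<^sup>2 * (C + d)" using ts by (intro mult_left_mono) auto
    finally show "(norm Y)\<^sup>2 \<le> (2 * t * sqrt (C + d))\<^sup>2" using C d by (simp add: power_mult_distrib)
  qed (use t C d in auto)
  finally have "sqrt d * (ep * l - 2 * n * t\<^sup>2) \<le> (2 * C0 + l * d) * (2 * t * sqrt (C + d))"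
    using C0 l d by (simp add: mult_left_mono)
  then have "ep * l - 2 * n * t\<^sup>2 \<le> A * t" unfolding A_def using d by (simp add: field_simps)
  then show False using tt by linarith
qed

text \<open>Otherwise \<open>K = 0\<close> and \<open>s = u z\<close> is a maximum of \<open>F\<close>, so that \<open>|\<nabla>u| \<le> L |u - s|\<close> and \<open>u\<close> is constant.\<close>

lemma max_point_gradient_pos:
  assumes z: "z \<in> \<Omega>" and Pz: "P z = K"
  shows "w z > 0"
proof (rule ccontr)
  assume "\<not> w z > 0"
  then have "w z = 0" by (simp add: order_less_le)
  define s where "s = u z"
  have "2 * F s = K" using Pz \<open>w z = 0\<close> unfolding P_def s_def by simp
  then have Fs: "F s = 0" and K0: "K = 0" using F_le[of s] K_ge by auto
  have sM: "0 \<le> s" "s \<le> M" using u_bounds z closure_subset unfolding s_def by auto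
  obtain C1 where C1: "C1 \<ge> 0" and f_le: "\<And>r. 0 \<le> r \<Longrightarrow> r \<le> M \<Longrightarrow> \<bar>f r\<bar> \<le> C1 * \<bar>r - s\<bar>"
    using f_bound_at_zero_of_F[OF sM Fs] by blast
  have F_ge: "\<bar>F r\<bar> \<le> (C1 * \<bar>r - s\<bar>) * \<bar>r - s\<bar>" if "0 \<le> r" "r \<le> M" for r
  proof -
    have "norm (F r - F s) \<le> (C1 * \<bar>r - s\<bar>) * norm (r - s)"
    proof (rule field_differentiable_bound[of "closed_segment r s" F f])
      fix x assume x: "x \<in> closed_segment r s"
      then have "0 \<le> x" "x \<le> M" "\<bar>x - s\<bar> \<le> \<bar>r - s\<bar>"
        using that sM by (auto simp: closed_segment_eq_real_ivl split: if_splits)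
      then show "norm (f x) \<le> C1 * \<bar>r - s\<bar>" using f_le[of x] C1
        by (simp add: order_trans[OF _ mult_left_mono])
    qed (auto intro: has_field_derivative_at_within DERIV_F)
    then show ?thesis using Fs by simp
  qed
  \<comment> \<open>The summand 1 keeps \<open>L\<close> positive when \<open>C1 = 0\<close>, so
    that \<open>1 / (2 * L)\<close> is a radius.\<close>
  define L where "L = sqrt (2 * C1) + 1"
  have L: "L > 0" unfolding L_def using C1 by (smt (verit) real_sqrt_ge_zero)
  have G_le: "norm (G x) \<le> L * \<bar>u x - s\<bar>" if x: "x \<in> \<Omega>" for x
  proof -
    have ub: "0 \<le> u x" "u x \<le> M" using u_bounds x closure_subset by auto
    have "P x \<le> 0" using modica_estimate x closure_subset K0 by auto
    then have "w x \<le> 2 * C1 * \<bar>u x - s\<bar>\<^sup>2"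
      using F_ge[OF ub] unfolding P_def by (simp add: power2_eq_square)
    then have "norm (G x) \<le> sqrt (2 * C1 * \<bar>u x - s\<bar>\<^sup>2)"
      by (simp add: real_le_rsqrt dot_square_norm)
    also have "\<dots> = sqrt (2 * C1) * \<bar>u x - s\<bar>" by (simp add: real_sqrt_mult)
    also have "\<dots> \<le> L * \<bar>u x - s\<bar>" unfolding L_def by (intro mult_right_mono) auto
    finally show ?thesis .
  qed
  have us: "u x = s" if "x \<in> \<Omega>" for x
  proof (rule connected_level_set[OF connected_dom _ z _ _ that, of u])
    show "continuous_on \<Omega> u" using cont_u closure_subset by (rule continuous_on_subset)
    show "u z = s" by (simp add: s_def)
    fix y assume y: "y \<in> \<Omega>" "u y = s"
    obtain r0 where r0: "r0 > 0" "cball y r0 \<subseteq> \<Omega>" using open_contains_cball open_dom y by blast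
    \<comment> \<open>On a ball with \<open>L * r \<le> 1/2\<close> the mean value inequality bounds
      the maximum of \<open>|u - s|\<close> by half of itself, so \<open>u = s\<close> there. The
      level set is thus open, and the constant value would have to be the boundary value 0.\<close>
    define r where "r = min r0 (1 / (2 * L))"
    have "cball y r \<subseteq> cball y r0" unfolding r_def by (intro subset_cball) simp
    with r0(2) have r: "cball y r \<subseteq> \<Omega>" "r > 0" "L * r \<le> 1/2" unfolding r_def using r0(1) L
      by (auto simp: field_simps min_def)
    have "continuous_on (cball y r) (\<lambda>x. \<bar>u x - s\<bar>)"
      using r(1) closure_subset by (intro continuous_intros continuous_on_subset[OF cont_u]) auto
    then obtain m where m: "m \<in> cball y r" "\<And>x. x \<in> cball y r \<Longrightarrow> \<bar>u x - s\<bar> \<le> \<bar>u m - s\<bar>"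
      using continuous_attains_sup[of "cball y r" "\<lambda>x. \<bar>u x - s\<bar>"] r(2)
      by (metis cball_eq_empty compact_cball less_eq_real_def not_le)
    have "norm (u m - u y) \<le> (L * \<bar>u m - s\<bar>) * norm (m - y)"
    proof (rule differentiable_bound[of "cball y r" u "\<lambda>x h. h \<bullet> G x"])
      fix x assume x: "x \<in> cball y r"
      then show "(u has_derivative (\<lambda>h. h \<bullet> G x)) (at x within cball y r)"
        using grad_lap_onD(1)[OF gl_u] r(1) unfolding gderiv_def
        by (meson has_derivative_at_withinI subsetD)
      have "norm (G x) \<le> L * \<bar>u m - s\<bar>" 
        using G_le[of x] m(2)[OF x] r(1) x L by (smt (verit) mult_left_mono subsetD)
      then show "onorm (\<lambda>h. h \<bullet> G x) \<le> L * \<bar>u m - s\<bar>"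
        by (intro onorm_le) (metis Cauchy_Schwarz_ineq2 mult.commute mult_left_mono norm_ge_zero order_trans real_norm_def)
    qed (use m(1) r(2) in auto)
    also have "\<dots> \<le> (L * \<bar>u m - s\<bar>) * r"
      using m(1) L by (intro mult_left_mono) (auto simp: dist_norm norm_minus_commute)
    also have "\<dots> = (L * r) * \<bar>u m - s\<bar>" by simp
    also have "\<dots> \<le> 1/2 * \<bar>u m - s\<bar>" using r(3) by (rule mult_right_mono) simp
    finally have "\<bar>u m - s\<bar> = 0" using y(2) by simp
    then have "\<forall>x\<in>ball y r. u x = s" using m(2) by fastforce
    then show "\<exists>r>0. ball y r \<subseteq> \<Omega> \<and> (\<forall>y\<in>ball y r. u y = s)"
      using r by (meson ball_subset_cball order_trans)
  qed
  obtain p where p: "p \<in> frontier \<Omega>" using frontier_nonempty by blast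
  then have "p \<in> closure \<Omega>" by (simp add: frontier_def)
  then have "u p = s" using continuous_constant_on_closure[OF cont_u us] by blast
  then show False using u_frontier[OF p] u_pos[OF z] s_def by simp
qed

text \<open>Writing \<open>gw\<close> as \<open>grad_P\<close> minus a multiple of \<open>G\<close>
  in \<open>gw_bound\<close> bounds \<open>S\<close> from below up to a term linear in
  \<open>grad_P\<close>. Division by \<open>w\<close> is why a positive lower bound \<open>m\<close>
  is required.\<close>

lemma P_drift_ineq:
  assumes x: "x \<in> \<Omega>" and m: "m > 0" "w x \<ge> m" and C0: "\<bar>f (u x)\<bar> \<le> C0"
  shows "- lap_P x \<le> (2 * C0 / sqrt m) * norm (grad_P x)"
proof -
  define \<phi> where "\<phi> = f (u x)"
  define Y where "Y = gw x + (2 * \<phi>) *\<^sub>R G x"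
  define g where "g = norm (G x)"
  have wg: "w x = g\<^sup>2" unfolding g_def by (simp add: dot_square_norm)
  have gm: "g \<ge> sqrt m" using m(2) unfolding wg using g_def by (simp add: real_le_lsqrt)
  have g0: "g > 0" using gm m(1) by (smt (verit) real_sqrt_gt_zero)
  have gww: "gw x = Y - (2 * \<phi>) *\<^sub>R G x" unfolding Y_def by simp
  have "(norm (gw x))\<^sup>2 \<ge> (2 * \<phi>)\<^sup>2 * w x - 2 * (2 * \<phi>) * (Y \<bullet> G x)"
    unfolding gww power2_norm_eq_inner
    by (simp add: inner_diff_left inner_diff_right inner_commute power2_eq_square algebra_simps)
  then have "w x * (- (2 * S x - 2 * \<phi>\<^sup>2)) \<le> 2 * \<phi> * (Y \<bullet> G x)"
    using gw_bound[of x] by (simp add: power2_eq_square algebra_simps)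
  also have "\<dots> \<le> 2 * \<bar>\<phi>\<bar> * \<bar>Y \<bullet> G x\<bar>" using abs_ge_self[of "\<phi> * (Y \<bullet> G x)"] by (simp add: abs_mult)
  also have "\<dots> \<le> 2 * C0 * (norm Y * g)"
    using C0 Cauchy_Schwarz_ineq2[of Y "G x"] unfolding g_def \<phi>_def by (intro mult_mono) auto
  finally have "g * (g * (- (2 * S x - 2 * \<phi>\<^sup>2))) \<le> g * (2 * C0 * norm Y)"
    unfolding wg by (simp add: power2_eq_square algebra_simps)
  then have "g * (- (2 * S x - 2 * \<phi>\<^sup>2)) \<le> 2 * C0 * norm Y" using g0 by simp
  then have "- (2 * S x - 2 * \<phi>\<^sup>2) \<le> 2 * C0 * norm Y / g" using g0 by (simp add: field_simps)
  also have "\<dots> \<le> 2 * C0 * norm Y / sqrt m"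
    using gm m C0 by (intro divide_left_mono) (auto intro!: mult_pos_pos g0)
  finally show ?thesis unfolding Y_def \<phi>_def by simp
qed

lemma gl_Q: "grad_lap_on \<Omega> (\<lambda>x. K - P x) (\<lambda>x. - grad_P x) (\<lambda>x. - lap_P x)"
  by (rule grad_lap_on_eq[OF grad_lap_on_diff[OF grad_lap_on_const[of _ K] gl_P]]) auto

text \<open>The set where \<open>P = K\<close> is open: the gradient of \<open>u\<close> is nonzero
  at its points, so near them the drift inequality allows the strong minimum principle for
  \<open>K - P\<close>.\<close>

lemma P_constant:
  assumes z: "z \<in> \<Omega>" "P z = K" and x: "x \<in> \<Omega>"
  shows "P x = K"
proof (rule connected_level_set[OF connected_dom _ z(1) _ _ x, of P])
  show "continuous_on \<Omega> P" using cont_P closure_subset by (rule continuous_on_subset)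
  show "P z = K" by (rule z(2))
  fix y assume y: "y \<in> \<Omega>" "P y = K"
  define m where "m = w y / 2"
  have m: "m > 0" using max_point_gradient_pos[OF y] unfolding m_def by simp
  have "continuous_on \<Omega> w" using cont_w closure_subset by (rule continuous_on_subset)
  then have "open (\<Omega> \<inter> w -` {m<..})" by (rule continuous_open_preimage[OF _ open_dom open_greaterThan])
  moreover have "y \<in> \<Omega> \<inter> w -` {m<..}" using y m unfolding m_def by auto
  ultimately obtain R where R: "R > 0" "ball y R \<subseteq> \<Omega> \<inter> w -` {m<..}" using open_contains_ball by blast
  obtain C0 where C0: "C0 \<ge> 0" "\<And>s. 0 \<le> s \<Longrightarrow> s \<le> M \<Longrightarrow> \<bar>f s\<bar> \<le> C0" using f_bound by blast
  have "K - P x1 = 0" if x1: "x1 \<in> ball y (R/2)" for x1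
  proof (rule strong_minimum_principle[OF grad_lap_on_subset[OF gl_Q] _ _ _ _ x1])
    show "0 \<le> 2 * C0 / sqrt m" using C0 m by simp
    fix x assume "x \<in> ball y R"
    then have x: "x \<in> \<Omega>" "x \<in> closure \<Omega>" "w x > m" using R(2) closure_subset[of \<Omega>] by auto
    show Q: "0 \<le> K - P x" using modica_estimate[OF x(2)] by simp
    have "0 \<le> (2 * C0 / sqrt m) * (K - P x)" using Q C0 m by simp
    then show "- lap_P x \<le> (2 * C0 / sqrt m) * norm (- grad_P x) + (2 * C0 / sqrt m) * (K - P x)"
      using P_drift_ineq[OF x(1) m _ C0(2), of] x(3) u_bounds[OF x(2)] by (simp only: norm_minus_cancel) fastforce
  qed (use R y in auto)
  then show "\<exists>r>0. ball y r \<subseteq> \<Omega> \<and> (\<forall>y\<in>ball y r. P y = K)"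
    using R by (intro exI[of _ "R/2"]) force
qed

end

section \<open>Rigidity when the bound is attained\<close>

context overdetermined begin

text \<open>On a one-dimensional solution with \<open>P = K\<close> the slope of the profile is
  \<open>1 / \<rho> (u x)\<close>. The primitive \<open>\<Psi>\<close> below inverts the profile, so
  \<open>\<Psi> (u x)\<close> is the distance to the boundary in the model case.\<close>

definition \<rho> :: "real \<Rightarrow> real" where "\<rho> s = 1 / sqrt (K - 2 * F s)"

definition \<Psi> :: "real \<Rightarrow> real" where "\<Psi> s = (LBINT t=ereal 0..ereal s. \<rho> t)"

lemma \<Psi>_0 [simp]: "\<Psi> 0 = 0"
  unfolding \<Psi>_def by (simp add: zero_ereal_def[symmetric])

lemma K_minus_F_0: "K - 2 * F 0 = \<kappa>\<^sup>2"
  unfolding K by simp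

abbreviation N :: "'a \<Rightarrow> 'a" where "N x \<equiv> \<rho> (u x) *\<^sub>R G x"

abbreviation lap_U :: "'a \<Rightarrow> real" where
  "lap_U x \<equiv> \<rho> (u x) * (- f (u x)) + f (u x) * \<rho> (u x) ^ 3 * w x"

lemma DERIV_\<rho>:
  assumes "K - 2 * F s > 0"
  shows "(\<rho> has_real_derivative f s * \<rho> s ^ 3) (at s)"
proof -
  have 1: "((\<lambda>s. K - 2 * F s) has_real_derivative (- 2 * f s)) (at s)"
    by (auto intro!: derivative_eq_intros DERIV_F)
  define r where "r = sqrt (K - 2 * F s)"
  have r: "r \<noteq> 0" unfolding r_def using assms by simp
  have "((\<lambda>s. sqrt (K - 2 * F s)) has_real_derivative (inverse r / 2) * (- 2 * f s)) (at s)"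
    unfolding r_def by (rule DERIV_chain2[OF DERIV_real_sqrt[OF assms] 1])
  from DERIV_divide[OF DERIV_const[of 1] this, folded r_def, OF r]
  have "((\<lambda>s. 1 / sqrt (K - 2 * F s)) has_real_derivative f s * (1 / r) ^ 3) (at s)"
    by (rule DERIV_cong) (use r in \<open>simp add: field_simps power3_eq_cube\<close>)
  then show ?thesis unfolding \<rho>_def r_def .
qed

text \<open>By openness positivity persists slightly beyond both ends of \<open>[0, s]\<close>. The
  derivative is therefore two-sided also at \<open>s = 0\<close>, the boundary value of
  \<open>u\<close>.\<close>

lemma DERIV_\<Psi>:
  assumes s: "s \<ge> 0" and pos: "\<And>t. 0 \<le> t \<Longrightarrow> t \<le> s \<Longrightarrow> K - 2 * F t > 0"
  shows "(\<Psi> has_real_derivative \<rho> s) (at s)"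
proof -
  have op: "open {t. K - 2 * F t > 0}"
    by (intro open_Collect_less continuous_intros cont_F)
  have "0 \<in> {t. K - 2 * F t > 0}" "s \<in> {t. K - 2 * F t > 0}" using s pos by auto
  then obtain e1 e2 where e: "e1 > 0" "ball 0 e1 \<subseteq> {t. K - 2 * F t > 0}" "e2 > 0" "ball s e2 \<subseteq> {t. K - 2 * F t > 0}"
    using op open_contains_ball by meson
  define a where "a = - e1 / 2"
  define b where "b = s + e2 / 2"
  have ab: "a < 0" "s < b" unfolding a_def b_def using e by auto
  have pos2: "K - 2 * F t > 0" if "t \<in> {a..b}" for t
  proof -
    consider "t < 0" | "0 \<le> t" "t \<le> s" | "s < t" by linarith
    then show ?thesis
    proof cases
      case 1
      then have "t \<in> ball 0 e1" using that e(1) unfolding a_def by (auto simp: dist_norm)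
      then show ?thesis using e by auto
    next
      case 3
      then have "t \<in> ball s e2" using that e(3) unfolding b_def by (auto simp: dist_norm)
      then show ?thesis using e by auto
    qed (use pos in auto)
  qed
  have "continuous_on {a..b} \<rho>"
    using DERIV_\<rho>[OF pos2] by (meson DERIV_continuous continuous_at_imp_continuous_on)
  then have "(\<Psi> has_vector_derivative \<rho> s) (at s within {a..b})"
    unfolding \<Psi>_def using ab s by (intro interval_integral_FTC2) auto
  moreover have "at s within {a..b} = at s" using ab s by (intro at_within_interior) auto
  ultimately show ?thesis by (simp add: has_real_derivative_iff_has_vector_derivative)
qed

lemma gl_U:
  assumes "T \<subseteq> \<Omega>" and pos: "\<And>x t. x \<in> T \<Longrightarrow> 0 \<le> t \<Longrightarrow> t \<le> u x \<Longrightarrow> K - 2 * F t > 0"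
  shows "grad_lap_on T (\<lambda>x. \<Psi> (u x)) N
    lap_U"
proof (rule grad_lap_on_compose[OF grad_lap_on_subset[OF gl_u assms(1)]])
  fix x assume x: "x \<in> T"
  then have ux: "u x \<ge> 0" using assms(1) u_pos[of x] by auto
  show "(\<Psi> has_real_derivative \<rho> (u x)) (at (u x))" using ux pos[OF x] by (rule DERIV_\<Psi>)
  show "(\<rho> has_real_derivative f (u x) * \<rho> (u x) ^ 3) (at (u x))" using DERIV_\<rho>[OF pos[OF x ux]] by simp
qed

lemma \<rho>_sq: "K - 2 * F s > 0 \<Longrightarrow> (\<rho> s)\<^sup>2 * (K - 2 * F s) = 1" "K - 2 * F s > 0 \<Longrightarrow> \<rho> s > 0"
  unfolding \<rho>_def by (auto simp: power_divide)

text \<open>Equality in Modica's estimate forces equality in \<open>gw_bound\<close>, so the Hessian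
  of \<open>u\<close> is a multiple of the tensor square of the gradient. Then \<open>N\<close> has
  derivative zero and \<open>\<Psi> (u x)\<close> is affine.\<close>

lemma half_space_of_P_constant:
  assumes \<kappa>: "\<kappa> > 0" and PK: "\<And>x. x \<in> \<Omega> \<Longrightarrow> P x = K"
  shows "\<exists>x0 (g :: real \<Rightarrow> real) a. \<Omega> = {x. a \<bullet> (x - x0) > 0} \<and> (\<forall>x\<in>\<Omega>. u x = g (a \<bullet> (x - x0)))"
proof -
  have wpos: "w x > 0" if "x \<in> \<Omega>" for x using max_point_gradient_pos[OF that PK[OF that]] .
  have wF: "w x = K - 2 * F (u x)" if "x \<in> \<Omega>" for x using PK[OF that] unfolding P_def by linarith
  obtain x0 where x0: "x0 \<in> frontier \<Omega>" using frontier_nonempty by blast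
  have x0c: "x0 \<in> closure \<Omega>" using x0 by (simp add: frontier_def)
  \<comment> \<open>Connectedness and the boundary value 0 make every \<open>t\<close> in
    \<open>(0, u x]\<close> a value of \<open>u\<close> in the domain, and there
    \<open>K - 2 F t\<close> is a positive squared gradient length. The value 0 is covered by
    \<kappa> > 0.\<close>
  have pos: "K - 2 * F t > 0" if x: "x \<in> \<Omega>" and t: "0 \<le> t" "t \<le> u x" for x t
  proof (cases "t = 0")
    case True
    then show ?thesis using K_minus_F_0 \<kappa> by simp
  next
    case False
    have "\<exists>y\<in>\<Omega>. u y < t"
    proof (rule ccontr)
      assume "\<not> (\<exists>y\<in>\<Omega>. u y < t)"
      then have "u x0 \<ge> t" by (intro continuous_ge_on_closure[OF cont_u x0c]) auto
      then show False using u_frontier[OF x0] False t by simp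
    qed
    then obtain y where y: "y \<in> \<Omega>" "u y < t" by blast
    have "connected (u ` \<Omega>)"
      using continuous_on_subset[OF cont_u closure_subset] connected_dom by (rule connected_continuous_image)
    then have "{u y..u x} \<subseteq> u ` \<Omega>" using connected_contains_Icc x y by blast
    then obtain z where "z \<in> \<Omega>" "u z = t" using y t by (metis atLeastAtMost_iff imageE less_imp_le subsetD)
    then show ?thesis using wpos wF by metis
  qed
  have poscl: "K - 2 * F t > 0" if "x \<in> closure \<Omega>" "0 \<le> t" "t \<le> u x" for x t
    using that(1) by (rule closure_cases) (use that pos u_frontier K_minus_F_0 \<kappa> in auto)
  have gN: "((\<lambda>x. N x \<bullet> b) has_derivative (\<lambda>h. 0)) (at x)" if x: "x \<in> \<Omega>" and b: "b \<in> Basis" for x b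
  proof -
    have Pmax: "P y \<le> P x" if "y \<in> \<Omega>" for y using PK x that by simp
    \<comment> \<open>Every point is a maximum of \<open>P\<close>. The vanishing gradient gives
      \<open>gw\<close>, the sign of the Laplacian gives the bound on \<open>S\<close>. With
      \<open>X = gw / (2 w)\<close> the sum of squares in \<open>sum_sq_dev\<close> is then
      \<open>S - f\<^sup>2 \<le> 0\<close>, and each square vanishes.\<close>
    have gw: "gw x = - (2 * f (u x)) *\<^sub>R G x" and S: "S x \<le> (f (u x))\<^sup>2"
      using grad_lap_on_local_max[OF gl_P open_dom x Pmax] by (auto simp: eq_neg_iff_add_eq_0)
    define X where "X = (- f (u x) / w x) *\<^sub>R G x"
    have "(\<Sum>b\<in>Basis. (norm (gG b x - (G x \<bullet> b) *\<^sub>R X))\<^sup>2) = S x - (f (u x))\<^sup>2"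
      unfolding sum_sq_dev gw X_def using wpos[OF x] by (simp add: field_simps power2_eq_square)
    also have "\<dots> \<le> 0" using S by simp
    finally have "(\<Sum>b\<in>Basis. (norm (gG b x - (G x \<bullet> b) *\<^sub>R X))\<^sup>2) = 0"
      by (intro antisym sum_nonneg) auto
    then have gGb: "gG b x = (G x \<bullet> b) *\<^sub>R X" using b by (simp add: sum_nonneg_eq_0_iff)
    have ux: "u x \<ge> 0" using u_pos[OF x] by simp
    have "GDERIV (\<lambda>x. \<rho> (u x)) x :> (f (u x) * \<rho> (u x) ^ 3) *\<^sub>R G x"
      by (rule GDERIV_DERIV_compose[OF grad_lap_onD(1)[OF gl_u x] DERIV_\<rho>[OF pos[OF x ux]]]) simp
    from GDERIV_mult[OF this grad_lap_onD(1)[OF gl_G[OF b] x]]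
    have "GDERIV (\<lambda>x. \<rho> (u x) * (G x \<bullet> b)) x :>
        (\<rho> (u x) *\<^sub>R gG b x + (G x \<bullet> b) *\<^sub>R ((f (u x) * \<rho> (u x) ^ 3) *\<^sub>R G x))" .
    moreover have "\<rho> (u x) *\<^sub>R gG b x + (G x \<bullet> b) *\<^sub>R ((f (u x) * \<rho> (u x) ^ 3) *\<^sub>R G x) = 0"
    proof -
      have "(\<rho> (u x))\<^sup>2 * w x = 1" using \<rho>_sq(1)[of "u x"] wF[OF x] wpos[OF x] by simp
      then have "\<rho> (u x) ^ 3 = \<rho> (u x) / w x" using wpos[OF x]
        by (simp add: field_simps power2_eq_square power3_eq_cube)
      then show ?thesis unfolding gGb X_def by (simp add: algebra_simps)
    qed
    ultimately show ?thesis unfolding gderiv_def by (simp add: inner_commute)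
  qed
  obtain z0 where z0: "z0 \<in> \<Omega>" using x0c by fastforce
  define a where "a = N z0"
  have Na: "N x = a" if "x \<in> \<Omega>" for x
  proof (rule euclidean_eqI)
    fix b :: 'a assume b: "b \<in> Basis"
    show "N x \<bullet> b = a \<bullet> b"
      unfolding a_def by (rule has_derivative_zero_unique_connected[OF open_dom connected_dom gN[OF _ b] that z0])
  qed
  have "((\<lambda>x. \<Psi> (u x) - a \<bullet> (x - x0)) has_derivative (\<lambda>h. 0)) (at x)" if x: "x \<in> \<Omega>" for x
  proof -
    have "((\<lambda>x. \<Psi> (u x)) has_derivative (\<lambda>h. h \<bullet> a)) (at x)"
      using grad_lap_onD(1)[OF gl_U[OF order_refl] x] pos Na[OF x] unfolding gderiv_def by auto
    then show ?thesis by (auto intro!: derivative_eq_intros simp: inner_commute)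
  qed
  from has_derivative_zero_unique_connected[OF open_dom connected_dom this _ z0]
  have const: "\<Psi> (u x) - a \<bullet> (x - x0) = \<Psi> (u z0) - a \<bullet> (z0 - x0)" if "x \<in> \<Omega>" for x using that by blast
  have "isCont \<Psi> s" if s: "s \<in> u ` closure \<Omega>" for s
  proof -
    obtain x where "x \<in> closure \<Omega>" "s = u x" using s by blast
    then have "(\<Psi> has_real_derivative \<rho> s) (at s)" using poscl u_bounds by (intro DERIV_\<Psi>) auto
    then show ?thesis by (rule DERIV_isCont)
  qed
  then have "continuous_on (u ` closure \<Omega>) \<Psi>"
    by (simp add: continuous_at_imp_continuous_on)
  then have "continuous_on (closure \<Omega>) (\<lambda>x. \<Psi> (u x))"
    by (rule continuous_on_compose2[OF _ cont_u]) simp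
  then have "continuous_on (closure \<Omega>) (\<lambda>x. \<Psi> (u x) - a \<bullet> (x - x0))"
    by (intro continuous_intros)
  from continuous_constant_on_closure[OF this const]
  have cl: "\<Psi> (u x) - a \<bullet> (x - x0) = \<Psi> (u z0) - a \<bullet> (z0 - x0)" if "x \<in> closure \<Omega>" for x using that by blast
  have eq: "\<Psi> (u x) = a \<bullet> (x - x0)" if "x \<in> closure \<Omega>" for x
    using cl[OF that] cl[OF x0c] u_frontier[OF x0] by simp
  have mono: "\<Psi> s < \<Psi> t" if "0 \<le> s" "s < t" "t \<le> u x" "x \<in> closure \<Omega>" for s t x
  proof (rule DERIV_pos_imp_increasing[OF that(2)])
    fix r assume r: "s \<le> r" "r \<le> t"
    have "(\<Psi> has_real_derivative \<rho> r) (at r)" "\<rho> r > 0"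
      using r that poscl[OF that(4)] by (auto intro!: DERIV_\<Psi> \<rho>_sq)
    then show "\<exists>y. (\<Psi> has_real_derivative y) (at r) \<and> 0 < y" by blast
  qed
  have inj: "u x = u y" if "x \<in> \<Omega>" "y \<in> \<Omega>" "a \<bullet> (x - x0) = a \<bullet> (y - x0)" for x y
  proof -
    have xy: "x \<in> closure \<Omega>" "y \<in> closure \<Omega>" using that closure_subset by auto
    then have "\<Psi> (u x) = \<Psi> (u y)" using eq that by simp
    then show ?thesis using mono[of "u x" "u y" y] mono[of "u y" "u x" x] u_bounds xy
      by (metis linorder_neq_iff order_less_irrefl order_refl)
  qed
  define H where "H = {x. a \<bullet> (x - x0) > 0}"
  have sub: "\<Omega> \<subseteq> H"
  proof
    fix x assume x: "x \<in> \<Omega>"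
    then have xc: "x \<in> closure \<Omega>" using closure_subset by auto
    show "x \<in> H" using mono[of 0 "u x" x] u_pos[OF x] xc eq[OF xc] unfolding H_def by simp
  qed
  have "convex H"
  proof -
    have "H = {x. a \<bullet> x > a \<bullet> x0}" unfolding H_def by (auto simp: inner_diff_right)
    then show ?thesis using convex_halfspace_gt by metis
  qed
  \<comment> \<open>If the connected set \<open>H\<close> were not contained in the domain it would
    meet the frontier, but there \<open>u = 0\<close> puts the point on the bounding
    hyperplane.\<close>
  have "H \<subseteq> \<Omega>"
  proof (rule ccontr)
    assume "\<not> H \<subseteq> \<Omega>"
    then have "H \<inter> frontier \<Omega> \<noteq> {}"
      using sub z0 by (intro connected_Int_frontier convex_connected \<open>convex H\<close>) auto
    then obtain p where p: "p \<in> frontier \<Omega>" "p \<in> H" by blast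
    then have "p \<in> closure \<Omega>" by (simp add: frontier_def)
    then show False using eq[of p] u_frontier p unfolding H_def by auto
  qed
  with sub have "\<Omega> = H" by blast
  \<comment> \<open>The profile is read off from any point with the prescribed height. By
    \<open>inj\<close>, that is by strict monotonicity of \<open>\<Psi>\<close>, the choice does not
    matter.\<close>
  moreover define g where "g r = (SOME s. \<exists>y\<in>\<Omega>. a \<bullet> (y - x0) = r \<and> u y = s)" for r
  have "u x = g (a \<bullet> (x - x0))" if x: "x \<in> \<Omega>" for x
  proof -
    have "\<exists>s. \<exists>y\<in>\<Omega>. a \<bullet> (y - x0) = a \<bullet> (x - x0) \<and> u y = s" using x by blast
    from someI_ex[OF this] obtain y where "y \<in> \<Omega>" "a \<bullet> (y - x0) = a \<bullet> (x - x0)" "u y = g (a \<bullet> (x - x0))"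
      unfolding g_def by blast
    then show ?thesis using inj[OF x, of y] by simp
  qed
  ultimately show ?thesis unfolding H_def by blast
qed

end

section \<open>Curvature of the boundary when the bound is strict\<close>

lemma first_exit:
  fixes x :: "'a::real_normed_vector"
  assumes "open O'" "x \<in> O'" "d > 0" "x + d *\<^sub>R v \<notin> O'"
  obtains \<tau> where "0 < \<tau>" "\<tau> \<le> d" "x + \<tau> *\<^sub>R v \<in> frontier O'" "\<And>t. 0 \<le> t \<Longrightarrow> t < \<tau> \<Longrightarrow> x + t *\<^sub>R v \<in> O'"
proof -
  define E where "E = {t \<in> {0..d}. x + t *\<^sub>R v \<in> - O'}"
  have "closed E" unfolding E_def
    using continuous_closed_preimage[of "{0..d}" "\<lambda>t. x + t *\<^sub>R v" "- O'"] assms(1)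
    by (simp add: closed_Compl vimage_def Int_def continuous_intros)
  moreover have "E \<noteq> {}" "bdd_below E" using assms unfolding E_def by (auto intro: exI[of _ d] bdd_belowI[of _ 0])
  ultimately have "Inf E \<in> E" by (simp add: closed_contains_Inf)
  define \<tau> where "\<tau> = Inf E"
  have \<tau>: "0 \<le> \<tau>" "\<tau> \<le> d" "x + \<tau> *\<^sub>R v \<notin> O'" using \<open>Inf E \<in> E\<close> unfolding \<tau>_def E_def by auto
  have "\<tau> \<noteq> 0" using \<tau>(3) assms(2) by auto
  then have pos: "\<tau> > 0" using \<tau> by simp
  have before: "x + t *\<^sub>R v \<in> O'" if "0 \<le> t" "t < \<tau>" for t
  proof (rule ccontr)
    assume "x + t *\<^sub>R v \<notin> O'"
    then have "t \<in> E" unfolding E_def using that \<tau> by auto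
    then have "\<tau> \<le> t" unfolding \<tau>_def using \<open>bdd_below E\<close> by (rule cInf_lower)
    then show False using that by simp
  qed
  have "((\<lambda>t. x + t *\<^sub>R v) \<longlongrightarrow> x + \<tau> *\<^sub>R v) (at_left \<tau>)"
    by (intro tendsto_intros)
  moreover have "\<forall>\<^sub>F t in at_left \<tau>. x + t *\<^sub>R v \<in> closure O'"
    using pos before closure_subset[of O'] by (intro eventually_at_leftI[of 0]) auto
  ultimately have "x + \<tau> *\<^sub>R v \<in> closure O'"
    by (rule Lim_in_closed_set[OF closed_closure _ trivial_limit_at_left_real, rotated])
  then have "x + \<tau> *\<^sub>R v \<in> frontier O'" using \<tau>(3) assms(1) by (simp add: frontier_def interior_open)
  with pos \<tau>(2) before show ?thesis using that by blast
qed

lemma le_by_derivative: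
  fixes h :: "real \<Rightarrow> real"
  assumes "a \<le> b" "continuous_on {a..b} h"
    and "\<And>t. a < t \<Longrightarrow> t < b \<Longrightarrow> (h has_real_derivative h' t) (at t)"
    and "\<And>t. a < t \<Longrightarrow> t < b \<Longrightarrow> h' t \<ge> - 1"
  shows "h a \<le> h b + (b - a)"
proof -
  have "h a + a \<le> h b + b"
  proof (rule DERIV_nonneg_imp_increasing_open[OF assms(1)])
    fix t assume t: "a < t" "t < b"
    then show "\<exists>y. ((\<lambda>t. h t + t) has_real_derivative y) (at t) \<and> 0 \<le> y"
      using assms(3)[OF t] assms(4)[OF t] by (intro exI[of _ "h' t + 1"]) (auto intro!: derivative_eq_intros)
  qed (use assms(2) in \<open>intro continuous_intros\<close>)
  then show ?thesis by simp
qed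

lemma tangent_ball_subset:
  fixes p \<nu> :: "'a::real_normed_vector"
  assumes "norm \<nu> = 1" "0 \<le> r'" "r' \<le> r"
  shows "ball (p - r' *\<^sub>R \<nu>) r' \<subseteq> ball (p - r *\<^sub>R \<nu>) r" "cball (p - r' *\<^sub>R \<nu>) r' \<subseteq> cball (p - r *\<^sub>R \<nu>) r"
proof -
  have "dist (p - r *\<^sub>R \<nu>) (p - r' *\<^sub>R \<nu>) = r - r'"
    using assms by (simp add: dist_norm flip: scaleR_diff_left)
  then have *: "dist (p - r *\<^sub>R \<nu>) x \<le> (r - r') + dist (p - r' *\<^sub>R \<nu>) x" for x
    using dist_triangle[of "p - r *\<^sub>R \<nu>" x "p - r' *\<^sub>R \<nu>"] by simp
  then show "ball (p - r' *\<^sub>R \<nu>) r' \<subseteq> ball (p - r *\<^sub>R \<nu>) r"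
    by (auto simp: subset_iff) (smt (verit))
  from * show "cball (p - r' *\<^sub>R \<nu>) r' \<subseteq> cball (p - r *\<^sub>R \<nu>) r"
    by (auto simp: subset_iff) (smt (verit))
qed

text \<open>In a ball tangent at \<open>p\<close> the squared distance to \<open>p\<close> is at
  most \<open>2 * r\<close> times the depth \<open>- (\<nu> \<bullet> (x - p))\<close>. Quadratic
  terms at \<open>p\<close> are thus small compared with the depth once \<open>r\<close> is
  small.\<close>

lemma tangent_cball_bounds:
  fixes p \<nu> x :: "'a::euclidean_space"
  assumes \<nu>: "norm \<nu> = 1" and r: "r > 0" and x: "x \<in> cball (p - r *\<^sub>R \<nu>) r"
  shows "dist x p \<le> 2 * r" and "(x - p) \<bullet> (x - p) \<le> 2 * r * (- (\<nu> \<bullet> (x - p)))"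
    and "- (\<nu> \<bullet> (x - p)) \<le> 2 * r"
proof -
  have \<nu>\<nu>: "\<nu> \<bullet> \<nu> = 1" using \<nu> by (simp add: dot_square_norm)
  define c where "c = p - r *\<^sub>R \<nu>"
  have "dist c p = r" unfolding c_def using \<nu> r by (simp add: dist_norm)
  then show d: "dist x p \<le> 2 * r" using x dist_triangle[of x p c] by (simp add: c_def dist_commute)
  have "(dist c x)\<^sup>2 \<le> r\<^sup>2" using x unfolding c_def by (intro power_mono) auto
  moreover have "(dist c x)\<^sup>2 = (x - c) \<bullet> (x - c)" by (simp add: dist_norm norm_minus_commute dot_square_norm)
  moreover have xc: "x - c = (x - p) + r *\<^sub>R \<nu>" unfolding c_def by simp
  have "(x - c) \<bullet> (x - c) = (x - p) \<bullet> (x - p) + 2 * r * (\<nu> \<bullet> (x - p)) + r\<^sup>2"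
    unfolding xc using \<nu>\<nu> by (simp add: inner_add_left inner_add_right inner_commute power2_eq_square)
  ultimately show "(x - p) \<bullet> (x - p) \<le> 2 * r * (- (\<nu> \<bullet> (x - p)))" by simp
  have "- (\<nu> \<bullet> (x - p)) \<le> norm \<nu> * norm (x - p)" using Cauchy_Schwarz_ineq2[of \<nu> "x - p"] by linarith
  then show "- (\<nu> \<bullet> (x - p)) \<le> 2 * r" using d \<nu> by (simp add: dist_norm)
qed

text \<open>Turns the conclusion of \<open>hopf_ball\<close> into linear growth along the inward
  normal, since \<open>r\<^sup>2 - (r - t)\<^sup>2 \<ge> r t\<close>.\<close>

lemma slope_of_tangent_ball_bound:
  fixes p \<nu> :: "'a::real_normed_vector"
  assumes \<nu>: "norm \<nu> = 1" and k: "k > 0" and t: "0 < t" "t < r"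
    and q: "\<And>x. x \<in> cball (p - r *\<^sub>R \<nu>) r \<Longrightarrow> q x \<ge> k * (r\<^sup>2 - (norm (x - (p - r *\<^sub>R \<nu>)))\<^sup>2)"
  shows "q (p - t *\<^sub>R \<nu>) \<ge> (k * r) * t"
proof -
  have n: "norm (p - t *\<^sub>R \<nu> - (p - r *\<^sub>R \<nu>)) = r - t"
    using \<nu> t by (simp flip: scaleR_diff_left)
  then have "p - t *\<^sub>R \<nu> \<in> cball (p - r *\<^sub>R \<nu>) r" using t by (subst mem_cball, subst dist_commute) (simp add: dist_norm)
  from q[OF this] have "q (p - t *\<^sub>R \<nu>) \<ge> k * (r\<^sup>2 - (r - t)\<^sup>2)" unfolding n .
  moreover have "r\<^sup>2 - (r - t)\<^sup>2 = r * t + t * (r - t)" by (simp add: power2_eq_square algebra_simps)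
  then have "r\<^sup>2 - (r - t)\<^sup>2 \<ge> r * t" using t by simp
  then have "k * (r\<^sup>2 - (r - t)\<^sup>2) \<ge> k * (r * t)" using k by (intro mult_left_mono) auto
  ultimately show ?thesis by simp
qed

text \<open>No derivative at \<open>p\<close> is assumed. The linear lower bound is passed to
  gradients at interior points close to \<open>p\<close>, where it can be confronted with continuity
  of the gradient up to the boundary.\<close>

lemma slope_near_boundary:
  fixes p \<nu> :: "'a::euclidean_space" and q :: "'a \<Rightarrow> real"
  assumes \<nu>: "norm \<nu> = 1" and r: "r > 0" and ball: "ball (p - r *\<^sub>R \<nu>) r \<subseteq> T"
    and cont: "continuous_on (closure T) q" and gd: "\<And>x. x \<in> T \<Longrightarrow> GDERIV q x :> g x"
    and q: "q p = 0" "\<And>t. 0 < t \<Longrightarrow> t < r \<Longrightarrow> q (p - t *\<^sub>R \<nu>) \<ge> k * t" and e: "e > 0"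
  shows "\<exists>x\<in>T. dist x p < e \<and> g x \<bullet> (- \<nu>) \<ge> k"
proof -
  define t where "t = min e r / 2"
  have t: "0 < t" "t < e" "t < r" unfolding t_def using e r by auto
  have inT: "p + s *\<^sub>R (- \<nu>) \<in> T" if "0 < s" "s < 2 * r" for s
  proof -
    have "dist (p - r *\<^sub>R \<nu>) (p + s *\<^sub>R (- \<nu>)) = \<bar>s - r\<bar>"
      using \<nu> by (simp add: dist_norm flip: scaleR_diff_left)
    then show ?thesis using ball that by auto
  qed
  have pc: "p \<in> closure T"
  proof -
    have "dist (p - r *\<^sub>R \<nu>) p = r" using \<nu> r by (simp add: dist_norm)
    then have "p \<in> closure (ball (p - r *\<^sub>R \<nu>) r)" using r by simp
    then show ?thesis using closure_mono[OF ball] by blast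
  qed
  have inTt: "p + s *\<^sub>R (- \<nu>) \<in> T" if "0 < s" "s \<le> t" for s using inT[of s] that t r by linarith
  obtain z where z: "0 < z" "z < t"
    "q (p + t *\<^sub>R (- \<nu>)) - q p = t * (g (p + z *\<^sub>R (- \<nu>)) \<bullet> (- \<nu>))"
    by (rule mean_value_segment[OF t(1) inTt pc cont gd])
  then have "t * (g (p + z *\<^sub>R (- \<nu>)) \<bullet> (- \<nu>)) \<ge> t * k" using q(1) q(2)[OF t(1,3)] by (simp add: mult.commute)
  then have "g (p + z *\<^sub>R (- \<nu>)) \<bullet> (- \<nu>) \<ge> k" using t(1) by (rule mult_left_le_imp_le)
  moreover have "dist (p + z *\<^sub>R (- \<nu>)) p < e" using z t \<nu> by (simp add: dist_norm)
  moreover have "p + z *\<^sub>R (- \<nu>) \<in> T" using inT[of z] z t r by linarith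
  ultimately show ?thesis by blast
qed

context overdetermined begin

lemma near_boundary_point:
  fixes h :: "'a \<Rightarrow> real"
  assumes "continuous_on (closure \<Omega>) h" "p \<in> closure \<Omega>" "h p < c"
  obtains e where "e > 0" "\<And>x. x \<in> closure \<Omega> \<Longrightarrow> dist x p < e \<Longrightarrow> h x < c"
proof -
  have "\<exists>e>0. \<forall>x\<in>closure \<Omega>. dist x p < e \<longrightarrow> dist (h x) (h p) < c - h p"
    using assms unfolding continuous_on_iff by auto
  then obtain e where e: "e > 0" "\<And>x. x \<in> closure \<Omega> \<Longrightarrow> dist x p < e \<Longrightarrow> dist (h x) (h p) < c - h p"
    by blast
  have "h x < c" if "x \<in> closure \<Omega>" "dist x p < e" for x
    using e(2)[OF that] by (simp add: dist_real_def)
  with e(1) show ?thesis by (rule that)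
qed

text \<open>For \<kappa> = 0 the sign conditions give \<open>F 0 = 0\<close>, so \<open>f\<close> is
  at most linear near 0. Hopf's lemma for \<open>u\<close> then yields a positive slope, against
  \<open>G p = 0\<close>. Positivity of \<kappa> keeps \<open>\<rho>\<close> regular at the boundary
  value 0.\<close>

lemma \<kappa>_pos:
  assumes \<kappa>: "\<kappa> \<ge> 0" and \<nu>: "norm \<nu> = 1" and r: "r > 0" and ball: "ball (p - r *\<^sub>R \<nu>) r \<subseteq> \<Omega>" and p: "p \<in> frontier \<Omega>"
  shows "\<kappa> > 0"
proof (rule ccontr)
  assume "\<not> \<kappa> > 0"
  then have \<kappa>0: "\<kappa> = 0" using \<kappa> by simp
  have pc: "p \<in> closure \<Omega>" using p by (simp add: frontier_def)
  have F0: "F 0 = 0" using K K_ge F_le[of 0] \<kappa>0 by simp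
  obtain C1 where C1: "C1 \<ge> 0" and f_le: "\<And>s. 0 \<le> s \<Longrightarrow> s \<le> M \<Longrightarrow> \<bar>f s\<bar> \<le> C1 * \<bar>s\<bar>"
    using f_bound_at_zero_of_F[OF order_refl M F0] by auto
  have cball: "cball (p - r *\<^sub>R \<nu>) r \<subseteq> closure \<Omega>" using closure_mono[OF ball] r by simp
  have "\<exists>k>0. \<forall>x\<in>cball (p - r *\<^sub>R \<nu>) r. u x \<ge> k * (r\<^sup>2 - (norm (x - (p - r *\<^sub>R \<nu>)))\<^sup>2)"
  proof (rule hopf_ball[OF r grad_lap_on_subset[OF gl_u ball] _ _ _ C1])
    show "continuous_on (cball (p - r *\<^sub>R \<nu>) r) u" using cont_u cball by (rule continuous_on_subset)
    fix x assume x: "x \<in> ball (p - r *\<^sub>R \<nu>) r"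
    show ux: "u x > 0" using u_pos ball x by auto
    have "x \<in> closure \<Omega>" using x ball closure_subset by blast
    then have "- f (u x) \<le> C1 * u x" using f_le[of "u x"] u_bounds[of x] by auto
    moreover have "0 \<le> C1 * norm (G x)" using C1 by simp
    ultimately show "- f (u x) \<le> C1 * norm (G x) + C1 * u x" by linarith
  qed (use cball u_bounds in auto)
  then obtain k where k: "k > 0" "\<And>x. x \<in> cball (p - r *\<^sub>R \<nu>) r \<Longrightarrow> u x \<ge> k * (r\<^sup>2 - (norm (x - (p - r *\<^sub>R \<nu>)))\<^sup>2)"
    by blast
  note slope = slope_of_tangent_ball_bound[OF \<nu> k(1) _ _ k(2)]
  have "G p = 0" using G_frontier[OF p] \<kappa>0 by simp
  then obtain e where e: "e > 0" "\<And>x. x \<in> closure \<Omega> \<Longrightarrow> dist x p < e \<Longrightarrow> norm (G x) < k * r"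
    using near_boundary_point[OF continuous_on_norm[OF cont_G] pc, of "k * r"] k(1) r by auto
  obtain x where x: "x \<in> \<Omega>" "dist x p < e" "G x \<bullet> (- \<nu>) \<ge> k * r"
    using slope_near_boundary[OF \<nu> r ball cont_u grad_lap_onD(1)[OF gl_u] u_frontier[OF p] slope e(1)] by auto
  have "G x \<bullet> (- \<nu>) \<le> norm (G x) * norm (- \<nu>)" by (rule norm_cauchy_schwarz)
  then show False using e(2)[of x] x closure_subset \<nu> by force
qed

text \<open>\<open>A\<close> stands for the shape operator at \<open>p\<close> and \<open>D\<close> for a quadratic upper bound of the distance to the
  boundary along the fixed direction \<open>\<nu>\<close>, with Laplacian close to \<open>- trace A\<close>. The function \<open>V\<close> below is
  nonnegative in a ball touching the boundary at \<open>p\<close>: it decreases along \<open>\<nu>\<close> up to the sphere \<open>l = 0\<close>, and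
  from there to the boundary of \<open>\<Omega>\<close> the bound \<open>|\<nabla>U| \<le> 1\<close> suffices.\<close>

lemma trace_shape_neg:
  assumes \<kappa>: "\<kappa> > 0" and Pless: "\<And>x. x \<in> \<Omega> \<Longrightarrow> P x < K" and p: "p \<in> frontier \<Omega>"
    and \<nu>: "norm \<nu> = 1" and Gp: "G p = - \<kappa> *\<^sub>R \<nu>"
    and r0: "r0 > 0" and ball: "ball (p - r0 *\<^sub>R \<nu>) r0 \<subseteq> \<Omega>"
    and A: "bounded_linear A" "\<And>x y. A x \<bullet> y = x \<bullet> A y" "A \<nu> = 0"
    and touch: "\<And>\<delta>. \<delta> > 0 \<Longrightarrow> \<exists>e>0. \<forall>y. y \<bullet> \<nu> = 0 \<longrightarrow> norm y < e \<longrightarrow>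
      p + y + (- (A y \<bullet> y) / 2 + \<delta> * (y \<bullet> y)) *\<^sub>R \<nu> \<notin> \<Omega>"
  shows "trace A < 0"
proof (rule ccontr)
  assume "\<not> trace A < 0"
  then have trA: "trace A \<ge> 0" by simp
  interpret A: bounded_linear A by fact
  define n where "n = real DIM('a)"
  have n: "n \<ge> 1" unfolding n_def by (simp add: DIM_positive Suc_leI)
  have pc: "p \<in> closure \<Omega>" using p by (simp add: frontier_def)
  have up: "u p = 0" using u_frontier[OF p] .
  have wp: "w p = \<kappa>\<^sup>2" using w_frontier[OF p] .
  have \<nu>\<nu>: "\<nu> \<bullet> \<nu> = 1" using \<nu> by (simp add: dot_square_norm)
  obtain BA where BA: "BA \<ge> 0" "\<And>y. \<bar>A y \<bullet> y\<bar> \<le> BA * (y \<bullet> y)"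
  proof -
    obtain B where B: "B \<ge> 0" "\<And>y. norm (A y) \<le> norm y * B" using A.nonneg_bounded by blast
    have "\<bar>A y \<bullet> y\<bar> \<le> B * (y \<bullet> y)" for y
    proof -
      have "\<bar>A y \<bullet> y\<bar> \<le> norm (A y) * norm y" by (rule Cauchy_Schwarz_ineq2)
      also have "\<dots> \<le> (norm y * B) * norm y" using B(2) by (rule mult_right_mono) simp
      also have "\<dots> = B * (y \<bullet> y)" by (simp add: dot_square_norm power2_eq_square)
      finally show ?thesis .
    qed
    with B(1) show ?thesis using that by blast
  qed
  have cF: "continuous_on UNIV (\<lambda>t. K - 2 * F t)" by (intro continuous_intros cont_F)
  have k2: "\<kappa>\<^sup>2 > 0" using \<kappa> by simp
  obtain s0 where s0: "s0 > 0" "\<And>t. \<bar>t\<bar> \<le> s0 \<Longrightarrow> K - 2 * F t > \<kappa>\<^sup>2 / 2 \<and> K - 2 * F t < 2 * \<kappa>\<^sup>2"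
  proof -
    have "\<kappa>\<^sup>2 / 2 > 0" using k2 by simp
    then obtain d where d: "d > 0" "\<And>t. dist t 0 < d \<Longrightarrow> dist (K - 2 * F t) (K - 2 * F 0) < \<kappa>\<^sup>2 / 2"
      using cF unfolding continuous_on_iff by (meson UNIV_I)
    have "K - 2 * F t > \<kappa>\<^sup>2 / 2 \<and> K - 2 * F t < 2 * \<kappa>\<^sup>2" if "\<bar>t\<bar> \<le> d / 2" for t
    proof -
      have "dist t 0 < d" using that d(1) by (simp add: dist_real_def)
      from d(2)[OF this] have "\<bar>K - 2 * F t - \<kappa>\<^sup>2\<bar> < \<kappa>\<^sup>2 / 2"
        unfolding K_minus_F_0 dist_real_def .
      then show ?thesis using k2 by (auto simp only: abs_less_iff)
    qed
    with d(1) show ?thesis using that[of "d/2"] by simp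
  qed
  obtain C0 where C0: "C0 \<ge> 0" "\<And>s. 0 \<le> s \<Longrightarrow> s \<le> M \<Longrightarrow> \<bar>f s\<bar> \<le> C0" using f_bound by blast
  obtain e1 where e1: "e1 > 0" "\<And>x. x \<in> closure \<Omega> \<Longrightarrow> dist x p < e1 \<Longrightarrow> u x < s0"
    using near_boundary_point[OF cont_u pc, of s0] up s0(1) by auto
  obtain e2 where e2: "e2 > 0" "\<And>x. x \<in> closure \<Omega> \<Longrightarrow> dist x p < e2 \<Longrightarrow> - w x < - \<kappa>\<^sup>2 / 4"
    using near_boundary_point[OF continuous_on_minus[OF cont_w] pc, of "- \<kappa>\<^sup>2 / 4"] wp k2 by auto
  define e where "e = min e1 e2"
  have e: "e > 0" "e \<le> e1" "e \<le> e2" unfolding e_def using e1 e2 by auto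
  have pos': "K - 2 * F t > \<kappa>\<^sup>2 / 2" "K - 2 * F t < 2 * \<kappa>\<^sup>2" if "x \<in> closure \<Omega>" "dist x p < e" "0 \<le> t" "t \<le> u x" for x t
    using s0(2)[of t] e1(2)[OF that(1)] e that by auto
  have pos: "K - 2 * F t > 0" "K - 2 * F t < 2 * \<kappa>\<^sup>2" if "x \<in> closure \<Omega>" "dist x p < e" "0 \<le> t" "t \<le> u x" for x t
    using pos'[OF that] k2 by auto
  define r1 where "r1 = min r0 (e / 3)"
  have r1: "r1 > 0" "r1 \<le> r0" "2 * r1 < e" unfolding r1_def using r0 e by auto
  define c1 where "c1 = p - r1 *\<^sub>R \<nu>"
  have B1: "ball c1 r1 \<subseteq> \<Omega>" using tangent_ball_subset(1)[OF \<nu> _ r1(2)] r1(1) ball unfolding c1_def by auto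
  have cB1: "cball c1 r1 \<subseteq> closure \<Omega>" using closure_mono[OF B1] r1 by simp
  have dist1: "dist x p < e" if "x \<in> cball c1 r1" for x
    using tangent_cball_bounds(1)[OF \<nu> r1(1), of x p] that r1(3) unfolding c1_def by simp
  \<comment> \<open>A lower bound for \<open>w\<close> within distance \<open>e\<close> of
    \<open>p\<close>, as the drift inequality for \<open>P\<close> requires.\<close>
  define m where "m = \<kappa>\<^sup>2 / 4"
  have m: "m > 0" unfolding m_def using k2 by simp
  define l where "l x = r1\<^sup>2 - (x - c1) \<bullet> (x - c1)" for x
  have "\<exists>k>0. \<forall>x\<in>cball c1 r1. K - P x \<ge> k * (r1\<^sup>2 - (norm (x - c1))\<^sup>2)"
  proof (rule hopf_ball[OF r1(1) grad_lap_on_subset[OF gl_Q B1]])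
    show "continuous_on (cball c1 r1) (\<lambda>x. K - P x)"
      by (intro continuous_intros continuous_on_subset[OF cont_P cB1])
    show "0 \<le> 2 * C0 / sqrt m" using C0 m by simp
    fix x assume x: "x \<in> ball c1 r1"
    have xO: "x \<in> \<Omega>" "x \<in> closure \<Omega>" using x B1 closure_subset[of \<Omega>] by auto
    show Q: "0 < K - P x" using Pless[OF xO(1)] by simp
    have "dist x p < e" using x dist1 by auto
    then have wx: "w x \<ge> m" using e2(2)[OF xO(2)] e unfolding m_def by simp
    have "0 \<le> (2 * C0 / sqrt m) * (K - P x)" using Q C0 m by simp
    moreover have "\<bar>f (u x)\<bar> \<le> C0" using C0(2) u_bounds[OF xO(2)] by simp
    ultimately show "- lap_P x \<le> (2 * C0 / sqrt m) * norm (- grad_P x) + (2 * C0 / sqrt m) * (K - P x)"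
      using P_drift_ineq[OF xO(1) m wx] by (simp only: norm_minus_cancel) fastforce
  qed (use modica_estimate cB1 in auto)
  then obtain k where k: "k > 0" "\<And>x. x \<in> cball c1 r1 \<Longrightarrow> K - P x \<ge> k * l x"
    unfolding l_def by (auto simp: dot_square_norm)
  \<comment> \<open>Near \<open>p\<close>,
    \<open>\<rho>\<^sup>2 \<ge> 1 / (2 \<kappa>\<^sup>2)\<close>. Hence \<open>|N|\<^sup>2 = 1 - (K
    - P) \<rho>\<^sup>2 \<le> 1 - 2 k' l \<le> (1 - k' l)\<^sup>2\<close> in the ball.\<close>
  define k' where "k' = k / (4 * \<kappa>\<^sup>2)"
  have k': "k' > 0" unfolding k'_def using k k2 by simp
  have rho_w: "(\<rho> (u x))\<^sup>2 * w x = 1 - (K - P x) * (\<rho> (u x))\<^sup>2" if x: "x \<in> closure \<Omega>" "dist x p < e" for x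
  proof -
    have "K - 2 * F (u x) > 0" using pos(1)[OF x, of "u x"] u_bounds[OF x(1)] by simp
    from \<rho>_sq(1)[OF this] show ?thesis unfolding P_def by (simp add: algebra_simps)
  qed
  have N_le: "norm (N x) \<le> 1" if x: "x \<in> closure \<Omega>" "dist x p < e" for x
  proof (rule power2_le_imp_le)
    have "0 \<le> (K - P x) * (\<rho> (u x))\<^sup>2" using modica_estimate[OF x(1)] by simp
    then show "(norm (N x))\<^sup>2 \<le> 1\<^sup>2"
      using rho_w[OF x] by (simp add: power_mult_distrib dot_square_norm)
  qed simp
  have l_nonneg: "l x \<ge> 0" if "x \<in> cball c1 r1" for x
    using that unfolding l_def by (simp add: dot_square_norm dist_norm norm_minus_commute power_mono)
  have N_le2: "norm (N x) \<le> 1 - k' * l x" if x: "x \<in> cball c1 r1" for x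
  proof (rule power2_le_imp_le)
    have xc: "x \<in> closure \<Omega>" "dist x p < e" using x cB1 dist1 by auto
    have ux: "0 \<le> u x" using u_bounds[OF xc(1)] by simp
    have h: "K - 2 * F (u x) > 0" "K - 2 * F (u x) < 2 * \<kappa>\<^sup>2" using pos[OF xc ux] by auto
    have "(\<rho> (u x))\<^sup>2 = 1 / (K - 2 * F (u x))" using \<rho>_sq(1)[OF h(1)] h(1) by (simp add: field_simps)
    then have r2: "(\<rho> (u x))\<^sup>2 \<ge> 1 / (2 * \<kappa>\<^sup>2)" using h by (simp add: frac_le)
    have "(K - P x) * (\<rho> (u x))\<^sup>2 \<ge> (k * l x) * (1 / (2 * \<kappa>\<^sup>2))"
      using k(2)[OF x] r2 modica_estimate[OF xc(1)] by (intro mult_mono) auto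
    then have q: "(K - P x) * (\<rho> (u x))\<^sup>2 \<ge> 2 * (k' * l x)" unfolding k'_def by simp
    have nsq: "(norm (N x))\<^sup>2 = 1 - (K - P x) * (\<rho> (u x))\<^sup>2"
      using rho_w[OF xc] by (simp add: power_mult_distrib dot_square_norm)
    have "0 \<le> (norm (N x))\<^sup>2" by simp
    then show "0 \<le> 1 - k' * l x" using q nsq by linarith
    have "(1 - k' * l x)\<^sup>2 = 1 - 2 * (k' * l x) + (k' * l x)\<^sup>2" by (simp add: power2_diff)
    then show "(norm (N x))\<^sup>2 \<le> (1 - k' * l x)\<^sup>2"
      using q nsq zero_le_power2[of "k' * l x"] by linarith
  qed
  \<comment> \<open>Along \<nu> the derivative of \<open>ep * l\<^sup>2\<close> is at least
    \<open>- 4 * ep * r1 * l = - k' * l\<close>. This is exactly the margin by which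
    \<open>|N|\<close> stays below 1.\<close>
  define ep where "ep = k' / (4 * r1)"
  have ep: "ep > 0" unfolding ep_def using k' r1 by simp
  \<comment> \<open>Keeps the contribution \<open>\<delta> * (2 * n - 2)\<close> of the Taylor error
    to the Laplacian of \<open>D\<close> at most \<open>ep * r1\<^sup>2\<close>.\<close>
  define \<delta> where "\<delta> = ep * r1\<^sup>2 / (2 * n)"
  have \<delta>: "\<delta> > 0" unfolding \<delta>_def using ep r1 n by simp
  obtain e3 where e3: "e3 > 0" "\<And>y. y \<bullet> \<nu> = 0 \<Longrightarrow> norm y < e3 \<Longrightarrow>
      p + y + (- (A y \<bullet> y) / 2 + \<delta> * (y \<bullet> y)) *\<^sub>R \<nu> \<notin> \<Omega>" using touch[OF \<delta>] by blast
  \<comment> \<open>A bound for the cube of \<open>\<rho>\<close>, from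
    \<open>\<rho>\<^sup>2 \<le> 2 / \<kappa>\<^sup>2\<close> and
    \<open>\<rho> \<le> \<rho>\<^sup>2 + 1\<close>.\<close>
  define C2 where "C2 = (2 / \<kappa>\<^sup>2) * (2 / \<kappa>\<^sup>2 + 1)"
  have "C0 * ((K - P p) * C2) < ep * r1\<^sup>2" using P_frontier[OF p] ep r1(1) by simp
  moreover have "continuous_on (closure \<Omega>) (\<lambda>x. C0 * ((K - P x) * C2))" by (intro continuous_intros cont_P)
  ultimately obtain e4 where e4: "e4 > 0" "\<And>x. x \<in> closure \<Omega> \<Longrightarrow> dist x p < e4 \<Longrightarrow> C0 * ((K - P x) * C2) < ep * r1\<^sup>2"
    using near_boundary_point[OF _ pc] by metis
  have lapU: "- lap_U x < ep * r1\<^sup>2"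
    if x: "x \<in> closure \<Omega>" "dist x p < e" "dist x p < e4" for x
  proof -
    have ux: "0 \<le> u x" "u x \<le> M" using u_bounds[OF x(1)] by auto
    have h: "K - 2 * F (u x) > \<kappa>\<^sup>2 / 2" using pos'[OF x(1,2) ux(1)] by simp
    then have h0: "K - 2 * F (u x) > 0" using k2 by linarith
    have "(\<rho> (u x))\<^sup>2 = 1 / (K - 2 * F (u x))" using \<rho>_sq(1)[OF h0] h0 by (simp add: field_simps)
    then have r2: "(\<rho> (u x))\<^sup>2 \<le> 2 / \<kappa>\<^sup>2" using h k2 frac_le[of 1 1 "\<kappa>\<^sup>2 / 2" "K - 2 * F (u x)"] by simp
    have r0: "\<rho> (u x) > 0" using \<rho>_sq(2)[OF h0] .
    have "0 \<le> (\<rho> (u x) - 1)\<^sup>2" by simp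
    then have "\<rho> (u x) \<le> (\<rho> (u x))\<^sup>2 + 1" using r0 by (simp add: power2_eq_square algebra_simps)
    then have "\<rho> (u x) \<le> 2 / \<kappa>\<^sup>2 + 1" using r2 by linarith
    then have r3: "(\<rho> (u x))\<^sup>2 * \<rho> (u x) \<le> C2" unfolding C2_def using r2 r0 by (intro mult_mono) auto
    have Q: "K - P x \<ge> 0" using modica_estimate[OF x(1)] by simp
    \<comment> \<open>The factor \<open>1 - \<rho>\<^sup>2 w\<close> equals
      \<open>(K - P) \<rho>\<^sup>2\<close>, so the Laplacian of \<open>U\<close> is controlled by
      \<open>K - P\<close>, which tends to 0 at \<open>p\<close>.\<close>
    have "- lap_U x = f (u x) * (\<rho> (u x) * (1 - (\<rho> (u x))\<^sup>2 * w x))"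
      by (simp add: power2_eq_square power3_eq_cube algebra_simps)
    also have "\<dots> = f (u x) * ((K - P x) * ((\<rho> (u x))\<^sup>2 * \<rho> (u x)))"
      unfolding rho_w[OF x(1,2)] by (simp add: algebra_simps)
    also have "\<dots> \<le> C0 * ((K - P x) * ((\<rho> (u x))\<^sup>2 * \<rho> (u x)))"
      using C0(2)[OF ux] Q r0 by (intro mult_right_mono) auto
    also have "\<dots> \<le> C0 * ((K - P x) * C2)" using r3 Q C0(1) by (intro mult_left_mono) auto
    also have "\<dots> < ep * r1\<^sup>2" using e4(2)[OF x(1,3)] .
    finally show ?thesis .
  qed
  \<comment> \<open>The factor \<open>8 + 4 * n\<close> keeps \<open>l\<close> small enough for the
    Laplacian of \<open>l * l\<close> to stay above \<open>4 * r1\<^sup>2\<close>. The radii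
    \<open>e3\<close> and \<open>e4\<close> give access to the touching graph and to
    \<open>lapU\<close>. A segment of length at most \<open>6 * r2\<close> from a point within
    \<open>2 * r2\<close> of \<open>p\<close> stays within \<open>e\<close>. The last two bounds
    make the quadratic terms of \<open>D\<close> small against the depth.\<close>
  define r2 where "r2 = min (r1 / (8 + 4 * n)) (min (e3 / 3) (min (e4 / 3) (min (e / 9) (min (1 / (2 * BA + 1)) (1 / (2 * \<delta>))))))"
  have r2: "r2 > 0" "r2 \<le> r1 / (8 + 4 * n)" "2 * r2 < e3" "2 * r2 < e4" "8 * r2 < e" "BA * r2 \<le> 1 / 2" "2 * \<delta> * r2 \<le> 1"
  proof -
    show "r2 > 0" unfolding r2_def using r1 n e3 e4 e BA \<delta> by simp
    show "r2 \<le> r1 / (8 + 4 * n)" unfolding r2_def by simp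
    have "r2 \<le> e3 / 3" "r2 \<le> e4 / 3" "r2 \<le> e / 9" unfolding r2_def by (simp_all only: min_le_iff_disj order_refl simp_thms)
    then show "2 * r2 < e3" "2 * r2 < e4" "8 * r2 < e" using e3(1) e4(1) e(1) by auto
    have a: "r2 \<le> 1 / (2 * BA + 1)" "r2 \<le> 1 / (2 * \<delta>)" unfolding r2_def by (simp_all only: min_le_iff_disj order_refl simp_thms)
    have "r2 * (2 * BA + 1) \<le> 1" using a(1) BA(1) by (subst pos_le_divide_eq[symmetric]) auto
    then show "BA * r2 \<le> 1 / 2" using \<open>r2 > 0\<close> by (simp add: algebra_simps)
    have "r2 * (2 * \<delta>) \<le> 1" using a(2) \<delta> by (subst pos_le_divide_eq[symmetric]) auto
    then show "2 * \<delta> * r2 \<le> 1" by (simp add: mult.commute)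
  qed
  have r2n: "r2 * (8 + 4 * n) \<le> r1" using r2(2) n by (subst pos_le_divide_eq[symmetric]) auto
  have r21: "r2 \<le> r1"
  proof -
    have "r2 * 1 \<le> r2 * (8 + 4 * n)" using r2(1) n by (intro mult_left_mono) auto
    then show ?thesis using r2n by simp
  qed
  define c2 where "c2 = p - r2 *\<^sub>R \<nu>"
  have cB21: "cball c2 r2 \<subseteq> cball c1 r1" and B21: "ball c2 r2 \<subseteq> ball c1 r1"
    unfolding c1_def c2_def using tangent_ball_subset[OF \<nu> _ r21] r2(1) by auto
  note x2 = tangent_cball_bounds[OF \<nu> r2(1), of _ p, folded c2_def]
  \<comment> \<open>Chosen so that \<open>x + D x *\<^sub>R \<nu>\<close> is the point of the
    touching graph over the tangential part of \<open>x - p\<close>. The \<open>A\<close> term may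
    use \<open>x - p\<close> itself because \<open>A \<nu> = 0\<close>; in the
    \<open>\<delta>\<close> term the normal component is subtracted.\<close>
  define D where "D x = - (\<nu> \<bullet> (x - p)) - (A (x - p) \<bullet> (x - p)) / 2 + \<delta> * ((x - p) \<bullet> (x - p) - (\<nu> \<bullet> (x - p)) * (\<nu> \<bullet> (x - p)))" for x
  have gl_D: "grad_lap_on T D (\<lambda>x. (- 1) *\<^sub>R \<nu> - (1 / 2) *\<^sub>R (2 *\<^sub>R A (x - p)) + \<delta> *\<^sub>R (2 *\<^sub>R (x - p) - ((\<nu> \<bullet> (x - p)) *\<^sub>R \<nu> + (\<nu> \<bullet> (x - p)) *\<^sub>R \<nu>)))
    (\<lambda>x. - trace A + \<delta> * (2 * n - 2))" for T
    by (rule grad_lap_on_eq[OF grad_lap_on_add[OF grad_lap_on_diff[OF grad_lap_on_cmult[OF grad_lap_on_linear[of T \<nu> p], of "-1"]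
      grad_lap_on_cmult[OF grad_lap_on_quadratic[OF A(1,2), of T p], of "1/2"]]
      grad_lap_on_cmult[OF grad_lap_on_diff[OF grad_lap_on_sq_norm[of T p] grad_lap_on_mult[OF grad_lap_on_linear[of T \<nu> p] grad_lap_on_linear[of T \<nu> p]]], of \<delta>]]])
      (simp_all add: D_def n_def \<nu>\<nu>)
  have D_bounds: "D x \<le> 3 * (- (\<nu> \<bullet> (x - p)))" "D x \<ge> - (\<nu> \<bullet> (x - p)) / 2" "- (\<nu> \<bullet> (x - p)) \<ge> 0" if x: "x \<in> cball c2 r2" for x
  proof -
    define s where "s = - (\<nu> \<bullet> (x - p))"
    define q where "q = (x - p) \<bullet> (x - p)"
    have q: "0 \<le> q" "q \<le> 2 * r2 * s" using x2(2)[OF x] unfolding q_def s_def by auto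
    then have "0 \<le> r2 * s" by linarith
    then show s: "- (\<nu> \<bullet> (x - p)) \<ge> 0" using r2(1) unfolding s_def[symmetric] by (simp add: zero_le_mult_iff)
    have "\<bar>A (x - p) \<bullet> (x - p)\<bar> \<le> BA * (2 * r2 * s)" using BA(2)[of "x - p"] mult_left_mono[OF q(2) BA(1)] unfolding q_def by linarith
    moreover have "(BA * r2) * s \<le> 1 / 2 * s" using r2(6) s unfolding s_def by (intro mult_right_mono) auto
    ultimately have Ab: "\<bar>A (x - p) \<bullet> (x - p)\<bar> \<le> s" by (simp add: algebra_simps)
    have cs: "s * s \<le> q"
      using Cauchy_Schwarz_ineq[of \<nu> "x - p"] \<nu>\<nu> unfolding s_def q_def by (simp add: power2_eq_square)
    have "\<delta> * (q - s * s) \<ge> 0" using \<delta> cs by simp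
    moreover have "q - s * s \<le> 2 * r2 * s" using q(2) zero_le_square[of s] by linarith
    then have "\<delta> * (q - s * s) \<le> \<delta> * (2 * r2 * s)" using \<delta> by (intro mult_left_mono) auto
    moreover have "(2 * \<delta> * r2) * s \<le> 1 * s" using r2(7) s unfolding s_def by (intro mult_right_mono) auto
    then have "\<delta> * (2 * r2 * s) \<le> s" by (simp add: algebra_simps)
    moreover have "D x = s - (A (x - p) \<bullet> (x - p)) / 2 + \<delta> * (q - s * s)" unfolding D_def s_def q_def by simp
    ultimately have "D x \<le> s + s / 2 + s" "D x \<ge> s / 2"
      using abs_le_D1[OF Ab] abs_le_D2[OF Ab] by linarith+
    then show "D x \<le> 3 * (- (\<nu> \<bullet> (x - p)))" "D x \<ge> - (\<nu> \<bullet> (x - p)) / 2" using s unfolding s_def by auto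
  qed
  have out: "x + D x *\<^sub>R \<nu> \<notin> \<Omega>" if x: "x \<in> cball c2 r2" for x
  proof -
    define y where "y = (x - p) - (\<nu> \<bullet> (x - p)) *\<^sub>R \<nu>"
    have y\<nu>: "y \<bullet> \<nu> = 0" unfolding y_def using \<nu>\<nu> by (simp add: inner_diff_left inner_diff_right inner_commute)
    have yy: "y \<bullet> y = (x - p) \<bullet> (x - p) - (\<nu> \<bullet> (x - p)) * (\<nu> \<bullet> (x - p))"
      unfolding y_def using \<nu>\<nu> by (simp add: inner_diff_left inner_diff_right inner_commute)
    have "y \<bullet> y \<le> (x - p) \<bullet> (x - p)" unfolding yy by simp
    then have "norm y \<le> norm (x - p)" by (simp add: norm_le)
    then have ny: "norm y < e3" using x2(1)[OF x] r2(3) by (simp add: dist_norm)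
    have Ay: "A y = A (x - p)" unfolding y_def by (simp add: A.diff A.scaleR A(3))
    have "A (x - p) \<bullet> \<nu> = 0" using A(2)[of "x - p" \<nu>] A(3) by simp
    then have "A (x - p) \<bullet> y = A (x - p) \<bullet> (x - p)" unfolding y_def by (simp add: inner_diff_right)
    then have Ayy: "A y \<bullet> y = A (x - p) \<bullet> (x - p)" unfolding Ay .
    have py: "p + y = x - (\<nu> \<bullet> (x - p)) *\<^sub>R \<nu>" unfolding y_def by simp
    have comb: "x - a *\<^sub>R \<nu> + b *\<^sub>R \<nu> = x + (- a + b) *\<^sub>R \<nu>" for a b by (simp add: algebra_simps)
    have "p + y + (- (A y \<bullet> y) / 2 + \<delta> * (y \<bullet> y)) *\<^sub>R \<nu> = x + D x *\<^sub>R \<nu>"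
      unfolding py comb Ayy yy D_def by simp
    then show ?thesis using e3(2)[OF y\<nu> ny] by simp
  qed
  define T where "T = \<Omega> \<inter> ball p e"
  define T' where "T' = closure \<Omega> \<inter> ball p e"
  define U where "U x = \<Psi> (u x)" for x
  have T: "T \<subseteq> \<Omega>" "T \<subseteq> T'" unfolding T_def T'_def using closure_subset by auto
  have T'D: "x \<in> closure \<Omega>" "dist x p < e" if "x \<in> T'" for x using that unfolding T'_def by (auto simp: dist_commute)
  have B1T: "ball c1 r1 \<subseteq> T" and cB1T: "cball c1 r1 \<subseteq> T'"
    using B1 cB1 dist1 unfolding T_def T'_def by (auto simp: dist_commute)
  have cont_\<rho>: "continuous_on T' (\<lambda>x. \<rho> (u x))" and cont_U: "continuous_on T' U"
  proof -
    have "isCont \<rho> s \<and> isCont \<Psi> s" if s: "s \<in> u ` T'" for s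
    proof -
      obtain x where x: "x \<in> T'" "s = u x" using s by blast
      have ux: "0 \<le> s" using x u_bounds T'D by auto
      have "(\<Psi> has_real_derivative \<rho> s) (at s)" using pos[OF T'D[OF x(1)]] x(2) ux by (intro DERIV_\<Psi>) auto
      moreover have "K - 2 * F s > 0" using pos[OF T'D[OF x(1)] ux] x(2) by simp
      ultimately show ?thesis using DERIV_\<rho> DERIV_isCont by blast
    qed
    then have "continuous_on (u ` T') \<rho>" "continuous_on (u ` T') \<Psi>"
      by (simp_all add: continuous_at_imp_continuous_on)
    moreover have "continuous_on T' u" using cont_u unfolding T'_def by (rule continuous_on_subset) simp
    ultimately show "continuous_on T' (\<lambda>x. \<rho> (u x))" "continuous_on T' U"
      unfolding U_def by (auto intro: continuous_on_compose2)
  qed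
  have glU: "grad_lap_on T U N lap_U"
    unfolding U_def using pos T'D T by (intro gl_U) blast+
  have gll: "grad_lap_on S' (\<lambda>x. l x * l x) (\<lambda>x. (- 4 * l x) *\<^sub>R (x - c1)) (\<lambda>x. 8 * r1\<^sup>2 - (8 + 4 * n) * l x)" for S'
  proof -
    have "grad_lap_on S' l (\<lambda>x. - (2 *\<^sub>R (x - c1))) (\<lambda>x. - (2 * n))"
      by (rule grad_lap_on_eq[OF grad_lap_on_diff[OF grad_lap_on_const[of S' "r1\<^sup>2"] grad_lap_on_sq_norm[of S' c1]]])
        (auto simp: l_def n_def)
    from grad_lap_on_mult[OF this this] show ?thesis
      by (rule grad_lap_on_eq) (auto simp: l_def algebra_simps scaleR_2[symmetric])
  qed
  have U_frontier: "U x = 0" if "x \<in> frontier \<Omega>" for x using u_frontier[OF that] unfolding U_def by simp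
  have cauchy: "N x \<bullet> \<nu> \<ge> - norm (N x)" for x
    using Cauchy_Schwarz_ineq2[of "N x" \<nu>] \<nu> by (simp add: abs_le_iff)
  have key: "U x + ep * (l x * l x) \<le> D x" if x: "x \<in> ball c2 r2" for x
  proof -
    have xc: "x \<in> cball c2 r2" using x by auto
    have xB1: "x \<in> ball c1 r1" using x B21 by blast
    have xO: "x \<in> \<Omega>" using xB1 B1 by blast
    have "x \<noteq> p"
      using xO p open_dom by (auto simp: frontier_def interior_open)
    then have "0 < (x - p) \<bullet> (x - p)" by simp
    then have "0 < 2 * r2 * (- (\<nu> \<bullet> (x - p)))" using x2(2)[OF xc] by linarith
    then have spos: "0 < - (\<nu> \<bullet> (x - p))" using r2(1) by (simp add: zero_less_mult_iff mult_less_0_iff)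
    then have Dpos: "D x > 0" using D_bounds(2)[OF xc] by linarith
    obtain \<tau> where \<tau>: "0 < \<tau>" "\<tau> \<le> D x" "x + \<tau> *\<^sub>R \<nu> \<in> frontier \<Omega>" "\<And>t. 0 \<le> t \<Longrightarrow> t < \<tau> \<Longrightarrow> x + t *\<^sub>R \<nu> \<in> \<Omega>"
      using first_exit[OF open_dom xO Dpos out[OF xc]] by blast
    have "x + \<tau> *\<^sub>R \<nu> \<notin> \<Omega>" using \<tau>(3) open_dom by (simp add: frontier_def interior_open)
    \<comment> \<open>The exit from the inner ball precedes that from the domain, so the segment
      splits at \<open>\<sigma>\<close>. The correction vanishes at \<open>\<sigma>\<close> and
      \<open>U\<close> vanishes at \<open>\<tau>\<close>, so the two length estimates add up to
      \<open>\<tau> \<le> D x\<close>.\<close>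
    then have "x + \<tau> *\<^sub>R \<nu> \<notin> ball c1 r1" using B1 by blast
    then obtain \<sigma> where \<sigma>: "0 < \<sigma>" "\<sigma> \<le> \<tau>" "x + \<sigma> *\<^sub>R \<nu> \<in> frontier (ball c1 r1)" "\<And>t. 0 \<le> t \<Longrightarrow> t < \<sigma> \<Longrightarrow> x + t *\<^sub>R \<nu> \<in> ball c1 r1"
      using first_exit[OF open_ball xB1 \<tau>(1)] by blast
    have path_dist: "dist (x + t *\<^sub>R \<nu>) p < e" if "0 \<le> t" "t \<le> \<tau>" for t
    proof -
      have "dist (x + t *\<^sub>R \<nu>) p \<le> dist (x + t *\<^sub>R \<nu>) x + dist x p" by (rule dist_triangle)
      also have "dist (x + t *\<^sub>R \<nu>) x = t" using \<nu> that by (simp add: dist_norm)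
      finally show ?thesis
        using that \<tau>(2) D_bounds(1)[OF xc] x2(1,3)[OF xc] r2(5) by linarith
    qed
    have pathT: "x + t *\<^sub>R \<nu> \<in> T" if "0 \<le> t" "t < \<tau>" for t
      using \<tau>(4)[OF that] path_dist[of t] that unfolding T_def by (auto simp: dist_commute)
    have pathT': "x + t *\<^sub>R \<nu> \<in> T'" if "0 \<le> t" "t \<le> \<tau>" for t
    proof (cases "t = \<tau>")
      case True
      then show ?thesis using \<tau>(3) path_dist[OF that] unfolding T'_def by (auto simp: frontier_def dist_commute)
    qed (use pathT[of t] that T in auto)
    have "U (x + 0 *\<^sub>R \<nu>) + ep * (l (x + 0 *\<^sub>R \<nu>) * l (x + 0 *\<^sub>R \<nu>)) \<le> (U (x + \<sigma> *\<^sub>R \<nu>) + ep * (l (x + \<sigma> *\<^sub>R \<nu>) * l (x + \<sigma> *\<^sub>R \<nu>))) + (\<sigma> - 0)"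
    proof (rule le_by_derivative)
      show "continuous_on {0..\<sigma>} (\<lambda>t. U (x + t *\<^sub>R \<nu>) + ep * (l (x + t *\<^sub>R \<nu>) * l (x + t *\<^sub>R \<nu>)))"
        unfolding l_def by (intro continuous_intros continuous_on_compose2[OF cont_U]) (use pathT' \<sigma>(2) in auto)
      fix t assume t: "0 < t" "t < \<sigma>"
      have tB: "x + t *\<^sub>R \<nu> \<in> ball c1 r1" using \<sigma>(4) t by simp
      then have tT: "x + t *\<^sub>R \<nu> \<in> T" using B1T by blast
      show "((\<lambda>t. U (x + t *\<^sub>R \<nu>) + ep * (l (x + t *\<^sub>R \<nu>) * l (x + t *\<^sub>R \<nu>))) has_real_derivative
          (N (x + t *\<^sub>R \<nu>) + ep *\<^sub>R ((- 4 * l (x + t *\<^sub>R \<nu>)) *\<^sub>R (x + t *\<^sub>R \<nu> - c1))) \<bullet> \<nu>) (at t)"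
        by (rule GDERIV_line) (rule grad_lap_onD(1)[OF grad_lap_on_add[OF glU grad_lap_on_cmult[OF gll]] tT])
      define z where "z = x + t *\<^sub>R \<nu>"
      have z: "z \<in> cball c1 r1" using tB unfolding z_def by auto
      have lz: "l z \<ge> 0" using l_nonneg[OF z] .
      have "(z - c1) \<bullet> \<nu> \<le> norm (z - c1) * norm \<nu>" by (rule norm_cauchy_schwarz)
      also have "\<dots> \<le> r1" using z \<nu> by (simp add: dist_norm norm_minus_commute)
      finally have "(4 * ep * l z) * ((z - c1) \<bullet> \<nu>) \<le> (4 * ep * l z) * r1" using ep lz by (intro mult_left_mono) auto
      also have "\<dots> = k' * l z" unfolding ep_def using r1 by simp
      finally have "ep * ((- 4 * l z) * ((z - c1) \<bullet> \<nu>)) \<ge> - (k' * l z)" by simp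
      moreover have "N z \<bullet> \<nu> \<ge> - (1 - k' * l z)" using cauchy[of z] N_le2[OF z] by linarith
      ultimately have "- 1 \<le> (N z + ep *\<^sub>R ((- 4 * l z) *\<^sub>R (z - c1))) \<bullet> \<nu>"
        unfolding inner_add_left inner_scaleR_left by linarith
      then show "- 1 \<le> (N (x + t *\<^sub>R \<nu>) + ep *\<^sub>R ((- 4 * l (x + t *\<^sub>R \<nu>)) *\<^sub>R (x + t *\<^sub>R \<nu> - c1))) \<bullet> \<nu>"
        unfolding z_def .
    qed (use \<sigma> in simp)
    moreover have "l (x + \<sigma> *\<^sub>R \<nu>) = 0"
      using \<sigma>(3) r1(1) unfolding l_def by (simp add: frontier_ball dot_square_norm dist_norm norm_minus_commute)
    moreover have "U (x + \<sigma> *\<^sub>R \<nu>) \<le> U (x + \<tau> *\<^sub>R \<nu>) + (\<tau> - \<sigma>)"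
    proof (rule le_by_derivative[OF \<sigma>(2)])
      show "continuous_on {\<sigma>..\<tau>} (\<lambda>t. U (x + t *\<^sub>R \<nu>))"
        by (intro continuous_intros continuous_on_compose2[OF cont_U]) (use pathT' \<sigma>(1) in auto)
      fix t assume t: "\<sigma> < t" "t < \<tau>"
      have tT: "x + t *\<^sub>R \<nu> \<in> T" using pathT[of t] t \<sigma>(1) by simp
      show "((\<lambda>t. U (x + t *\<^sub>R \<nu>)) has_real_derivative N (x + t *\<^sub>R \<nu>) \<bullet> \<nu>) (at t)"
        by (rule GDERIV_line) (rule grad_lap_onD(1)[OF glU tT])
      show "- 1 \<le> N (x + t *\<^sub>R \<nu>) \<bullet> \<nu>"
        using cauchy[of "x + t *\<^sub>R \<nu>"] N_le[OF T'D[OF subsetD[OF T(2) tT]]] by linarith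
    qed
    ultimately show ?thesis using U_frontier[OF \<tau>(3)] \<tau>(2) by simp
  qed
  define V where "V x = D x - (U x + ep * (l x * l x))" for x
  have B2T: "ball c2 r2 \<subseteq> T" using B21 B1T by blast
  have cB2T: "cball c2 r2 \<subseteq> T'" using cB21 cB1T by blast
  note glV = grad_lap_on_diff[OF gl_D grad_lap_on_add[OF grad_lap_on_subset[OF glU B2T] grad_lap_on_cmult[OF gll, of _ ep]], folded V_def]
  have contV: "continuous_on (cball c2 r2) V"
    unfolding V_def D_def l_def
    by (intro continuous_intros continuous_on_subset[OF cont_U cB2T] A.continuous_on) simp_all
  have V_nonneg: "V x \<ge> 0" if x: "x \<in> cball c2 r2" for x
  proof (rule continuous_ge_on_closure[of "ball c2 r2"])
    show "continuous_on (closure (ball c2 r2)) V" using contV r2(1) by simp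
    show "x \<in> closure (ball c2 r2)" using x r2(1) by simp
  qed (use key in \<open>simp add: V_def\<close>)
  \<comment> \<open>In units of \<open>ep * r1\<^sup>2\<close>: \<open>- lap_U\<close> and the
    \<open>\<delta>\<close> term cost at most 1 each, the Laplacian of \<open>ep * l\<^sup>2\<close>
    gains at least 4, and \<open>trace A \<ge> 0\<close> has the right sign.\<close>
  have lapV: "- trace A + \<delta> * (2 * n - 2) - (lap_U x + ep * (8 * r1\<^sup>2 - (8 + 4 * n) * l x)) < 0"
    if x: "x \<in> ball c2 r2" for x
  proof -
    have xc: "x \<in> cball c2 r2" using x by auto
    have xT': "x \<in> T'" using xc cB2T by blast
    have "dist x p < e4" using x2(1)[OF xc] r2(4) by linarith
    note lu = lapU[OF T'D[OF xT'] this]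
    have d: "\<delta> * (2 * n - 2) \<le> ep * r1\<^sup>2"
    proof -
      have "\<delta> * (2 * n - 2) \<le> \<delta> * (2 * n)" using \<delta> by simp
      also have "\<dots> = ep * r1\<^sup>2" unfolding \<delta>_def using n by simp
      finally show ?thesis .
    qed
    have "l x \<le> 4 * r1 * r2"
    proof -
      have "l x = - ((x - p) \<bullet> (x - p)) - 2 * r1 * (\<nu> \<bullet> (x - p))"
      proof -
        have xc1: "x - c1 = (x - p) + r1 *\<^sub>R \<nu>" unfolding c1_def by simp
        show ?thesis unfolding l_def xc1 using \<nu>\<nu>
          by (simp add: inner_add_left inner_add_right inner_commute power2_eq_square)
      qed
      also have "\<dots> \<le> 2 * r1 * (- (\<nu> \<bullet> (x - p)))" by simp
      also have "\<dots> \<le> 2 * r1 * (2 * r2)" using x2(3)[OF xc] r1 by (intro mult_left_mono) auto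
      finally show ?thesis by simp
    qed
    then have "(8 + 4 * n) * l x \<le> (8 + 4 * n) * (4 * r1 * r2)" using n by (intro mult_left_mono) auto
    also have "\<dots> = 4 * r1 * (r2 * (8 + 4 * n))" by (simp add: algebra_simps)
    also have "\<dots> \<le> 4 * r1 * r1" using r2n r1 by (intro mult_left_mono) auto
    finally have "8 * r1\<^sup>2 - (8 + 4 * n) * l x \<ge> 4 * r1\<^sup>2" by (simp add: power2_eq_square)
    then have "ep * (8 * r1\<^sup>2 - (8 + 4 * n) * l x) \<ge> ep * (4 * r1\<^sup>2)" using ep by (intro mult_left_mono) auto
    moreover have "ep * r1\<^sup>2 > 0" using ep r1 by simp
    ultimately show ?thesis using lu d trA by (simp add: algebra_simps)
  qed
  have V_pos: "V x > 0" if x: "x \<in> ball c2 r2" for x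
  proof (rule ccontr)
    assume "\<not> V x > 0"
    then have "V x = 0" using V_nonneg[of x] x by auto
    then have "- V y \<le> - V x" if "y \<in> ball c2 r2" for y using V_nonneg[of y] that by auto
    from grad_lap_on_local_max(2)[OF grad_lap_on_diff[OF grad_lap_on_const[of _ 0] glV, unfolded diff_0] open_ball x this]
    show False using lapV[OF x] by simp
  qed
  have "\<exists>k>0. \<forall>x\<in>cball c2 r2. V x \<ge> k * (r2\<^sup>2 - (norm (x - c2))\<^sup>2)"
    by (rule hopf_ball[OF r2(1) glV contV V_nonneg V_pos order_refl]) (use lapV in \<open>auto simp: less_imp_le\<close>)
  then obtain k3 where k3: "k3 > 0" "\<And>x. x \<in> cball c2 r2 \<Longrightarrow> V x \<ge> k3 * (r2\<^sup>2 - (norm (x - c2))\<^sup>2)" by blast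
  \<comment> \<open>On the normal line through \<open>p\<close> the quadratic terms of
    \<open>D\<close> vanish, so \<open>V \<le> q\<close> there and \<open>q\<close> inherits the
    slope. The gradient of \<open>q\<close> is \<open>- \<nu> - N\<close>, continuous up to
    \<open>p\<close>, and its component along \<open>- \<nu>\<close> is 0 at \<open>p\<close>
    because \<open>|G p| = \<kappa>\<close>.\<close>
  define q where "q x = (- \<nu>) \<bullet> (x - p) - U x" for x
  have q_slope: "q (p - t *\<^sub>R \<nu>) \<ge> (k3 * r2) * t" if t: "0 < t" "t < r2" for t
  proof -
    have "V (p - t *\<^sub>R \<nu>) \<ge> (k3 * r2) * t"
      by (rule slope_of_tangent_ball_bound[OF \<nu> k3(1) t k3(2)[unfolded c2_def]])
    moreover have "V (p - t *\<^sub>R \<nu>) \<le> q (p - t *\<^sub>R \<nu>)"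
      unfolding V_def q_def D_def using \<nu>\<nu> ep by (simp add: A.neg A.scaleR A(3))
    ultimately show ?thesis by simp
  qed
  have glq: "grad_lap_on (ball (p - r2 *\<^sub>R \<nu>) r2) q (\<lambda>x. - \<nu> - N x)
      (\<lambda>x. 0 - lap_U x)"
    unfolding q_def c2_def[symmetric] by (rule grad_lap_on_diff[OF grad_lap_on_linear grad_lap_on_subset[OF glU B2T]])
  have contq: "continuous_on (closure (ball (p - r2 *\<^sub>R \<nu>) r2)) q"
    unfolding q_def c2_def[symmetric] using r2(1)
    by (simp, intro continuous_intros continuous_on_subset[OF cont_U cB2T])
  have pT': "p \<in> T'" using pc e unfolding T'_def by simp
  have "continuous_on T' (\<lambda>x. 1 + N x \<bullet> \<nu>)"
    by (intro continuous_intros cont_\<rho> continuous_on_subset[OF cont_G]) (auto simp: T'_def)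
  then have cont_slope: "\<exists>e5>0. \<forall>x\<in>T'. dist x p < e5 \<longrightarrow> dist (1 + N x \<bullet> \<nu>) (1 + N p \<bullet> \<nu>) < k3 * r2"
    using pT' k3(1) r2(1) unfolding continuous_on_iff by (meson mult_pos_pos)
  have slope_p: "1 + N p \<bullet> \<nu> = 0"
    unfolding up Gp \<rho>_def K_minus_F_0 using \<kappa> \<nu>\<nu> by simp
  from cont_slope obtain e5 where e5: "e5 > 0" "\<And>x. x \<in> T' \<Longrightarrow> dist x p < e5 \<Longrightarrow> \<bar>1 + N x \<bullet> \<nu>\<bar> < k3 * r2"
    unfolding slope_p dist_real_def diff_0_right by blast
  have "q p = 0" unfolding q_def U_def up by simp
  from slope_near_boundary[OF \<nu> r2(1) order_refl contq grad_lap_onD(1)[OF glq] this q_slope e5(1)]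
  obtain x where x: "x \<in> ball c2 r2" "dist x p < e5" "(- \<nu> - N x) \<bullet> (- \<nu>) \<ge> k3 * r2"
    unfolding c2_def by blast
  have "(- \<nu> - N x) \<bullet> (- \<nu>) = 1 + N x \<bullet> \<nu>"
    using \<nu>\<nu> by (simp add: inner_diff_left)
  moreover have "x \<in> T'" using x(1) cB2T ball_subset_cball by blast
  ultimately show False using e5(2)[of x] x(2,3) by linarith
qed

end

section \<open>Geometry of the boundary\<close>

text \<open>A derivative of the gradient is kept at the single point \<open>p\<close>; nothing more
  is needed for the curvature at \<open>p\<close>.\<close>

locale boundary_chart =
  fixes \<Omega> U :: "'a::euclidean_space set" and \<phi> :: "'a \<Rightarrow> real" and g :: "'a \<Rightarrow> 'a" and H :: "'a \<Rightarrow> 'a" and p :: 'a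
  assumes open_dom: "open \<Omega>" and open_U: "open U" and p: "p \<in> U" "p \<in> frontier \<Omega>"
    and gd: "\<And>x. x \<in> U \<Longrightarrow> GDERIV \<phi> x :> g x"
    and g_nz: "\<And>x. x \<in> U \<Longrightarrow> g x \<noteq> 0"
    and H: "(g has_derivative H) (at p)"
    and chart: "\<Omega> \<inter> U = {x \<in> U. \<phi> x < 0}"
begin

definition \<nu> :: "'a \<Rightarrow> 'a" where "\<nu> x = (1 / norm (g x)) *\<^sub>R g x"

lemma chartD: "x \<in> U \<Longrightarrow> x \<in> \<Omega> \<longleftrightarrow> \<phi> x < 0"
  using chart by blast

lemma norm_\<nu>: "x \<in> U \<Longrightarrow> norm (\<nu> x) = 1" and g_\<nu>: "x \<in> U \<Longrightarrow> g x = norm (g x) *\<^sub>R \<nu> x"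
  unfolding \<nu>_def using g_nz by auto

lemma isCont_\<phi>: "x \<in> U \<Longrightarrow> isCont \<phi> x"
  using gd unfolding gderiv_def by (blast intro: has_derivative_continuous)

lemma eventually_in_U:
  assumes "x \<in> U" shows "\<exists>d>0. \<forall>t. \<bar>t\<bar> < d \<longrightarrow> x + t *\<^sub>R v \<in> U"
proof -
  obtain r where r: "r > 0" "ball x r \<subseteq> U" using assms open_U open_contains_ball by blast
  show ?thesis
  proof (intro exI[of _ "r / (norm v + 1)"] conjI allI impI)
    show "r / (norm v + 1) > 0" using r(1) by (simp add: add_nonneg_pos)
    fix t :: real assume "\<bar>t\<bar> < r / (norm v + 1)"
    then have "\<bar>t\<bar> * (norm v + 1) < r" by (simp add: pos_less_divide_eq add_nonneg_pos)
    then have "\<bar>t\<bar> * norm v < r" by (simp add: algebra_simps)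
    then have "x + t *\<^sub>R v \<in> ball x r" by (simp add: dist_norm)
    then show "x + t *\<^sub>R v \<in> U" using r(2) by blast
  qed
qed

lemma DERIV_\<phi>_line:
  assumes "x \<in> U" shows "((\<lambda>t. \<phi> (x + t *\<^sub>R v)) has_real_derivative g x \<bullet> v) (at 0)"
  by (rule GDERIV_line) (use gd[OF assms] in simp)

lemma inward:
  assumes x: "x \<in> U" "\<phi> x = 0" and v: "g x \<bullet> v < 0"
  shows "\<exists>d>0. \<forall>t. 0 < t \<longrightarrow> t < d \<longrightarrow> x + t *\<^sub>R v \<in> \<Omega>"
proof -
  obtain d1 where d1: "d1 > 0" "\<And>h. 0 < h \<Longrightarrow> h < d1 \<Longrightarrow> \<phi> (x + h *\<^sub>R v) < 0"
    using DERIV_neg_dec_right[OF DERIV_\<phi>_line[OF x(1)] v] x(2) by auto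
  obtain d2 where d2: "d2 > 0" "\<And>t. \<bar>t\<bar> < d2 \<Longrightarrow> x + t *\<^sub>R v \<in> U" using eventually_in_U[OF x(1)] by blast
  show ?thesis by (intro exI[of _ "min d1 d2"]) (use d1 d2 chartD in auto)
qed

lemma outward:
  assumes x: "x \<in> U" "\<phi> x = 0" and v: "g x \<bullet> v > 0"
  shows "\<exists>d>0. \<forall>t. 0 < t \<longrightarrow> t < d \<longrightarrow> x + t *\<^sub>R v \<notin> \<Omega>"
proof -
  obtain d1 where d1: "d1 > 0" "\<And>h. 0 < h \<Longrightarrow> h < d1 \<Longrightarrow> \<phi> (x + h *\<^sub>R v) > 0"
    using DERIV_pos_inc_right[OF DERIV_\<phi>_line[OF x(1)] v] x(2) by auto
  obtain d2 where d2: "d2 > 0" "\<And>t. \<bar>t\<bar> < d2 \<Longrightarrow> x + t *\<^sub>R v \<in> U" using eventually_in_U[OF x(1)] by blast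
  show ?thesis by (intro exI[of _ "min d1 d2"]) (use d1 d2 chartD in \<open>auto simp: not_less less_imp_le\<close>)
qed

text \<open>Points with \<phi> > 0 have a neighbourhood outside the domain by continuity; from a
  zero of \<phi> the direction \<open>- g x\<close> leads into the domain.\<close>

lemma frontier_iff:
  assumes xU: "x \<in> U" shows "x \<in> frontier \<Omega> \<longleftrightarrow> \<phi> x = 0"
proof -
  show "x \<in> frontier \<Omega> \<longleftrightarrow> \<phi> x = 0"
  proof
    assume fr: "x \<in> frontier \<Omega>"
    then have "x \<notin> \<Omega>" "x \<in> closure \<Omega>" using open_dom by (auto simp: frontier_def interior_open)
    then have ge: "\<phi> x \<ge> 0" using chartD[OF xU] by simp
    show "\<phi> x = 0"
    proof (rule ccontr)
      assume "\<phi> x \<noteq> 0"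
      then have pos: "\<phi> x > 0" using ge by simp
      have "continuous_on U \<phi>" using isCont_\<phi> by (simp add: continuous_at_imp_continuous_on)
      then have "open (U \<inter> \<phi> -` {0<..})" by (rule continuous_open_preimage[OF _ open_U open_greaterThan])
      moreover have "x \<in> U \<inter> \<phi> -` {0<..}" using xU pos by simp
      moreover have "\<Omega> \<inter> (U \<inter> \<phi> -` {0<..}) = {}" using chartD by fastforce
      ultimately show False using \<open>x \<in> closure \<Omega>\<close> open_Int_closure_eq_empty[of "U \<inter> \<phi> -` {0<..}" \<Omega>] by blast
    qed
  next
    assume \<phi>0: "\<phi> x = 0"
    then have "x \<notin> \<Omega>" using chartD[OF xU] by simp
    have "g x \<bullet> (- g x) < 0" using g_nz[OF xU] by simp
    from inward[OF xU \<phi>0 this] obtain d where d: "d > 0" "\<And>t. 0 < t \<Longrightarrow> t < d \<Longrightarrow> x + t *\<^sub>R (- g x) \<in> \<Omega>" by blast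
    have "((\<lambda>t. x + t *\<^sub>R (- g x)) \<longlongrightarrow> x + 0 *\<^sub>R (- g x)) (at_right 0)" by (intro tendsto_intros)
    moreover have "\<forall>\<^sub>F t in at_right 0. x + t *\<^sub>R (- g x) \<in> closure \<Omega>"
      using d closure_subset[of \<Omega>] by (intro eventually_at_rightI[of 0 d]) auto
    ultimately have "x + 0 *\<^sub>R (- g x) \<in> closure \<Omega>"
      by (rule Lim_in_closed_set[OF closed_closure _ trivial_limit_at_right_real, rotated])
    then show "x \<in> frontier \<Omega>" using \<open>x \<notin> \<Omega>\<close> open_dom by (simp add: frontier_def interior_open)
  qed
qed

text \<open>\<phi> has opposite signs at time \<open>t\<close> in the directions
  \<open>v - \<eta> *\<^sub>R \<nu> x\<close> and \<open>v + \<eta> *\<^sub>R \<nu> x\<close>. The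
  intermediate value theorem gives a frontier point between them, in place of an implicit
  function.\<close>

lemma frontier_near:
  assumes x: "x \<in> U" "x \<in> frontier \<Omega>" and v: "g x \<bullet> v = 0" and \<eta>: "\<eta> > 0"
  shows "\<exists>d>0. \<forall>t. 0 < t \<longrightarrow> t < d \<longrightarrow> (\<exists>s. \<bar>s\<bar> \<le> \<eta> * t \<and> x + t *\<^sub>R v + s *\<^sub>R \<nu> x \<in> frontier \<Omega>)"
proof -
  have \<phi>x: "\<phi> x = 0" using frontier_iff x by blast
  have "norm (g x) > 0" using g_nz x by simp
  then have "g x \<bullet> \<nu> x > 0" unfolding \<nu>_def by simp
  then have dir: "g x \<bullet> (v + \<eta> *\<^sub>R \<nu> x) > 0" "g x \<bullet> (v + (- \<eta>) *\<^sub>R \<nu> x) < 0"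
    using v \<eta> by (simp_all add: inner_add_right inner_diff_right)
  obtain d1 where d1: "d1 > 0" "\<And>t. 0 < t \<Longrightarrow> t < d1 \<Longrightarrow> \<phi> (x + t *\<^sub>R (v + \<eta> *\<^sub>R \<nu> x)) > 0"
    using DERIV_pos_inc_right[OF DERIV_\<phi>_line[OF x(1)] dir(1)] \<phi>x by auto
  obtain d2 where d2: "d2 > 0" "\<And>t. 0 < t \<Longrightarrow> t < d2 \<Longrightarrow> \<phi> (x + t *\<^sub>R (v + (- \<eta>) *\<^sub>R \<nu> x)) < 0"
    using DERIV_neg_dec_right[OF DERIV_\<phi>_line[OF x(1)] dir(2)] \<phi>x by auto
  obtain r where r: "r > 0" "ball x r \<subseteq> U" using x open_U open_contains_ball by blast
  define N where "N = norm v + \<eta>"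
  have N: "N > 0" unfolding N_def using \<eta> by (simp add: add_nonneg_pos)
  define d where "d = min (min d1 d2) (r / N)"
  have d: "d > 0" unfolding d_def using d1 d2 r N by simp
  show ?thesis
  proof (rule exI[of _ d], intro conjI d allI impI)
    fix t assume t: "0 < t" "t < d"
    have tN: "t * N < r" "t < d1" "t < d2" using t N unfolding d_def by (auto simp: pos_less_divide_eq)
    have inU: "x + t *\<^sub>R v + s *\<^sub>R \<nu> x \<in> U" if "\<bar>s\<bar> \<le> \<eta> * t" for s
    proof -
      have "norm (t *\<^sub>R v + s *\<^sub>R \<nu> x) \<le> t * N"
        using norm_triangle_ineq[of "t *\<^sub>R v" "s *\<^sub>R \<nu> x"] that t norm_\<nu>[OF x(1)] unfolding N_def by (simp add: algebra_simps)
      then have "dist (x + (t *\<^sub>R v + s *\<^sub>R \<nu> x)) x < r" using tN by (simp add: dist_norm)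
      then show ?thesis using r(2) by (auto simp: dist_commute add.assoc)
    qed
    have eq: "x + t *\<^sub>R (v + c *\<^sub>R \<nu> x) = x + t *\<^sub>R v + (c * t) *\<^sub>R \<nu> x" for c by (simp add: algebra_simps)
    have "continuous_on U \<phi>" using isCont_\<phi> by (simp add: continuous_at_imp_continuous_on)
    then have "continuous_on {(- \<eta>) * t..\<eta> * t} (\<lambda>s. \<phi> (x + t *\<^sub>R v + s *\<^sub>R \<nu> x))"
      by (rule continuous_on_compose2) (use inU in \<open>auto intro!: continuous_intros\<close>)
    then obtain s where s: "(- \<eta>) * t \<le> s" "s \<le> \<eta> * t" "\<phi> (x + t *\<^sub>R v + s *\<^sub>R \<nu> x) = 0"
      using IVT'[of "\<lambda>s. \<phi> (x + t *\<^sub>R v + s *\<^sub>R \<nu> x)" "(- \<eta>) * t" 0 "\<eta> * t"]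
        d1(2)[OF t(1) tN(2), unfolded eq] d2(2)[OF t(1) tN(3), unfolded eq] t \<eta> by fastforce
    have "\<bar>s\<bar> \<le> \<eta> * t" using s by auto
    then show "\<exists>s. \<bar>s\<bar> \<le> \<eta> * t \<and> x + t *\<^sub>R v + s *\<^sub>R \<nu> x \<in> frontier \<Omega>"
      using frontier_iff[OF inU] s(3) by blast
  qed
qed

text \<open>One inclusion differentiates \<phi> along a curve on which it vanishes. For the other,
  only differentiability at time 0 is demanded, so boundary points over
  \<open>x + t *\<^sub>R v\<close> may be selected for each \<open>t\<close> separately.\<close>

lemma tangent_space:
  assumes x: "x \<in> U" "x \<in> frontier \<Omega>"
  shows "boundary_tangent_space \<Omega> x = {v. g x \<bullet> v = 0}"
proof (intro equalityI subsetI)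
  fix v assume "v \<in> boundary_tangent_space \<Omega> x"
  then obtain \<gamma> :: "real \<Rightarrow> 'a" where \<gamma>: "\<gamma> 0 = x" "\<And>t. \<gamma> t \<in> frontier \<Omega>" "(\<gamma> has_vector_derivative v) (at 0)"
    unfolding boundary_tangent_space_def by blast
  have "isCont \<gamma> 0" using \<gamma>(3) by (rule has_vector_derivative_continuous)
  then have "\<forall>\<^sub>F t in at 0. \<gamma> t \<in> U"
    using \<gamma>(1) x(1) open_U unfolding isCont_def tendsto_def by auto
  then obtain d where d: "d > 0" "\<And>t. dist t 0 < d \<Longrightarrow> \<gamma> t \<in> U"
    unfolding eventually_at using \<gamma>(1) x(1) by (metis UNIV_I)
  have z: "\<phi> (\<gamma> t) = 0" if "dist t 0 < d" for t using frontier_iff[OF d(2)[OF that]] \<gamma>(2) by blast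
  have "(\<phi> has_derivative (\<lambda>h. h \<bullet> g x)) (at (\<gamma> 0))" using gd x(1) unfolding gderiv_def \<gamma>(1) by blast
  then have "((\<lambda>t. \<phi> (\<gamma> t)) has_derivative (\<lambda>h. (h *\<^sub>R v) \<bullet> g x)) (at 0)"
    by (rule has_derivative_compose[OF \<gamma>(3)[unfolded has_vector_derivative_def]])
  then have "((\<lambda>t. 0) has_derivative (\<lambda>h. (h *\<^sub>R v) \<bullet> g x)) (at (0::real))"
    by (rule has_derivative_transform_within[OF _ d(1)]) (use z in auto)
  from has_derivative_unique[OF this has_derivative_const] have "(1 *\<^sub>R v) \<bullet> g x = 0" by metis
  then show "v \<in> {v. g x \<bullet> v = 0}" by (simp add: inner_commute)
next
  fix v assume "v \<in> {v. g x \<bullet> v = 0}"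
  then have v: "g x \<bullet> v = 0" by simp
  define Z where "Z t = {s. x + t *\<^sub>R v + s *\<^sub>R \<nu> x \<in> frontier \<Omega>}" for t
  have cl: "closed (Z t)" for t
    unfolding Z_def by (intro closed_vimage[unfolded vimage_def] continuous_intros) (simp add: frontier_closed)
  \<comment> \<open>Taking \<open>\<bar>s t\<bar>\<close> minimal makes one curve satisfy the estimate of \<open>frontier_near\<close> for all \<open>\<eta>\<close>.\<close>
  define s where "s t = (SOME s. s \<in> Z t \<and> (\<forall>s'\<in>Z t. \<bar>s\<bar> \<le> \<bar>s'\<bar>))" for t
  have sZ: "s t \<in> Z t \<and> (\<forall>s'\<in>Z t. \<bar>s t\<bar> \<le> \<bar>s'\<bar>)" if "Z t \<noteq> {}" for t
  proof -
    have "\<exists>s. s \<in> Z t \<and> (\<forall>s'\<in>Z t. \<bar>s\<bar> \<le> \<bar>s'\<bar>)"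
      using distance_attains_inf[OF cl that, of 0] unfolding dist_real_def by (metis abs_minus_commute diff_0_right)
    then show ?thesis unfolding s_def by (rule someI_ex)
  qed
  define \<gamma> where "\<gamma> t = (if Z t = {} then x else x + t *\<^sub>R v + s t *\<^sub>R \<nu> x)" for t
  have fr: "\<gamma> t \<in> frontier \<Omega>" for t using sZ[of t] x(2) unfolding \<gamma>_def Z_def by auto
  have Z0: "0 \<in> Z 0" unfolding Z_def using x(2) by simp
  then have s00: "s 0 = 0" using sZ[of 0] by force
  then have \<gamma>0: "\<gamma> 0 = x" using Z0 unfolding \<gamma>_def by auto
  have "(\<gamma> has_derivative (\<lambda>h. h *\<^sub>R v)) (at 0)"
    unfolding has_derivative_at_alt
  proof (intro conjI allI impI)
    show "bounded_linear (\<lambda>h. h *\<^sub>R v)" by (rule bounded_linear_scaleR_left)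
    fix e :: real assume e: "e > 0"
    have "g x \<bullet> (- v) = 0" using v by simp
    from frontier_near[OF x this e] frontier_near[OF x v e] obtain d1 d2 where
      d1: "d1 > 0" "\<And>t. 0 < t \<Longrightarrow> t < d1 \<Longrightarrow> \<exists>s. \<bar>s\<bar> \<le> e * t \<and> x + t *\<^sub>R (- v) + s *\<^sub>R \<nu> x \<in> frontier \<Omega>" and
      d2: "d2 > 0" "\<And>t. 0 < t \<Longrightarrow> t < d2 \<Longrightarrow> \<exists>s. \<bar>s\<bar> \<le> e * t \<and> x + t *\<^sub>R v + s *\<^sub>R \<nu> x \<in> frontier \<Omega>"
      by blast
    define d where "d = min d1 d2"
    have d: "d > 0" "\<And>t. t \<noteq> 0 \<Longrightarrow> \<bar>t\<bar> < d \<Longrightarrow> \<exists>s. \<bar>s\<bar> \<le> e * \<bar>t\<bar> \<and> x + t *\<^sub>R v + s *\<^sub>R \<nu> x \<in> frontier \<Omega>"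
      subgoal unfolding d_def using d1(1) d2(1) by simp
      subgoal for t unfolding d_def using d1(2)[of "- t"] d2(2)[of t] by (cases "t > 0") auto
      done
    show "\<exists>d>0. \<forall>y. norm (y - 0) < d \<longrightarrow> norm (\<gamma> y - \<gamma> 0 - (y - 0) *\<^sub>R v) \<le> e * norm (y - 0)"
    proof (intro exI[of _ d] conjI d(1) allI impI)
      fix t :: real assume t: "norm (t - 0) < d"
      show "norm (\<gamma> t - \<gamma> 0 - (t - 0) *\<^sub>R v) \<le> e * norm (t - 0)"
      proof (cases "t = 0")
        case False
        then obtain s' where s': "\<bar>s'\<bar> \<le> e * \<bar>t\<bar>" "s' \<in> Z t" using d(2)[of t] t unfolding Z_def by auto
        then have "Z t \<noteq> {}" "\<bar>s t\<bar> \<le> e * \<bar>t\<bar>" using sZ[of t] by fastforce+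
        then show ?thesis using norm_\<nu>[OF x(1)] \<gamma>0 by (simp add: \<gamma>_def)
      qed simp
    qed
  qed
  then show "v \<in> boundary_tangent_space \<Omega> x"
    unfolding boundary_tangent_space_def has_vector_derivative_def using fr \<gamma>0 by blast
qed

lemma outward_normal:
  assumes x: "x \<in> U" "x \<in> frontier \<Omega>"
  shows "outward_normal \<Omega> x = \<nu> x"
  unfolding outward_normal_def
proof (rule the_equality)
  have ng: "norm (g x) > 0" using g_nz x by simp
  have \<phi>x: "\<phi> x = 0" using frontier_iff x by blast
  have g\<nu>: "g x \<bullet> \<nu> x = norm (g x)" unfolding \<nu>_def using ng by (simp add: dot_square_norm power2_eq_square)
  obtain d1 where d1: "d1 > 0" "\<And>t. 0 < t \<Longrightarrow> t < d1 \<Longrightarrow> x + t *\<^sub>R (- \<nu> x) \<in> \<Omega>"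
    using inward[OF x(1) \<phi>x, of "- \<nu> x"] g\<nu> ng by auto
  obtain d2 where d2: "d2 > 0" "\<And>t. 0 < t \<Longrightarrow> t < d2 \<Longrightarrow> x + t *\<^sub>R \<nu> x \<notin> \<Omega>"
    using outward[OF x(1) \<phi>x, of "\<nu> x"] g\<nu> ng by auto
  have ev: "\<forall>\<^sub>F t in at_right 0. x - t *\<^sub>R \<nu> x \<in> \<Omega> \<and> x + t *\<^sub>R \<nu> x \<notin> \<Omega>"
    using d1 d2 by (intro eventually_at_rightI[of 0 "min d1 d2"]) auto
  show "norm (\<nu> x) = 1 \<and> (\<forall>w\<in>boundary_tangent_space \<Omega> x. \<nu> x \<bullet> w = 0) \<and>
     (\<forall>\<^sub>F t in at_right 0. x - t *\<^sub>R \<nu> x \<in> \<Omega> \<and> x + t *\<^sub>R \<nu> x \<notin> \<Omega>)"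
    using ev norm_\<nu>[OF x(1)] unfolding tangent_space[OF x] \<nu>_def by simp
  fix v assume v: "norm v = 1 \<and> (\<forall>w\<in>boundary_tangent_space \<Omega> x. v \<bullet> w = 0) \<and>
     (\<forall>\<^sub>F t in at_right 0. x - t *\<^sub>R v \<in> \<Omega> \<and> x + t *\<^sub>R v \<notin> \<Omega>)"
  define w where "w = v - (v \<bullet> \<nu> x) *\<^sub>R \<nu> x"
  have \<nu>\<nu>: "\<nu> x \<bullet> \<nu> x = 1" using norm_\<nu>[OF x(1)] by (simp add: dot_square_norm)
  have \<nu>w: "\<nu> x \<bullet> w = 0" unfolding w_def using \<nu>\<nu> by (simp add: inner_diff_right inner_commute)
  then have "g x \<bullet> w = 0" using ng unfolding \<nu>_def by simp
  then have "v \<bullet> w = 0" using v unfolding tangent_space[OF x] by blast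
  then have "w \<bullet> w = 0" using \<nu>w unfolding w_def by (simp add: inner_diff_left)
  then have veq: "v = (v \<bullet> \<nu> x) *\<^sub>R \<nu> x" unfolding w_def by simp
  then have "norm v = \<bar>v \<bullet> \<nu> x\<bar> * norm (\<nu> x)" by (metis norm_scaleR)
  then have c: "\<bar>v \<bullet> \<nu> x\<bar> = 1" using v norm_\<nu>[OF x(1)] by simp
  have "v \<bullet> \<nu> x \<noteq> - 1"
  proof
    assume "v \<bullet> \<nu> x = - 1"
    then have "v = - \<nu> x" using veq by simp
    then have "\<forall>\<^sub>F t in at_right 0. x + t *\<^sub>R \<nu> x \<in> \<Omega>" using v by (auto elim: eventually_mono)
    then have "\<forall>\<^sub>F t in at_right (0::real). False" using ev by eventually_elim auto
    then show False by simp
  qed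
  then have "v \<bullet> \<nu> x = 1" using c by linarith
  then show "v = \<nu> x" using veq by simp
qed

text \<open>With \<open>g\<close> differentiable at \<open>p\<close> only, the mean value theorem is
  applied to the remainder along the segment, and the first order expansion of \<open>g\<close> at
  \<open>p\<close> bounds its derivative.\<close>

lemma taylor:
  assumes e: "e > 0"
  shows "\<exists>d>0. \<forall>h. norm h < d \<longrightarrow> p + h \<in> U \<and> \<bar>\<phi> (p + h) - g p \<bullet> h - (H h \<bullet> h) / 2\<bar> \<le> e * (norm h)\<^sup>2"
proof -
  interpret H: bounded_linear H using H by (rule has_derivative_bounded_linear)
  have \<phi>p: "\<phi> p = 0" using frontier_iff p by blast
  obtain d1 where d1: "d1 > 0" "\<And>y. norm (y - p) < d1 \<Longrightarrow> norm (g y - g p - H (y - p)) \<le> e * norm (y - p)"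
    using H e unfolding has_derivative_at_alt by blast
  obtain r where r: "r > 0" "ball p r \<subseteq> U" using p open_U open_contains_ball by blast
  show ?thesis
  proof (intro exI[of _ "min d1 r"] conjI allI impI)
    show "min d1 r > 0" using d1 r by simp
    fix h :: 'a assume h: "norm h < min d1 r"
    have th: "norm (t *\<^sub>R h) \<le> norm h" if "0 \<le> t" "t \<le> 1" for t
      using that mult_right_mono[of t 1 "norm h"] by simp
    have inU: "p + t *\<^sub>R h \<in> U" if "0 \<le> t" "t \<le> 1" for t
    proof -
      have "dist p (p + t *\<^sub>R h) < r" using th[OF that] h by (simp add: dist_norm)
      then show ?thesis using r(2) by auto
    qed
    from inU[of 1] show "p + h \<in> U" by simp
    have "\<exists>t. t > 0 \<and> t < 1 \<and> (\<phi> (p + 1 *\<^sub>R h) - 1 * (g p \<bullet> h) - 1\<^sup>2 / 2 * (H h \<bullet> h)) - (\<phi> (p + 0 *\<^sub>R h) - 0 * (g p \<bullet> h) - 0\<^sup>2 / 2 * (H h \<bullet> h))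
        = (1 - 0) * (g (p + t *\<^sub>R h) \<bullet> h - g p \<bullet> h - t * (H h \<bullet> h))"
    proof (rule MVT2)
      fix t :: real assume t: "0 \<le> t" "t \<le> 1"
      show "((\<lambda>t. \<phi> (p + t *\<^sub>R h) - t * (g p \<bullet> h) - t\<^sup>2 / 2 * (H h \<bullet> h)) has_real_derivative
          g (p + t *\<^sub>R h) \<bullet> h - g p \<bullet> h - t * (H h \<bullet> h)) (at t)"
        by (rule derivative_eq_intros GDERIV_line[OF gd[OF inU[OF t]]] refl | simp)+
    qed simp
    then obtain t where t: "0 < t" "t < 1" "\<phi> (p + h) - g p \<bullet> h - (H h \<bullet> h) / 2 = (g (p + t *\<^sub>R h) - g p - H (t *\<^sub>R h)) \<bullet> h"
      using \<phi>p by (auto simp: inner_diff_left H.scaleR)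
    have "\<bar>(g (p + t *\<^sub>R h) - g p - H (t *\<^sub>R h)) \<bullet> h\<bar> \<le> norm (g (p + t *\<^sub>R h) - g p - H (t *\<^sub>R h)) * norm h"
      by (rule Cauchy_Schwarz_ineq2)
    also have "\<dots> \<le> (e * norm (t *\<^sub>R h)) * norm h"
      using d1(2)[of "p + t *\<^sub>R h"] th[of t] t h by (intro mult_right_mono) auto
    also have "\<dots> \<le> (e * norm h) * norm h" using th[of t] t e by (intro mult_right_mono mult_left_mono) auto
    finally show "\<bar>\<phi> (p + h) - g p \<bullet> h - (H h \<bullet> h) / 2\<bar> \<le> e * (norm h)\<^sup>2"
      unfolding t(3) by (simp add: power2_eq_square)
  qed
qed

lemma interior_ball: "\<exists>r>0. ball (p - r *\<^sub>R \<nu> p) r \<subseteq> \<Omega>"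
proof -
  interpret H: bounded_linear H using H by (rule has_derivative_bounded_linear)
  obtain d where d: "d > 0" "\<And>h. norm h < d \<Longrightarrow> p + h \<in> U"
     "\<And>h. norm h < d \<Longrightarrow> \<bar>\<phi> (p + h) - g p \<bullet> h - (H h \<bullet> h) / 2\<bar> \<le> 1 * (norm h)\<^sup>2"
    using taylor[of 1] by auto
  obtain B where B: "B \<ge> 0" "\<And>y. norm (H y) \<le> norm y * B" using H.nonneg_bounded by blast
  define C where "C = B + 1"
  have C: "C > 0" unfolding C_def using B by simp
  have ng: "norm (g p) > 0" using g_nz p by simp
  \<comment> \<open>In the tangent ball \<open>|h|\<^sup>2 < 2 r (- \<nu> \<bullet> h)\<close>. With
    \<open>2 * r * C\<close> at most the length of \<open>g p\<close> the linear term beats the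
    quadratic one; \<open>d / 2\<close> keeps the ball within reach of
    \<open>taylor\<close>.\<close>
  define r where "r = min (d / 2) (norm (g p) / (2 * C))"
  have r: "r > 0" "2 * r \<le> d" "2 * r * C \<le> norm (g p)"
  proof -
    show "r > 0" unfolding r_def using d ng C by simp
    show "2 * r \<le> d" unfolding r_def by simp
    have "r \<le> norm (g p) / (2 * C)" unfolding r_def by simp
    then show "2 * r * C \<le> norm (g p)" using C by (simp add: pos_le_divide_eq algebra_simps)
  qed
  have \<nu>\<nu>: "\<nu> p \<bullet> \<nu> p = 1" using norm_\<nu>[OF p(1)] by (simp add: dot_square_norm)
  have "x \<in> \<Omega>" if x: "x \<in> ball (p - r *\<^sub>R \<nu> p) r" for x
  proof -
    define h where "h = x - p"
    have "dist (p - r *\<^sub>R \<nu> p) x < r" using x by simp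
    then have nh: "norm (h + r *\<^sub>R \<nu> p) < r" unfolding h_def by (simp add: dist_norm norm_minus_commute algebra_simps)
    have "norm h \<le> norm (h + r *\<^sub>R \<nu> p) + norm (r *\<^sub>R \<nu> p)"
      using norm_triangle_ineq4[of "h + r *\<^sub>R \<nu> p" "r *\<^sub>R \<nu> p"] by simp
    then have hd: "norm h < d" using nh r norm_\<nu>[OF p(1)] by simp
    have "(norm (h + r *\<^sub>R \<nu> p))\<^sup>2 < r\<^sup>2" using nh by (intro power_strict_mono) auto
    moreover have "(norm (h + r *\<^sub>R \<nu> p))\<^sup>2 = (norm h)\<^sup>2 + 2 * r * (\<nu> p \<bullet> h) + r\<^sup>2"
      unfolding power2_norm_eq_inner using \<nu>\<nu> by (simp add: inner_add_left inner_add_right inner_commute power2_eq_square)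
    ultimately have h2: "(norm h)\<^sup>2 < 2 * r * (- (\<nu> p \<bullet> h))" by simp
    then have "0 < 2 * r * (- (\<nu> p \<bullet> h))" using zero_le_power2[of "norm h"] by linarith
    then have npos: "- (\<nu> p \<bullet> h) > 0" using r(1) by (simp add: zero_less_mult_iff mult_less_0_iff)
    have "H h \<bullet> h \<le> norm (H h) * norm h" by (rule norm_cauchy_schwarz)
    also have "\<dots> \<le> (norm h * B) * norm h" using B(2) by (intro mult_right_mono) auto
    finally have "H h \<bullet> h \<le> B * (norm h)\<^sup>2" by (simp add: power2_eq_square algebra_simps)
    moreover have "B * (norm h)\<^sup>2 \<ge> 0" using B by simp
    ultimately have "(H h \<bullet> h) / 2 \<le> B * (norm h)\<^sup>2" by linarith
    moreover have "\<phi> (p + h) - g p \<bullet> h - (H h \<bullet> h) / 2 \<le> 1 * (norm h)\<^sup>2" using abs_le_D1[OF d(3)[OF hd]] .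
    ultimately have "\<phi> (p + h) \<le> g p \<bullet> h + C * (norm h)\<^sup>2" unfolding C_def by (simp add: algebra_simps)
    also have "\<dots> < g p \<bullet> h + C * (2 * r * (- (\<nu> p \<bullet> h)))" using mult_strict_left_mono[OF h2 C] by linarith
    also have "\<dots> = g p \<bullet> h + (2 * r * C) * (- (\<nu> p \<bullet> h))" by simp
    also have "\<dots> \<le> g p \<bullet> h + norm (g p) * (- (\<nu> p \<bullet> h))"
      using mult_right_mono[OF r(3), of "- (\<nu> p \<bullet> h)"] npos by linarith
    also have "\<dots> = 0" unfolding \<nu>_def using ng by simp
    finally show ?thesis using chartD[OF d(2)[OF hd]] unfolding h_def by simp
  qed
  then show ?thesis using r(1) by blast
qed

section \<open>The shape operator and the mean curvature at p\<close>

abbreviation n\<^sub>p :: 'a where "n\<^sub>p \<equiv> \<nu> p"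

definition proj :: "'a \<Rightarrow> 'a" where "proj y = y - (n\<^sub>p \<bullet> y) *\<^sub>R n\<^sub>p"

text \<open>The Weingarten map of the level set of \<phi>, extended by 0 on the normal line. Its
  trace on the whole space is therefore the sum of the principal curvatures.\<close>

definition shape :: "'a \<Rightarrow> 'a" where "shape y = (1 / norm (g p)) *\<^sub>R proj (H (proj y))"

lemma H_linear: "bounded_linear H" using H by (rule has_derivative_bounded_linear)

lemma g_p_pos: "norm (g p) > 0" using g_nz p by simp

lemma np_unit: "n\<^sub>p \<bullet> n\<^sub>p = 1" using norm_\<nu>[OF p(1)] by (simp add: dot_square_norm)

lemma np_g: "n\<^sub>p \<bullet> g p = norm (g p)"
  unfolding \<nu>_def using g_p_pos by (simp add: dot_square_norm power2_eq_square)

lemma H_sym: "H x \<bullet> y = x \<bullet> H y"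
  using hessian_symmetric[OF open_U p(1) gd H, of x y] by (simp add: inner_commute)

lemma proj_sym: "proj x \<bullet> y = x \<bullet> proj y"
  unfolding proj_def by (simp add: inner_diff_left inner_diff_right inner_commute)

lemma proj_linear: "bounded_linear proj"
  unfolding proj_def
  by (intro bounded_linear_sub bounded_linear_ident bounded_linear_scaleR_const bounded_linear_inner_right)

lemma np_proj: "n\<^sub>p \<bullet> proj y = 0"
  unfolding proj_def using np_unit by (simp add: inner_diff_right)

lemma proj_tangent: "n\<^sub>p \<bullet> y = 0 \<Longrightarrow> proj y = y"
  unfolding proj_def by simp

lemma shape_linear: "bounded_linear shape"
  unfolding shape_def
  by (intro bounded_linear_const_scaleR bounded_linear_compose[OF proj_linear] bounded_linear_compose[OF H_linear] proj_linear)

lemma shape_sym: "shape x \<bullet> y = x \<bullet> shape y"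
  unfolding shape_def by (simp add: proj_sym H_sym)

lemma shape_np: "shape n\<^sub>p = 0"
proof -
  interpret H: bounded_linear H by (rule H_linear)
  interpret P: bounded_linear proj by (rule proj_linear)
  have "proj n\<^sub>p = 0" unfolding proj_def using np_unit by simp
  then show ?thesis unfolding shape_def by (simp add: H.zero P.zero)
qed

lemma tangent_iff: "v \<in> boundary_tangent_space \<Omega> p \<longleftrightarrow> n\<^sub>p \<bullet> v = 0"
  unfolding tangent_space[OF p] \<nu>_def using g_p_pos by auto

text \<open>The derivative of a unit field is orthogonal to it, so projecting to the tangent space
  changes nothing, while it removes the contribution of the varying factor
  \<open>1 / norm (g x)\<close>.\<close>

lemma normal_derivative:
  "\<exists>N. (\<nu> has_derivative N) (at p) \<and> (\<forall>v. n\<^sub>p \<bullet> v = 0 \<longrightarrow> N v = shape v)"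
proof -
  have "(\<lambda>x. norm (g x)) differentiable (at p)"
    by (rule differentiable_compose[of norm g p UNIV, OF differentiable_norm_at[OF g_nz[OF p(1)]]])
      (use H in \<open>blast intro: differentiableI\<close>)
  then have "(\<lambda>x. inverse (norm (g x))) differentiable (at p)"
    using g_p_pos by (intro differentiable_inverse) auto
  then obtain D where "((\<lambda>x. inverse (norm (g x))) has_derivative D) (at p)" unfolding differentiable_def by blast
  then have D: "((\<lambda>x. 1 / norm (g x)) has_derivative D) (at p)" by (simp add: inverse_eq_divide)
  define N where "N h = (1 / norm (g p)) *\<^sub>R H h + D h *\<^sub>R g p" for h
  have N: "(\<nu> has_derivative N) (at p)"
    using has_derivative_scaleR[OF D H] unfolding \<nu>_def[abs_def] N_def by simp
  have orth: "n\<^sub>p \<bullet> N v = 0" for v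
  proof -
    have "((\<lambda>x. \<nu> x \<bullet> \<nu> x) has_derivative (\<lambda>h. n\<^sub>p \<bullet> N h + N h \<bullet> n\<^sub>p)) (at p)"
      by (rule has_derivative_inner[OF N N])
    then have "((\<lambda>x. 1) has_derivative (\<lambda>h. n\<^sub>p \<bullet> N h + N h \<bullet> n\<^sub>p)) (at p)"
      by (rule has_derivative_transform_within_open[OF _ open_U p(1)]) (simp add: norm_\<nu> dot_square_norm)
    from fun_cong[OF has_derivative_unique[OF this has_derivative_const], of v] show ?thesis
      by (simp add: inner_commute)
  qed
  have "N v = shape v" if v: "n\<^sub>p \<bullet> v = 0" for v
  proof -
    interpret P: bounded_linear proj by (rule proj_linear)
    have "proj (g p) = 0" unfolding proj_def np_g by (simp add: g_\<nu>[OF p(1), symmetric])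
    have "N v = proj (N v)" using proj_tangent[OF orth] by simp
    also have "\<dots> = shape v" unfolding N_def shape_def proj_tangent[OF v]
      using \<open>proj (g p) = 0\<close> by (simp add: P.add P.scaleR)
    finally show ?thesis .
  qed
  with N show ?thesis by (intro exI[of _ N]) simp
qed

text \<open>A derivative within the frontier is pinned down only on tangent vectors. Composition
  with a boundary curve of velocity \<open>v\<close> identifies it there with that of the ambient
  field \<open>\<nu>\<close>.\<close>

lemma derivative_along_boundary:
  assumes A: "(outward_normal \<Omega> has_derivative A) (at p within frontier \<Omega>)" and v: "n\<^sub>p \<bullet> v = 0"
  shows "A v = shape v"
proof -
  obtain N where N: "(\<nu> has_derivative N) (at p)" "\<forall>v. n\<^sub>p \<bullet> v = 0 \<longrightarrow> N v = shape v"
    using normal_derivative by (elim exE conjE)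
  obtain \<gamma> :: "real \<Rightarrow> 'a" where \<gamma>: "\<gamma> 0 = p" "\<And>t. \<gamma> t \<in> frontier \<Omega>" "(\<gamma> has_vector_derivative v) (at 0)"
    using v[folded tangent_iff] unfolding boundary_tangent_space_def by blast
  have \<gamma>d: "(\<gamma> has_derivative (\<lambda>h. h *\<^sub>R v)) (at 0)" using \<gamma>(3) unfolding has_vector_derivative_def .
  have dA: "((\<lambda>t. outward_normal \<Omega> (\<gamma> t)) has_derivative (\<lambda>h. A (h *\<^sub>R v))) (at 0)"
  proof (rule has_derivative_in_compose[OF \<gamma>d])
    have "range \<gamma> \<subseteq> frontier \<Omega>" using \<gamma>(2) by blast
    from has_derivative_subset[OF A this]
    show "(outward_normal \<Omega> has_derivative A) (at (\<gamma> 0) within range \<gamma>)" unfolding \<gamma>(1) .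
  qed
  have dN: "((\<lambda>t. \<nu> (\<gamma> t)) has_derivative (\<lambda>h. N (h *\<^sub>R v))) (at 0)"
    by (rule has_derivative_compose[OF \<gamma>d]) (simp add: N(1) \<gamma>(1))
  have "isCont \<gamma> 0" using \<gamma>(3) by (rule has_vector_derivative_continuous)
  then have "\<forall>\<^sub>F t in at 0. \<gamma> t \<in> U"
    using \<gamma>(1) p(1) open_U unfolding isCont_def by (intro topological_tendstoD) auto
  then obtain d where d: "d > 0" "\<And>t. t \<noteq> 0 \<Longrightarrow> dist t 0 < d \<Longrightarrow> \<gamma> t \<in> U"
    unfolding eventually_at by blast
  have "((\<lambda>t. \<nu> (\<gamma> t)) has_derivative (\<lambda>h. A (h *\<^sub>R v))) (at 0)"
  proof (rule has_derivative_transform_within[OF dA d(1) UNIV_I])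
    fix t :: real assume "dist t 0 < d"
    then have "\<gamma> t \<in> U" using d(2)[of t] p(1) \<gamma>(1) by (cases "t = 0") auto
    then show "outward_normal \<Omega> (\<gamma> t) = \<nu> (\<gamma> t)" using \<gamma>(2) by (rule outward_normal)
  qed
  from fun_cong[OF has_derivative_unique[OF this dN], of 1]
  have "A v = N v" unfolding scaleR_one .
  then show ?thesis using N(2) v by simp
qed

text \<open>Adding the normal completes \<open>E\<close> to an orthonormal basis of the space, and
  \<open>shape\<close> vanishes on the normal. The sum is thus a trace, independent of
  \<open>E\<close> and \<open>k\<close>, which makes the mean curvature well defined.\<close>

lemma principal_curvatures_sum:
  assumes "principal_curvatures \<Omega> p E k"
  shows "(\<Sum>e\<in>E. k e) = trace shape"
proof -
  have E: "pairwise orthogonal E" "\<And>e. e \<in> E \<Longrightarrow> norm e = 1" "span E = boundary_tangent_space \<Omega> p"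
    using assms unfolding principal_curvatures_def by simp_all
  have "\<exists>A. (outward_normal \<Omega> has_derivative A) (at p within frontier \<Omega>) \<and> (\<forall>e\<in>E. A e = k e *\<^sub>R e)"
    using assms unfolding principal_curvatures_def by (elim conjE)
  then obtain A where A: "(outward_normal \<Omega> has_derivative A) (at p within frontier \<Omega>)" "\<And>e. e \<in> E \<Longrightarrow> A e = k e *\<^sub>R e"
    by auto
  have Et: "n\<^sub>p \<bullet> e = 0" if "e \<in> E" for e
    using span_base[OF that] unfolding E(3) tangent_iff .
  have npE: "n\<^sub>p \<notin> E" using Et[of n\<^sub>p] np_unit by auto
  have "independent E" using E by (intro pairwise_orthogonal_independent) (use E(2)[of 0] in auto)
  then have fin: "finite E" by (rule independent_imp_finite)
  have "span (insert n\<^sub>p E) = UNIV"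
  proof (intro equalityI subsetI UNIV_I)
    fix y
    have "y - (n\<^sub>p \<bullet> y) *\<^sub>R n\<^sub>p \<in> span E" unfolding E(3) tangent_iff using np_proj[of y] unfolding proj_def .
    then show "y \<in> span (insert n\<^sub>p E)" unfolding span_breakdown_eq by blast
  qed
  moreover have "pairwise orthogonal (insert n\<^sub>p E)"
    using E(1) Et by (auto simp: pairwise_insert orthogonal_def inner_commute)
  moreover have "norm e = 1" if "e \<in> insert n\<^sub>p E" for e using that E(2) norm_\<nu>[OF p(1)] by blast
  ultimately have "(\<Sum>e\<in>insert n\<^sub>p E. shape e \<bullet> e) = trace shape"
    by (intro trace_orthonormal bounded_linear.linear[OF shape_linear])
  moreover have "(\<Sum>e\<in>insert n\<^sub>p E. shape e \<bullet> e) = (\<Sum>e\<in>E. k e)"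
  proof -
    have "shape e \<bullet> e = k e" if e: "e \<in> E" for e
    proof -
      have "shape e = k e *\<^sub>R e" using derivative_along_boundary[OF A(1) Et[OF e]] A(2)[OF e] by simp
      then show ?thesis using E(2)[OF e] by (simp add: dot_square_norm)
    qed
    then show ?thesis using fin npE by (simp add: shape_np)
  qed
  ultimately show ?thesis by simp
qed

lemma principal_curvatures_exist: "\<exists>E k. principal_curvatures \<Omega> p E k"
proof -
  let ?T = "boundary_tangent_space \<Omega> p"
  have T: "?T = {v. n\<^sub>p \<bullet> v = 0}" using tangent_iff by blast
  have "subspace ?T" unfolding T by (auto simp: subspace_def inner_add_right)
  moreover have "shape x \<in> ?T" for x unfolding T shape_def by (simp add: np_proj)
  ultimately obtain E k where E: "pairwise orthogonal E" "\<forall>e\<in>E. norm e = 1" "span E = ?T" "\<forall>e\<in>E. shape e = k e *\<^sub>R e"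
    using spectral_subspace[OF bounded_linear.linear[OF shape_linear] shape_sym] by blast
  obtain N where N: "(\<nu> has_derivative N) (at p)" "\<forall>v. n\<^sub>p \<bullet> v = 0 \<longrightarrow> N v = shape v"
    using normal_derivative by (elim exE conjE)
  obtain r where r: "r > 0" "ball p r \<subseteq> U" using p open_U open_contains_ball by blast
  have "(outward_normal \<Omega> has_derivative N) (at p within frontier \<Omega>)"
  proof (rule has_derivative_transform_within[OF has_derivative_at_withinI[OF N(1)] r(1) p(2)])
    fix x assume "x \<in> frontier \<Omega>" "dist x p < r"
    then show "\<nu> x = outward_normal \<Omega> x" using outward_normal[of x] r(2) by (auto simp: dist_commute)
  qed
  moreover have "N e = k e *\<^sub>R e" if e: "e \<in> E" for e
  proof -
    have "n\<^sub>p \<bullet> e = 0" using span_base[OF e] unfolding E(3) tangent_iff .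
    then show ?thesis using N(2) E(4) e by simp
  qed
  ultimately have "principal_curvatures \<Omega> p E k" unfolding principal_curvatures_def using E by blast
  then show ?thesis by blast
qed

lemma mean_curvature_eq: "mean_curvature \<Omega> p = trace shape / (real DIM('a) - 1)"
  unfolding mean_curvature_def
proof (rule the_equality)
  obtain E k where "principal_curvatures \<Omega> p E k" using principal_curvatures_exist by blast
  then show "\<exists>E k. principal_curvatures \<Omega> p E k \<and>
      trace shape / (real DIM('a) - 1) = (\<Sum>e\<in>E. k e) / (real DIM('a) - 1)"
    using principal_curvatures_sum by metis
qed (use principal_curvatures_sum in metis)

text \<open>At the graph point the second order expansion of \<phi> leaves
  \<open>G0 * \<delta> * |y|\<^sup>2\<close>. Half of it covers the Taylor remainder, the other half
  the replacement of \<open>h\<close> by \<open>y\<close> in the quadratic term, so \<phi> is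
  nonnegative.\<close>

lemma touching_graph:
  assumes \<delta>: "\<delta> > 0"
  shows "\<exists>e>0. \<forall>y. y \<bullet> n\<^sub>p = 0 \<longrightarrow> norm y < e \<longrightarrow>
      p + y + (- (shape y \<bullet> y) / 2 + \<delta> * (y \<bullet> y)) *\<^sub>R n\<^sub>p \<notin> \<Omega>"
proof -
  interpret H: bounded_linear H by (rule H_linear)
  interpret S: bounded_linear shape by (rule shape_linear)
  define G0 where "G0 = norm (g p)"
  have G0: "G0 > 0" unfolding G0_def by (rule g_p_pos)
  obtain B where B: "B > 0" "\<And>y. norm (H y) \<le> norm y * B" using H.pos_bounded by blast
  obtain B' where B': "B' > 0" "\<And>y. norm (shape y) \<le> norm y * B'" using S.pos_bounded by blast
  define C where "C = B' + \<delta>"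
  have C: "C > 0" unfolding C_def using B' \<delta> by simp
  define \<epsilon> where "\<epsilon> = G0 * \<delta> / 8"
  have \<epsilon>: "\<epsilon> > 0" unfolding \<epsilon>_def using G0 \<delta> by simp
  obtain d where d: "d > 0" "\<And>h. norm h < d \<Longrightarrow> p + h \<in> U"
     "\<And>h. norm h < d \<Longrightarrow> \<bar>\<phi> (p + h) - g p \<bullet> h - (H h \<bullet> h) / 2\<bar> \<le> \<epsilon> * (norm h)\<^sup>2"
    using taylor[OF \<epsilon>] by auto
  \<comment> \<open>The first bound makes \<open>\<bar>\<sigma>\<bar> \<le> |y|\<close>, the second
    keeps \<open>h\<close> in the range of \<open>taylor\<close>, the third makes the cubic error at
    most \<open>G0 * \<delta> * |y|\<^sup>2\<close>.\<close>
  define e where "e = Min {1 / C, d / 2, G0 * \<delta> / (4 * B * C)}"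
  have e: "e > 0" "e \<le> 1 / C" "e \<le> d / 2" "e \<le> G0 * \<delta> / (4 * B * C)"
    unfolding e_def using C d G0 \<delta> B by auto
  show ?thesis
  proof (rule exI[of _ e], intro conjI e(1) allI impI)
    fix y assume y: "y \<bullet> n\<^sub>p = 0" "norm y < e"
    define \<sigma> where "\<sigma> = - (shape y \<bullet> y) / 2 + \<delta> * (y \<bullet> y)"
    define h where "h = y + \<sigma> *\<^sub>R n\<^sub>p"
    define Y where "Y = norm y"
    have Y0: "Y \<ge> 0" unfolding Y_def by simp
    have yy: "y \<bullet> y = Y\<^sup>2" unfolding Y_def by (simp add: dot_square_norm)
    have "\<bar>shape y \<bullet> y\<bar> \<le> norm (shape y) * norm y" by (rule Cauchy_Schwarz_ineq2)
    also have "\<dots> \<le> (norm y * B') * norm y" using B'(2) by (intro mult_right_mono) auto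
    finally have "\<bar>shape y \<bullet> y\<bar> \<le> B' * Y\<^sup>2" unfolding Y_def by (simp add: power2_eq_square algebra_simps)
    moreover have "\<delta> * Y\<^sup>2 \<ge> 0" "B' * Y\<^sup>2 \<ge> 0" using \<delta> B' by simp_all
    ultimately have \<sigma>C: "\<bar>\<sigma>\<bar> \<le> C * Y\<^sup>2" unfolding \<sigma>_def yy C_def distrib_right by linarith
    have Ye: "Y \<le> 1 / C" "Y \<le> G0 * \<delta> / (4 * B * C)" using y(2) e unfolding Y_def by auto
    have CY: "C * Y \<le> 1" using Ye(1) C by (simp add: pos_le_divide_eq mult.commute)
    have "C * Y\<^sup>2 = (C * Y) * Y" by (simp add: power2_eq_square)
    also have "\<dots> \<le> 1 * Y" using CY Y0 by (rule mult_right_mono)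
    finally have \<sigma>Y: "\<bar>\<sigma>\<bar> \<le> Y" using \<sigma>C by simp
    have nh: "norm h \<le> 2 * Y"
      unfolding h_def using norm_triangle_ineq[of y "\<sigma> *\<^sub>R n\<^sub>p"] norm_\<nu>[OF p(1)] \<sigma>Y by (simp add: Y_def)
    then have hd: "norm h < d" using y(2) e(3) unfolding Y_def by simp
    have "n\<^sub>p \<bullet> h = \<sigma>"
      unfolding h_def using np_unit y(1) by (simp add: inner_add_right inner_commute)
    then have gh: "g p \<bullet> h = G0 * \<sigma>"
      unfolding G0_def by (subst g_\<nu>[OF p(1)]) simp
    have Hy: "H y \<bullet> y = G0 * (shape y \<bullet> y)"
    proof -
      have "proj y = y" using y(1) by (intro proj_tangent) (simp add: inner_commute)
      then have "shape y \<bullet> y = (1 / G0) * (H y \<bullet> y)" unfolding shape_def G0_def by (simp add: proj_sym)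
      then show ?thesis using G0 by simp
    qed
    have diff: "\<bar>H h \<bullet> h - H y \<bullet> y\<bar> \<le> 3 * B * C * Y ^ 3"
    proof -
      have "H h \<bullet> h - H y \<bullet> y = (\<sigma> *\<^sub>R H n\<^sub>p) \<bullet> h + H y \<bullet> (\<sigma> *\<^sub>R n\<^sub>p)"
        unfolding h_def by (simp add: H.add H.scaleR inner_add_left inner_add_right algebra_simps)
      also have "\<bar>\<dots>\<bar> \<le> norm (\<sigma> *\<^sub>R H n\<^sub>p) * norm h + norm (H y) * norm (\<sigma> *\<^sub>R n\<^sub>p)"
        by (intro order_trans[OF abs_triangle_ineq] add_mono Cauchy_Schwarz_ineq2)
      also have "\<dots> \<le> (\<bar>\<sigma>\<bar> * B) * (2 * Y) + (Y * B) * \<bar>\<sigma>\<bar>"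
        using B(2)[of n\<^sub>p] B(2)[of y] nh norm_\<nu>[OF p(1)] B(1)
        by (intro add_mono mult_mono) (auto simp: Y_def intro!: mult_left_mono)
      also have "\<dots> = (3 * B * Y) * \<bar>\<sigma>\<bar>" by (simp add: algebra_simps)
      also have "\<dots> \<le> (3 * B * Y) * (C * Y\<^sup>2)" using \<sigma>C B(1) Y0 by (intro mult_left_mono) auto
      finally show ?thesis by (simp add: power2_eq_square power3_eq_cube algebra_simps)
    qed
    have "(norm h)\<^sup>2 \<le> (2 * Y)\<^sup>2" using nh by (intro power_mono) auto
    then have "\<epsilon> * (norm h)\<^sup>2 \<le> \<epsilon> * (4 * Y\<^sup>2)" using \<epsilon> by (intro mult_left_mono) auto
    moreover have "\<epsilon> * (4 * Y\<^sup>2) = G0 * \<delta> * Y\<^sup>2 / 2" unfolding \<epsilon>_def by simp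
    moreover have "3 * B * C * Y ^ 3 \<le> G0 * \<delta> * Y\<^sup>2"
    proof -
      have "Y * (4 * B * C) \<le> G0 * \<delta>" using Ye(2) B C by (simp add: pos_le_divide_eq)
      moreover have "Y * (3 * B * C) \<le> Y * (4 * B * C)" using Y0 B C by (intro mult_left_mono) auto
      ultimately have "Y * (3 * B * C) \<le> G0 * \<delta>" by linarith
      then have "(Y * (3 * B * C)) * Y\<^sup>2 \<le> (G0 * \<delta>) * Y\<^sup>2" by (rule mult_right_mono) simp
      then show ?thesis by (simp add: power2_eq_square power3_eq_cube algebra_simps)
    qed
    moreover have "\<phi> (p + h) \<ge> g p \<bullet> h + (H h \<bullet> h) / 2 - \<epsilon> * (norm h)\<^sup>2" using abs_le_D2[OF d(3)[OF hd]] by linarith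
    moreover have "g p \<bullet> h + (H y \<bullet> y) / 2 = G0 * \<delta> * Y\<^sup>2"
      unfolding gh Hy \<sigma>_def yy by (simp add: algebra_simps)
    ultimately have "\<phi> (p + h) \<ge> 0" using abs_le_D2[OF diff] by linarith
    then have "p + h \<notin> \<Omega>" using chartD[OF d(2)[OF hd]] by simp
    then show "p + y + (- (shape y \<bullet> y) / 2 + \<delta> * (y \<bullet> y)) *\<^sub>R n\<^sub>p \<notin> \<Omega>"
      unfolding h_def \<sigma>_def by (simp add: add.assoc)
  qed
qed

text \<open>Positivity of \<open>u\<close> inside makes \<open>G p \<bullet> v \<ge> 0\<close> for
  every inward \<open>v\<close>, hence \<open>G p\<close> is normal. The one-sided normal derivative
  fixes its length and sign.\<close>

lemma boundary_gradient:
  assumes cu: "continuous_on (closure \<Omega>) u" and cG: "continuous_on (closure \<Omega>) G"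
    and gu: "\<And>x. x \<in> \<Omega> \<Longrightarrow> GDERIV u x :> G x" and u_pos: "\<And>x. x \<in> \<Omega> \<Longrightarrow> u x > 0" and up: "u p = 0"
    and nd: "has_normal_derivative u \<Omega> p (- \<kappa>)"
  shows "G p = - \<kappa> *\<^sub>R n\<^sub>p" and "\<kappa> \<ge> 0"
proof -
  have pc: "p \<in> closure \<Omega>" using p(2) by (simp add: frontier_def)
  have \<phi>p: "\<phi> p = 0" using frontier_iff p by blast
  have slope: "\<exists>d>0. \<forall>t. 0 < t \<longrightarrow> t < d \<longrightarrow> (\<exists>l. u (p + t *\<^sub>R v) = t * l \<and> \<bar>l - G p \<bullet> v\<bar> < e)"
    if v: "g p \<bullet> v < 0" and e: "e > 0" for v e
  proof -
    obtain d1 where d1: "d1 > 0" "\<And>t. 0 < t \<Longrightarrow> t < d1 \<Longrightarrow> p + t *\<^sub>R v \<in> \<Omega>" using inward[OF p(1) \<phi>p v] by blast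
    have "continuous_on (closure \<Omega>) (\<lambda>x. G x \<bullet> v)" using cG by (intro continuous_intros)
    then obtain d2 where d2: "d2 > 0" "\<And>x. x \<in> closure \<Omega> \<Longrightarrow> dist x p < d2 \<Longrightarrow> \<bar>G x \<bullet> v - G p \<bullet> v\<bar> < e"
      unfolding continuous_on_iff dist_real_def using pc e by blast
    define d where "d = min d1 (d2 / (norm v + 1))"
    have d: "d > 0" unfolding d_def using d1 d2 by (simp add: add_nonneg_pos)
    show ?thesis
    proof (rule exI[of _ d], intro conjI d allI impI)
      fix t assume t: "0 < t" "t < d"
      have in\<Omega>: "p + s *\<^sub>R v \<in> \<Omega>" if "0 < s" "s \<le> t" for s using d1(2)[of s] that t unfolding d_def by simp
      obtain z where z: "0 < z" "z < t" "u (p + t *\<^sub>R v) - u p = t * (G (p + z *\<^sub>R v) \<bullet> v)"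
        by (rule mean_value_segment[OF t(1) in\<Omega> pc cu gu])
      have zO: "p + z *\<^sub>R v \<in> closure \<Omega>" using in\<Omega>[of z] z closure_subset by auto
      have "dist (p + z *\<^sub>R v) p < d2"
      proof -
        have "z < d2 / (norm v + 1)" using z t unfolding d_def by simp
        then have "z * (norm v + 1) < d2" by (simp add: pos_less_divide_eq add_nonneg_pos)
        then have "z * norm v < d2" using z(1) by (simp add: algebra_simps)
        then show ?thesis using z(1) by (simp add: dist_norm)
      qed
      then show "\<exists>l. u (p + t *\<^sub>R v) = t * l \<and> \<bar>l - G p \<bullet> v\<bar> < e"
        using z(3) up d2(2)[OF zO] by auto
    qed
  qed
  have nonneg: "G p \<bullet> v \<ge> 0" if v: "g p \<bullet> v < 0" for v
  proof (rule ccontr)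
    assume neg: "\<not> G p \<bullet> v \<ge> 0"
    then have "- (G p \<bullet> v) > 0" by simp
    from slope[OF v this] obtain d where d: "d > 0" "\<And>t. 0 < t \<Longrightarrow> t < d \<Longrightarrow> \<exists>l. u (p + t *\<^sub>R v) = t * l \<and> \<bar>l - G p \<bullet> v\<bar> < - (G p \<bullet> v)" by blast
    obtain d1 where d1: "d1 > 0" "\<And>t. 0 < t \<Longrightarrow> t < d1 \<Longrightarrow> p + t *\<^sub>R v \<in> \<Omega>" using inward[OF p(1) \<phi>p v] by blast
    define t where "t = min d d1 / 2"
    have t: "0 < t" "t < d" "t < d1" unfolding t_def using d d1 by auto
    obtain l where l: "u (p + t *\<^sub>R v) = t * l" "\<bar>l - G p \<bullet> v\<bar> < - (G p \<bullet> v)" using d(2)[OF t(1,2)] by blast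
    then have "l < 0" by linarith
    then have "u (p + t *\<^sub>R v) < 0" using l(1) t(1) by (simp add: mult_pos_neg)
    then show False using u_pos[OF d1(2)[OF t(1,3)]] by simp
  qed
  have gnp: "g p \<bullet> n\<^sub>p = norm (g p)" using np_g by (simp add: inner_commute)
  have tang: "G p \<bullet> v \<ge> 0" if v: "n\<^sub>p \<bullet> v = 0" for v
  proof (rule ccontr)
    assume neg: "\<not> G p \<bullet> v \<ge> 0"
    have gv: "g p \<bullet> v = 0" by (subst g_\<nu>[OF p(1)]) (simp add: v)
    \<comment> \<open>A tangent vector tilted inward by \<eta> is inward. With this \<eta> the tilt
      can make up for at most half of a negative \<open>G p \<bullet> v\<close>; the summand 1 keeps
      \<open>m\<close> positive.\<close>
    define m where "m = \<bar>G p \<bullet> n\<^sub>p\<bar> + 1"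
    have m: "m > 0" "- m \<le> G p \<bullet> n\<^sub>p" unfolding m_def by auto
    define \<eta> where "\<eta> = - (G p \<bullet> v) / (2 * m)"
    have \<eta>: "\<eta> > 0" unfolding \<eta>_def using neg m(1) by (intro divide_pos_pos) auto
    have "g p \<bullet> (v - \<eta> *\<^sub>R n\<^sub>p) < 0" using gv gnp g_p_pos \<eta> by (simp add: inner_diff_right)
    from nonneg[OF this] have "\<eta> * (G p \<bullet> n\<^sub>p) \<le> G p \<bullet> v" by (simp add: inner_diff_right)
    moreover have "\<eta> * (- m) \<le> \<eta> * (G p \<bullet> n\<^sub>p)" using \<eta> m(2) by (intro mult_left_mono) auto
    moreover have "\<eta> * (- m) = (G p \<bullet> v) / 2" unfolding \<eta>_def using m(1) by simp
    ultimately show False using neg by linarith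
  qed
  have tang0: "G p \<bullet> v = 0" if "n\<^sub>p \<bullet> v = 0" for v
    using tang[OF that] tang[of "- v"] that by simp
  have "g p \<bullet> (- n\<^sub>p) < 0" using gnp g_p_pos by simp
  note slope_n = slope[OF this] and nonneg_n = nonneg[OF this]
  have D1: "((\<lambda>t. u (p + t *\<^sub>R n\<^sub>p)) has_real_derivative (G p \<bullet> n\<^sub>p)) (at_left 0)"
    unfolding has_field_derivative_iff tendsto_iff
  proof (intro allI impI)
    fix e :: real assume e: "e > 0"
    obtain d where d: "d > 0" "\<And>t. 0 < t \<Longrightarrow> t < d \<Longrightarrow> \<exists>l. u (p + t *\<^sub>R (- n\<^sub>p)) = t * l \<and> \<bar>l - G p \<bullet> (- n\<^sub>p)\<bar> < e"
      using slope_n[OF e] by blast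
    show "\<forall>\<^sub>F t in at_left 0. dist ((u (p + t *\<^sub>R n\<^sub>p) - u (p + 0 *\<^sub>R n\<^sub>p)) / (t - 0)) (G p \<bullet> n\<^sub>p) < e"
    proof (rule eventually_at_leftI[of "- d"])
      fix t assume t: "t \<in> {- d<..<0}"
      then obtain l where l: "u (p + (- t) *\<^sub>R (- n\<^sub>p)) = (- t) * l" "\<bar>l - G p \<bullet> (- n\<^sub>p)\<bar> < e" using d(2)[of "- t"] by auto
      then have "(u (p + t *\<^sub>R n\<^sub>p) - u (p + 0 *\<^sub>R n\<^sub>p)) / (t - 0) = - l" using t up by simp
      then show "dist ((u (p + t *\<^sub>R n\<^sub>p) - u (p + 0 *\<^sub>R n\<^sub>p)) / (t - 0)) (G p \<bullet> n\<^sub>p) < e"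
        using l(2) by (simp add: dist_real_def abs_minus_commute)
    qed (use d in simp)
  qed
  have D2: "((\<lambda>t. u (p + t *\<^sub>R n\<^sub>p)) has_real_derivative - \<kappa>) (at_left 0)"
    using nd unfolding has_normal_derivative_def outward_normal[OF p] .
  have Gn: "G p \<bullet> n\<^sub>p = - \<kappa>"
    using D1 D2 unfolding has_field_derivative_iff by (rule tendsto_unique[OF trivial_limit_at_left_real])
  then show "\<kappa> \<ge> 0" using nonneg_n by simp
  show "G p = - \<kappa> *\<^sub>R n\<^sub>p"
  proof -
    define z where "z = G p - (G p \<bullet> n\<^sub>p) *\<^sub>R n\<^sub>p"
    have nz: "n\<^sub>p \<bullet> z = 0" unfolding z_def using np_unit by (simp add: inner_diff_right inner_commute)
    have "G p \<bullet> z = 0" by (rule tang0[OF nz])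
    then have "z \<bullet> z = 0" using nz unfolding z_def by (simp add: inner_diff_left)
    then show ?thesis unfolding z_def Gn by (simp add: eq_neg_iff_add_eq_0)
  qed
qed

end

section \<open>Charts of a regular domain and the final dichotomy\<close>

lemma boundary_chart_exists:
  fixes \<Omega> :: "'a::euclidean_space set"
  assumes "regular_domain \<Omega>" "p \<in> frontier \<Omega>"
  shows "\<exists>U \<phi> g H. boundary_chart \<Omega> U \<phi> g H p"
proof -
  have "smooth_boundary \<Omega>" using assms(1) unfolding regular_domain_def by simp
  from bspec[OF this[unfolded smooth_boundary_def] assms(2)]
  obtain U and \<phi> :: "'a \<Rightarrow> real" where U: "open U" "p \<in> U" "smooth_on U \<phi>"
    "\<forall>x\<in>U. \<exists>v. frechet_derivative \<phi> (at x) v \<noteq> 0" "\<Omega> \<inter> U = {x \<in> U. \<phi> x < 0}"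
    by (elim exE conjE)
  have C2: "Ck_on 2 U \<phi>" using U(3) unfolding smooth_on_def by blast
  note gl = Ck_on_2_grad_lap[OF C2]
  obtain H where H: "(grad \<phi> has_derivative H) (at p)" using gl U(2) unfolding grad_lap_on_def by blast
  have nz: "grad \<phi> x \<noteq> 0" if x: "x \<in> U" for x
  proof
    assume "grad \<phi> x = 0"
    then have "(\<phi> has_derivative (\<lambda>h. 0)) (at x)" using grad_lap_onD(1)[OF gl x] unfolding gderiv_def by simp
    then have "frechet_derivative \<phi> (at x) = (\<lambda>h. 0)" by (rule frechet_derivative_at[symmetric])
    then show False using bspec[OF U(4) x] by simp
  qed
  have "boundary_chart \<Omega> U \<phi> (grad \<phi>) H p"
  proof
    show "open \<Omega>" using assms(1) unfolding regular_domain_def by simp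
  qed (use U assms(2) grad_lap_onD(1)[OF gl] H nz in auto)
  then show ?thesis by blast
qed

theorem theorem1p1:
  fixes \<Omega> :: "(real ^ 'n) set" and f :: "real \<Rightarrow> real" and \<kappa> :: real
    and u :: "real ^ 'n \<Rightarrow> real"
  assumes "CARD('n) \<ge> 2"
    and "regular_domain \<Omega>"
    and "Ck_on 1 UNIV f"
    and "Ck_on 3 \<Omega> u"
    and "C1_up_to_boundary \<Omega> u"
    and "bounded (u ` \<Omega>)"
    and "\<And>x. x \<in> \<Omega> \<Longrightarrow> laplacian u x + f (u x) = 0"
    and "\<And>x. x \<in> \<Omega> \<Longrightarrow> u x > 0"
    and "\<And>p. p \<in> frontier \<Omega> \<Longrightarrow> u p = 0"
    and "\<And>p. p \<in> frontier \<Omega> \<Longrightarrow> has_normal_derivative u \<Omega> p (- \<kappa>)"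
    and "\<exists>F :: real \<Rightarrow> real. (\<forall>s. (F has_real_derivative f s) (at s)) \<and> (\<forall>s. F s \<le> 0) \<and>
           \<kappa>\<^sup>2 + 2 * F 0 \<ge> 0"
  shows "(\<forall>p\<in>frontier \<Omega>. mean_curvature \<Omega> p < 0) \<or>
    (\<exists>(x0 :: real ^ 'n) (g :: real \<Rightarrow> real) (a :: real ^ 'n).
       \<Omega> = {x. a \<bullet> (x - x0) > 0} \<and> (\<forall>x\<in>\<Omega>. u x = g (a \<bullet> (x - x0))))"
proof -
  have op: "open \<Omega>" and conn: "connected \<Omega>" and ne: "frontier \<Omega> \<noteq> {}"
    using assms(2) unfolding regular_domain_def by auto
  obtain F where F: "\<And>s. (F has_real_derivative f s) (at s)" "\<And>s. F s \<le> 0" "\<kappa>\<^sup>2 + 2 * F 0 \<ge> 0"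
    using assms(11) by blast
  define f' where "f' s = frechet_derivative f (at s) 1" for s
  have f': "(f has_real_derivative f' s) (at s)" for s
  proof -
    have fd: "(f has_derivative frechet_derivative f (at s)) (at s)"
      using assms(3) frechet_derivative_works by (auto simp: One_nat_def)
    interpret D: bounded_linear "frechet_derivative f (at s)" using fd by (rule has_derivative_bounded_linear)
    have "frechet_derivative f (at s) h = f' s * h" for h
      using D.scaleR[of h 1] unfolding f'_def by simp
    then have "frechet_derivative f (at s) = (*) (f' s)" by blast
    then show ?thesis using fd unfolding has_field_derivative_def by simp
  qed
  have cont_f': "continuous_on UNIV f'" using assms(3) unfolding f'_def by (simp add: One_nat_def)
  obtain G where cu: "continuous_on (closure \<Omega>) u" and cG: "continuous_on (closure \<Omega>) G"
    and Gu: "\<And>x. x \<in> \<Omega> \<Longrightarrow> GDERIV u x :> G x"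
    using assms(5) unfolding C1_up_to_boundary_def by blast
  have pd2: "Ck_on 2 \<Omega> (pd u b)" for b using assms(4) by (simp add: numeral_3_eq_3 numeral_2_eq_2)
  have u2: "Ck_on 2 \<Omega> u"
    using assms(4) by (auto simp: numeral_3_eq_3 numeral_2_eq_2 intro!: continuous_at_imp_continuous_on differentiable_imp_continuous_within)
  have lap: "laplacian u x = - f (u x)" if "x \<in> \<Omega>" for x using assms(7)[OF that] by simp
  have G_grad: "grad u x = G x" if "x \<in> \<Omega>" for x
    using grad_lap_onD(1)[OF Ck_on_2_grad_lap[OF u2] that] Gu[OF that] by (rule GDERIV_unique)
  obtain M where M: "\<And>x. x \<in> \<Omega> \<Longrightarrow> \<bar>u x\<bar> \<le> M" using assms(6) unfolding bounded_iff by auto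
  have grad_p: "G p = - \<kappa> *\<^sub>R outward_normal \<Omega> p" "\<kappa> \<ge> 0" "norm (G p) = \<kappa>" if p: "p \<in> frontier \<Omega>" for p
  proof -
    obtain U \<phi> g H where "boundary_chart \<Omega> U \<phi> g H p" using boundary_chart_exists[OF assms(2) p] by blast
    then interpret C: boundary_chart \<Omega> U \<phi> g H p .
    note bg = C.boundary_gradient[OF cu cG Gu assms(8) assms(9)[OF p] assms(10)[OF p]]
    have Gp: "G p = - \<kappa> *\<^sub>R C.\<nu> p" by (rule bg(1))
    then show "G p = - \<kappa> *\<^sub>R outward_normal \<Omega> p" unfolding C.outward_normal[OF C.p] .
    show k: "\<kappa> \<ge> 0" by (rule bg(2))
    have "norm (G p) = \<bar>- \<kappa>\<bar> * norm (C.\<nu> p)" unfolding Gp by (rule norm_scaleR)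
    then show "norm (G p) = \<kappa>" using k C.norm_\<nu>[OF C.p(1)] by simp
  qed
  \<comment> \<open>The bound enters as \<open>\<bar>M\<bar>\<close> to meet the requirement that it
    be nonnegative.\<close>
  interpret overdetermined \<Omega> u f f' F \<kappa> "\<bar>M\<bar>" "\<kappa>\<^sup>2 + 2 * F 0" G "\<lambda>b. grad (pd u b)"
  proof
    show "grad_lap_on \<Omega> u G (\<lambda>x. - f (u x))"
      by (rule grad_lap_on_cong[OF op Ck_on_2_grad_lap[OF u2]]) (auto simp: G_grad lap)
    fix b :: "real ^ 'n" assume b: "b \<in> Basis"
    show "grad_lap_on \<Omega> (\<lambda>x. G x \<bullet> b) (grad (pd u b)) (\<lambda>x. - f' (u x) * (G x \<bullet> b))"
    proof (rule grad_lap_on_cong[OF op Ck_on_2_grad_lap[OF pd2[of b]]])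
      fix x assume x: "x \<in> \<Omega>"
      show Gb: "pd u b x = G x \<bullet> b" using inner_grad[OF b, of u x] G_grad[OF x] by simp
      show "laplacian (pd u b) x = - f' (u x) * (G x \<bullet> b)"
        using laplacian_pd[OF op x assms(4) b lap f'] unfolding Gb .
    qed simp
  next
    fix x assume "x \<in> \<Omega>"
    then show "u x \<le> \<bar>M\<bar>" using M[of x] by auto
  qed (fact op conn ne cu cG assms(8) abs_ge_zero assms(9) grad_p(3) F f' cont_f' refl)+
  show ?thesis
  proof (cases "\<forall>p\<in>frontier \<Omega>. mean_curvature \<Omega> p < 0")
    case False
    then obtain p where p: "p \<in> frontier \<Omega>" "mean_curvature \<Omega> p \<ge> 0" by force
    obtain U \<phi> g H where "boundary_chart \<Omega> U \<phi> g H p" using boundary_chart_exists[OF assms(2) p(1)] by blast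
    then interpret C: boundary_chart \<Omega> U \<phi> g H p .
    obtain r where r: "r > 0" "ball (p - r *\<^sub>R C.\<nu> p) r \<subseteq> \<Omega>" using C.interior_ball by blast
    note \<nu>1 = C.norm_\<nu>[OF C.p(1)]
    have \<kappa>: "\<kappa> > 0" by (rule \<kappa>_pos[OF grad_p(2)[OF p(1)] \<nu>1 r p(1)])
    have Gp: "G p = - \<kappa> *\<^sub>R C.\<nu> p" using grad_p(1)[OF p(1)] unfolding C.outward_normal[OF C.p] .
    \<comment> \<open>If \<open>P < K\<close> held throughout, \<open>trace_shape_neg\<close> would
      make the trace at \<open>p\<close> negative. Since the dimension is at least 2, the mean
      curvature has the sign of that trace, against the choice of \<open>p\<close>.\<close>
    have "\<exists>z\<in>\<Omega>. P z = \<kappa>\<^sup>2 + 2 * F 0"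
    proof (rule ccontr)
      assume nex: "\<not> (\<exists>z\<in>\<Omega>. P z = \<kappa>\<^sup>2 + 2 * F 0)"
      have "P x < \<kappa>\<^sup>2 + 2 * F 0" if "x \<in> \<Omega>" for x
        using modica_estimate[of x] nex that closure_subset[of \<Omega>] by force
      from trace_shape_neg[OF \<kappa> this p(1) \<nu>1 Gp r C.shape_linear C.shape_sym C.shape_np C.touching_graph]
      show False using p(2) assms(1) unfolding C.mean_curvature_eq by (simp add: zero_le_divide_iff)
    qed
    then obtain z where z: "z \<in> \<Omega>" "P z = \<kappa>\<^sup>2 + 2 * F 0" by (elim bexE)
    show ?thesis
      using half_space_of_P_constant[OF \<kappa> P_constant[OF z]] by (rule disjI2)
  qed simp
qed

end
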